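(* Let $q\ge 3$ and assume the Generalized Riemann Hypothesis for $L(s,\chi)$ for every non-principal Dirichlet character $\chi$ modulo $q$. Let $a,b$ be distinct invertible residue classes modulo $q$. Then there is a constant $C$ (depending on $q,a,b$) such that, as $x\to\infty$, \[\frac{1}{x}\int_{ 2}^x \bigl(\pi_{1/2}(u;q,a)-\pi_{1/2}(u;q,b)\bigr)\mathrm{d}u=-\mathrm{M}(q;a,b)\log \log x+C+O\left(\frac{\log \log x}{\log x}\right).\]
   Context: For $x\ge 2$, $\pi_{1/2}(x;q,a)=\sum_{p\le x,\ p\equiv a \bmod q} p^{-1/2}$, the sum over primes. For a non-principal Dirichlet character $\chi$ mod $q$, $m_\chi:=\mathrm{ord}_{s=1/2}L(s,\chi)$. Let $r(a)=\#\{x\in(\mathbb Z/q\mathbb Z)^\times: x^2=a\}$ and $\mathrm{M}(q;a,b)=\frac{1}{2\varphi(q)}\Bigl(r(a)-r(b)+2\sum_{\chi\ne\chi_0}(\chi(a)-\chi(b))m_\chi\Bigr)$, the sum over non-principal characters mod $q$. *)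

theory Defs
  imports "HOL-Complex_Analysis.Complex_Analysis" "HOL-Number_Theory.Number_Theory"
    "HOL-Library.Landau_Symbols"
begin

definition dirichlet_char :: "nat \<Rightarrow> (nat \<Rightarrow> complex) \<Rightarrow> bool" where
  "dirichlet_char q chi \<longleftrightarrow>
     (\<forall>n. chi (n + q) = chi n) \<and>
     (\<forall>m n. chi (m * n) = chi m * chi n) \<and>
     (\<forall>n. chi n \<noteq> 0 \<longleftrightarrow> coprime n q)"

definition principal_char :: "nat \<Rightarrow> nat \<Rightarrow> complex" where
  "principal_char q n = (if coprime n q then 1 else 0)"

definition nonprincipal_chars :: "nat \<Rightarrow> (nat \<Rightarrow> complex) set" where
  "nonprincipal_chars q = {chi. dirichlet_char q chi \<and> chi \<noteq> principal_char q}"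

text \<open>Dirichlet L-function given by its Dirichlet series (partial sums limit);
  for non-principal characters this converges and is holomorphic on Re s > 0,
  which contains every point used below.\<close>
definition dirichlet_L :: "(nat \<Rightarrow> complex) \<Rightarrow> complex \<Rightarrow> complex" where
  "dirichlet_L chi s = (\<Sum>n. chi n / (of_nat n) powr s)"

definition GRH_mod :: "nat \<Rightarrow> bool" where
  "GRH_mod q \<longleftrightarrow> (\<forall>chi\<in>nonprincipal_chars q. \<forall>s. Re s > 1/2 \<longrightarrow> dirichlet_L chi s \<noteq> 0)"

definition m_chi :: "(nat \<Rightarrow> complex) \<Rightarrow> int" where
  "m_chi chi = zorder (dirichlet_L chi) (1/2)"

definition pi_half :: "real \<Rightarrow> nat \<Rightarrow> nat \<Rightarrow> real" where
  "pi_half x q a = (\<Sum>p | prime p \<and> real p \<le> x \<and> [p = a] (mod q). 1 / sqrt (real p))"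

definition r_sq :: "nat \<Rightarrow> nat \<Rightarrow> nat" where
  "r_sq q a = card {x\<in>{0..<q}. coprime x q \<and> [x ^ 2 = a] (mod q)}"

definition M_const :: "nat \<Rightarrow> nat \<Rightarrow> nat \<Rightarrow> complex" where
  "M_const q a b = (1 / (2 * of_nat (totient q))) *
     (of_int (int (r_sq q a) - int (r_sq q b)) +
      2 * (\<Sum>chi\<in>nonprincipal_chars q. (chi a - chi b) * of_int (m_chi chi)))"

end

theory Submission
  imports Defs
begin

text \<open>By orthogonality of characters it suffices to treat \<open>\<Sum>p\<le>x. chi p / sqrt p * (1 - p / x)\<close> for each
  non-principal \<open>chi\<close>. With weights \<open>ln p\<close> inserted, the prime powers of even exponent cancel in
  \<open>- L'/L(s, chi) + L'/L(2 s, chi^2)\<close>, so this combination generates the sum up to \<open>O(1)\<close>. Under GRH it is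
  holomorphic for \<open>Re s > 1/2\<close>, and at \<open>1/2\<close> it has at most a simple pole, of residue
  \<open>- (m_chi + 1/2)\<close> or \<open>- m_chi\<close> according to whether \<open>chi^2\<close> is principal. Perron's formula with
  the kernel \<open>x^w / (w (w + 1))\<close> on \<open>Re s = 1/2 + 1 / ln x\<close> turns the pole into \<open>ln x\<close>; as the logarithmic
  derivative is locally a sum of \<open>O(ln t)\<close> terms \<open>1 / (s - \<rho>)\<close> with \<open>Re \<rho> \<le> 1/2\<close>, each of which
  has mean value \<open>O(ln ln x)\<close> on that line, the error is \<open>O(ln ln x)\<close>. Partial summation
  removes the weights \<open>ln p\<close>. No functional equation is needed.\<close>

section \<open>Dirichlet characters\<close>

text \<open>Averaging over \<open>u\<close> replaces the sharp cutoff at \<open>x\<close> by the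
  weight \<open>1 - p / x\<close>, whose kernel decays quadratically in the height, so the growth
  \<open>ln t\<close> of the logarithmic derivative does no harm there. The obstacle is horizontal:
  the line must come within \<open>1 / ln x\<close> of \<open>Re s = 1/2\<close> to keep
  \<open>x^w\<close> bounded, zeros may lie on \<open>Re s = 1/2\<close>, and the pointwise bound
  \<open>ln x\<close> would be as large as the main term. Averaging \<open>1 / |s - \<rho>|\<close>
  over a unit window costs only \<open>ln (ln x)\<close>, which is where the error term comes from.
  The argument of \<open>L(2 s, chi^2)\<close> is then at the edge \<open>Re (2 s) = 1\<close>;
  possible zeros there are treated by the same averaging, and GRH supplies
  \<open>L(1, chi^2) \<noteq> 0\<close> if \<open>chi^2\<close> is not principal. If it is
  principal, the pole of \<open>L(2 s, chi^2)\<close> at 1/2 adds 1/2 to the residue; counting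
  square roots by characters selects exactly these \<open>chi\<close>, which explains
  \<open>r(a) - r(b)\<close>. The constant \<open>C\<close> arises during partial summation as the
  limit of an integral of the error \<open>O(ln (ln u))\<close> against a weight of size
  \<open>1 / (u (ln u)^2)\<close>.\<close>

lemma dirichlet_char_cong:
  assumes "dirichlet_char q chi" "[m = n] (mod q)"
  shows "chi m = chi n"
proof -
  have per: "chi (n + k * q) = chi n" for n k
  proof (induction k)
    case (Suc k)
    have "chi (n + Suc k * q) = chi ((n + k * q) + q)" by (simp add: algebra_simps)
    also have "\<dots> = chi (n + k * q)" using assms(1) unfolding dirichlet_char_def by blast
    finally show ?case using Suc by simp
  qed simp
  have "chi k = chi (k mod q)" for k using per[of "k mod q" "k div q"] by simp
  then show ?thesis using assms(2) by (metis cong_def)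
qed

lemma dirichlet_char_mult: "dirichlet_char q chi \<Longrightarrow> chi (m * n) = chi m * chi n"
  unfolding dirichlet_char_def by blast

lemma dirichlet_char_nonzero_iff: "dirichlet_char q chi \<Longrightarrow> chi n \<noteq> 0 \<longleftrightarrow> coprime n q"
  unfolding dirichlet_char_def by blast

lemma dirichlet_char_one:
  assumes "dirichlet_char q chi"
  shows "chi (Suc 0) = 1"
  using dirichlet_char_mult[OF assms, of "Suc 0" "Suc 0"] dirichlet_char_nonzero_iff[OF assms, of "Suc 0"] by simp

lemma dirichlet_char_power:
  assumes "dirichlet_char q chi"
  shows "chi (n ^ k) = chi n ^ k"
  by (induction k) (use dirichlet_char_one[OF assms] dirichlet_char_mult[OF assms] in auto)

lemma dirichlet_char_power_totient:
  assumes "dirichlet_char q chi" "coprime n q"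
  shows "chi n ^ totient q = 1"
  using dirichlet_char_cong[OF assms(1) euler_theorem[OF assms(2)]]
  by (simp add: dirichlet_char_power[OF assms(1)] dirichlet_char_one[OF assms(1)])

lemma norm_dirichlet_char:
  assumes "dirichlet_char q chi" "q > 0"
  shows "norm (chi n) = (if coprime n q then 1 else 0)"
proof (cases "coprime n q")
  case True
  then have "norm (chi n) ^ totient q = 1"
    by (metis dirichlet_char_power_totient[OF assms(1)] norm_one norm_power)
  moreover have "totient q > 0" using assms(2) by simp
  ultimately show ?thesis using True by (metis norm_ge_zero power_eq_1_iff real_norm_def abs_norm_cancel less_numeral_extra(3))
next
  case False
  then show ?thesis using dirichlet_char_nonzero_iff[OF assms(1)] by auto
qed

lemma norm_dirichlet_char_le_1: "dirichlet_char q chi \<Longrightarrow> q > 0 \<Longrightarrow> norm (chi n) \<le> 1"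
  by (simp add: norm_dirichlet_char)

lemma dirichlet_char_principal: "dirichlet_char q (principal_char q)"
proof -
  have "coprime (n + q) q \<longleftrightarrow> coprime n q" for n by (simp only: coprime_iff_gcd_eq_1 gcd_add1)
  then show ?thesis unfolding dirichlet_char_def principal_char_def by simp
qed

lemma dirichlet_char_times:
  "dirichlet_char q chi \<Longrightarrow> dirichlet_char q psi \<Longrightarrow> dirichlet_char q (\<lambda>n. chi n * psi n)"
  unfolding dirichlet_char_def by auto

lemma dirichlet_char_square:
  "dirichlet_char q chi \<Longrightarrow> dirichlet_char q (\<lambda>n. chi n ^ 2)"
  using dirichlet_char_times[of q chi chi] by (simp add: power2_eq_square)

lemma dirichlet_char_cnj: "dirichlet_char q chi \<Longrightarrow> dirichlet_char q (\<lambda>n. cnj (chi n))"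
  unfolding dirichlet_char_def by auto

lemma dirichlet_char_times_cnj:
  assumes "dirichlet_char q chi" "q > 0"
  shows "chi n * cnj (chi n) = principal_char q n"
  using norm_dirichlet_char[OF assms, of n] by (simp add: complex_norm_square[symmetric] principal_char_def)

lemma dirichlet_char_times_principal:
  "dirichlet_char q chi \<Longrightarrow> principal_char q n * chi n = chi n"
  using dirichlet_char_nonzero_iff[of q chi n] by (auto simp: principal_char_def)

text \<open>A character is determined by one period, and its values there are 0 or roots of unity of
  order dividing \<open>totient q\<close>. Restriction to \<open>{..<q}\<close> therefore embeds the
  characters into a finite space of extensional functions.\<close>

lemma finite_dirichlet_chars:
  assumes "q > 0"
  shows "finite {chi. dirichlet_char q chi}"
proof -
  let ?V = "insert 0 {z::complex. z ^ totient q = 1}"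
  have tp: "totient q > 0" using assms by simp
  have "finite ?V" using finite_roots_unity[of "totient q"] tp by simp
  then have "finite ({..<q} \<rightarrow>\<^sub>E ?V)" by (intro finite_PiE) auto
  moreover have "(\<lambda>chi. restrict chi {..<q}) ` {chi. dirichlet_char q chi} \<subseteq> {..<q} \<rightarrow>\<^sub>E ?V"
  proof (rule image_subsetI)
    fix chi assume "chi \<in> {chi. dirichlet_char q chi}"
    then have chi: "dirichlet_char q chi" by simp
    have "chi n \<in> ?V" for n
      using dirichlet_char_power_totient[OF chi, of n] dirichlet_char_nonzero_iff[OF chi, of n] by blast
    then show "restrict chi {..<q} \<in> {..<q} \<rightarrow>\<^sub>E ?V" by (simp add: restrict_PiE_iff)
  qed
  moreover have "inj_on (\<lambda>chi. restrict chi {..<q}) {chi. dirichlet_char q chi}"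
  proof (rule inj_onI)
    fix chi psi
    assume a: "chi \<in> {chi. dirichlet_char q chi}" "psi \<in> {chi. dirichlet_char q chi}"
      and eq: "restrict chi {..<q} = restrict psi {..<q}"
    show "chi = psi"
    proof
      fix n
      have "chi n = chi (n mod q)" "psi n = psi (n mod q)"
        using a by (auto intro!: dirichlet_char_cong[where q=q])
      moreover have "n mod q \<in> {..<q}" using assms by simp
      ultimately show "chi n = psi n" using fun_cong[OF eq, of "n mod q"] by simp
    qed
  qed
  ultimately show ?thesis by (meson finite_imageD finite_subset)
qed

text \<open>Encodes a character of the subgroup \<open>{n. psi n \<noteq> 0}\<close> of the residue classes coprime to \<open>q\<close>, extended by 0.\<close>

definition partial_char :: "nat \<Rightarrow> (nat \<Rightarrow> complex) \<Rightarrow> bool" where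
  "partial_char q psi \<longleftrightarrow> (\<forall>m n. [m = n] (mod q) \<longrightarrow> psi m = psi n) \<and> (\<forall>n. psi n \<noteq> 0 \<longrightarrow> coprime n q) \<and>
     psi (Suc 0) = 1 \<and> (\<forall>m n. psi m \<noteq> 0 \<longrightarrow> psi n \<noteq> 0 \<longrightarrow> psi (m * n) = psi m * psi n)"

lemma partial_char_power:
  assumes "partial_char q psi" "psi n \<noteq> 0"
  shows "psi (n ^ k) = psi n ^ k"
proof (induction k)
  case 0
  show ?case using assms by (simp add: partial_char_def)
next
  case (Suc k)
  then have "psi (n ^ k) \<noteq> 0" using assms by simp
  then have "psi (n * n ^ k) = psi n * psi (n ^ k)" using assms unfolding partial_char_def by blast
  then show ?case using Suc by simp
qed

text \<open>The support of \<open>psi\<close> is closed under division: by Euler's theorem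
  \<open>m ^ (totient q - 1)\<close> inverts \<open>m\<close> modulo \<open>q\<close>, and it stays
  in the support because powers do.\<close>

lemma partial_char_cancel:
  assumes pc: "partial_char q psi" and q: "q > 0" and "psi m \<noteq> 0" "psi (m * n) \<noteq> 0"
  shows "psi n \<noteq> 0"
proof -
  have cop: "coprime m q" using assms unfolding partial_char_def by blast
  have tp: "totient q > 0" using q by simp
  let ?m = "m ^ (totient q - 1)"
  have "m * ?m = m ^ totient q" using tp by (metis Suc_diff_1 power_Suc)
  then have "?m * (m * n) = m ^ totient q * n" by (metis mult.assoc mult.commute)
  then have "[?m * (m * n) = 1 * n] (mod q)"
    using cong_scalar_right[OF euler_theorem[OF cop], of n] by (simp only:)
  moreover have "psi ?m \<noteq> 0" using partial_char_power[OF pc assms(3)] assms(3) by simp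
  then have "psi (?m * (m * n)) \<noteq> 0" using assms unfolding partial_char_def by simp
  ultimately show ?thesis using pc unfolding partial_char_def by (metis mult_1)
qed

text \<open>The subgroup generated by the support and \<open>g\<close> consists of the classes
  \<open>h * g ^ i\<close>, and \<open>psi h * z ^ i\<close> is the only possible value there. Since
  \<open>k\<close> is the order of \<open>g\<close> modulo the support,
  \<open>z ^ k = psi (g ^ k)\<close> is the only compatibility condition.\<close>

lemma partial_char_extend_step:
  assumes pc: "partial_char q psi" and q: "q > 0" and g: "coprime g q"
    and k: "k > 0" "psi (g ^ k) \<noteq> 0" "\<And>r. 0 < r \<Longrightarrow> r < k \<Longrightarrow> psi (g ^ r) = 0"
    and z: "z ^ k = psi (g ^ k)"
  shows "\<exists>psi'. partial_char q psi' \<and> psi' g = z \<and> (\<forall>n. psi n \<noteq> 0 \<longrightarrow> psi' n = psi n)"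
proof -
  have cong: "psi m = psi n" if "[m = n] (mod q)" for m n using pc that unfolding partial_char_def by blast
  have cop: "psi n \<noteq> 0 \<Longrightarrow> coprime n q" for n using pc unfolding partial_char_def by blast
  have one: "psi (Suc 0) = 1" using pc unfolding partial_char_def by blast
  have mult: "psi m \<noteq> 0 \<Longrightarrow> psi n \<noteq> 0 \<Longrightarrow> psi (m * n) = psi m * psi n" for m n using pc unfolding partial_char_def by blast
  \<comment> \<open>The new character as a graph, so that independence of the representation
    \<open>h * g ^ i\<close> can be proved before a value is chosen.\<close>
  define rel where "rel = (\<lambda>n v. \<exists>h i. psi h \<noteq> 0 \<and> [n = h * g ^ i] (mod q) \<and> v = psi h * z ^ i)"
  have z0: "z \<noteq> 0" using z k by (metis power_eq_0_iff)
  \<comment> \<open>Cancelling the common power of \<open>g\<close> leaves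
    \<open>h = h' * g ^ d\<close> modulo \<open>q\<close>. After splitting off multiples of
    \<open>k\<close> from \<open>d\<close>, the remaining power of \<open>g\<close> lies in the
    support, so minimality of \<open>k\<close> forces the remainder to be 0.\<close>
  have wd: "psi h * z ^ i = psi h' * z ^ (i + d)"
    if h: "psi h \<noteq> 0" "psi h' \<noteq> 0" and c: "[h * g ^ i = h' * g ^ (i + d)] (mod q)" for h h' i d
  proof -
    have "[g ^ i * h = g ^ i * (h' * g ^ d)] (mod q)" using c by (simp add: power_add mult_ac)
    then have c': "[h = h' * g ^ d] (mod q)"
      using cong_mult_lcancel_nat[of "g ^ i" q] g by simp
    define a r where "a = d div k" and "r = d mod k"
    have d: "g ^ d = (g ^ k) ^ a * g ^ r" unfolding a_def r_def by (metis div_mult_mod_eq mult.commute power_add power_mult)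
    have pa: "psi ((g ^ k) ^ a) = psi (g ^ k) ^ a" by (rule partial_char_power[OF pc k(2)])
    then have h2: "psi (h' * (g ^ k) ^ a) = psi h' * psi (g ^ k) ^ a" using mult[OF h(2)] k(2) by simp
    have "psi ((h' * (g ^ k) ^ a) * g ^ r) = psi h" using cong[OF c'] by (simp add: d mult.assoc)
    then have "psi (g ^ r) \<noteq> 0"
      using partial_char_cancel[OF pc q, of "h' * (g ^ k) ^ a" "g ^ r"] h h2 k(2) by simp
    moreover have "r < k" using k by (simp add: r_def)
    ultimately have "r = 0" using k(3) by blast
    then have "d = k * a" unfolding a_def r_def by (metis mult_div_mod_eq add_0_right)
    have "psi h = psi (h' * (g ^ k) ^ a)" using cong[OF c'] d \<open>r = 0\<close> by simp
    also have "\<dots> = psi h' * z ^ d" unfolding h2 z[symmetric] \<open>d = k * a\<close> by (simp add: power_mult)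
    finally show ?thesis by (simp add: power_add mult_ac)
  qed
  have rel_unique: "v = w" if "rel n v" "rel n w" for n v w
  proof -
    from that obtain h i h' j where h: "psi h \<noteq> 0" "[n = h * g ^ i] (mod q)" "v = psi h * z ^ i"
      "psi h' \<noteq> 0" "[n = h' * g ^ j] (mod q)" "w = psi h' * z ^ j" unfolding rel_def by blast
    have c: "[h * g ^ i = h' * g ^ j] (mod q)" using h by (metis cong_sym cong_trans)
    show ?thesis
    proof (cases "i \<le> j")
      case True
      then show ?thesis using wd[of h h' i "j - i"] h c by simp
    next
      case False
      then show ?thesis using wd[of h' h j "i - j"] h cong_sym[OF c] by simp
    qed
  qed
  \<comment> \<open>The value 0 marks the classes outside the enlarged subgroup; on the subgroup all
    values are nonzero because \<open>z\<close> is.\<close>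
  define psi' where "psi' = (\<lambda>n. if \<exists>v. rel n v then THE v. rel n v else 0)"
  have psi'_eq: "psi' n = v" if "rel n v" for n v
    using that rel_unique unfolding psi'_def by (auto intro!: the_equality)
  have rel0: "v \<noteq> 0" if "rel n v" for n v using that z0 unfolding rel_def by auto
  have psi'_rel: "rel n (psi' n)" if "psi' n \<noteq> 0" for n
  proof -
    have "\<exists>v. rel n v"
    proof (rule ccontr)
      assume "\<nexists>v. rel n v"
      then have "psi' n = 0" by (simp only: psi'_def if_False)
      with that show False by simp
    qed
    then obtain v where "rel n v" by blast
    then show ?thesis using psi'_eq by simp
  qed
  have rel_psi: "rel n (psi n)" if "psi n \<noteq> 0" for n
    unfolding rel_def using that by (intro exI[of _ n] exI[of _ 0]) auto
  have "rel g z" unfolding rel_def by (intro exI[of _ "Suc 0"] exI[of _ 1]) (use one in auto)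
  moreover have "partial_char q psi'"
    unfolding partial_char_def
  proof (intro conjI allI impI)
    fix m n :: nat assume "[m = n] (mod q)"
    then have "rel m = rel n" unfolding rel_def by (intro ext) (metis cong_sym cong_trans)
    then show "psi' m = psi' n" unfolding psi'_def by (simp only:)
  next
    fix n assume "psi' n \<noteq> 0"
    from psi'_rel[OF this] obtain h i where h: "psi h \<noteq> 0" "[n = h * g ^ i] (mod q)" unfolding rel_def by blast
    have "coprime (h * g ^ i) q" using cop[OF h(1)] g by simp
    then show "coprime n q" using h(2) by (metis cong_imp_coprime cong_sym)
  next
    show "psi' (Suc 0) = 1" using psi'_eq[OF rel_psi[of "Suc 0"]] one by simp
  next
    fix m n assume "psi' m \<noteq> 0" "psi' n \<noteq> 0"
    then obtain h i h' j where h: "psi h \<noteq> 0" "[m = h * g ^ i] (mod q)" "psi' m = psi h * z ^ i"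
      "psi h' \<noteq> 0" "[n = h' * g ^ j] (mod q)" "psi' n = psi h' * z ^ j" using psi'_rel unfolding rel_def by meson
    have "rel (m * n) (psi' m * psi' n)" unfolding rel_def
    proof (intro exI conjI)
      show "psi (h * h') \<noteq> 0" using mult h by simp
      show "[m * n = h * h' * g ^ (i + j)] (mod q)" using cong_mult[OF h(2) h(5)] by (simp add: power_add mult_ac)
      show "psi' m * psi' n = psi (h * h') * z ^ (i + j)" using h mult by (simp add: power_add)
    qed
    then show "psi' (m * n) = psi' m * psi' n" by (rule psi'_eq)
  qed
  ultimately show ?thesis using psi'_eq rel_psi by blast
qed

text \<open>By Euler's theorem some positive power of \<open>g\<close> is congruent to 1 and hence
  in the support. The least exponent whose power lies in the support is the order of
  \<open>g\<close> in the quotient group, as the extension step requires.\<close>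

lemma partial_char_extend_root:
  assumes pc: "partial_char q psi" and q: "q > 0" and g: "coprime g q"
  shows "\<exists>k>0. psi (g ^ k) \<noteq> 0 \<and> (\<forall>r. 0 < r \<longrightarrow> r < k \<longrightarrow> psi (g ^ r) = 0)"
proof -
  let ?P = "\<lambda>k. k > 0 \<and> psi (g ^ k) \<noteq> 0"
  have "psi (g ^ totient q) = psi 1" using pc euler_theorem[OF g] unfolding partial_char_def by blast
  then have "?P (totient q)" using q pc by (simp add: partial_char_def)
  then have "?P (LEAST k. ?P k)" by (rule LeastI)
  moreover have "psi (g ^ r) = 0" if "0 < r" "r < (LEAST k. ?P k)" for r
    using not_less_Least[OF that(2)] that(1) by simp
  ultimately show ?thesis by blast
qed

text \<open>Induction on the number of invertible classes not yet reached by the support: each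
  extension step captures at least the class of \<open>g\<close>. Once none is left,
  \<open>psi\<close> is a full character.\<close>

lemma partial_char_extend:
  assumes "partial_char q psi" "q > 0"
  shows "\<exists>chi. dirichlet_char q chi \<and> (\<forall>n. psi n \<noteq> 0 \<longrightarrow> chi n = psi n)"
  using assms(1)
proof (induction "card {n. n < q \<and> coprime n q \<and> psi n = 0}" arbitrary: psi rule: less_induct)
  case less
  note pc = less.prems
  show ?case
  proof (cases "\<exists>g. coprime g q \<and> psi g = 0")
    case False
    then have iff: "psi n \<noteq> 0 \<longleftrightarrow> coprime n q" for n using pc unfolding partial_char_def by blast
    have "psi (n + q) = psi n" for n using pc unfolding partial_char_def by (metis cong_add_rcancel_0_nat cong_def mod_add_self2)
    moreover have "psi (m * n) = psi m * psi n" for m n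
    proof (cases "psi m \<noteq> 0 \<and> psi n \<noteq> 0")
      case True
      then show ?thesis using pc unfolding partial_char_def by blast
    next
      case False
      then have "\<not> coprime (m * n) q" using iff by auto
      then show ?thesis using iff False by (metis mult_eq_0_iff)
    qed
    ultimately have "dirichlet_char q psi" unfolding dirichlet_char_def using iff by blast
    then show ?thesis by blast
  next
    case True
    then obtain g where g: "coprime g q" "psi g = 0" by blast
    obtain k where k: "k > 0" "psi (g ^ k) \<noteq> 0" "\<And>r. 0 < r \<Longrightarrow> r < k \<Longrightarrow> psi (g ^ r) = 0"
      using partial_char_extend_root[OF pc assms(2) g(1)] by blast
    \<comment> \<open>Any \<open>k\<close>-th root will do; the principal logarithm supplies
      one.\<close>
    obtain z where z: "z ^ k = psi (g ^ k)" "z \<noteq> 0"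
    proof
      let ?w = "psi (g ^ k)"
      show "exp (Ln ?w / of_nat k) ^ k = ?w"
      proof -
        have "exp (Ln ?w / of_nat k) ^ k = exp (of_nat k * (Ln ?w / of_nat k))" by (rule exp_of_nat_mult[symmetric])
        also have "\<dots> = exp (Ln ?w)" using k(1) by simp
        also have "\<dots> = ?w" using k(2) by (rule exp_Ln)
        finally show ?thesis .
      qed
    qed simp
    obtain psi' where psi': "partial_char q psi'" "psi' g = z" "\<And>n. psi n \<noteq> 0 \<Longrightarrow> psi' n = psi n"
      using partial_char_extend_step[OF pc assms(2) g(1) k z(1)] by blast
    have "g mod q \<in> {n. n < q \<and> coprime n q \<and> psi n = 0} - {n. n < q \<and> coprime n q \<and> psi' n = 0}"
    proof -
      have cg: "[g mod q = g] (mod q)" by simp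
      have "psi (g mod q) = psi g" using pc cg unfolding partial_char_def by blast
      moreover have "psi' (g mod q) = psi' g" using psi'(1) cg unfolding partial_char_def by blast
      moreover have "coprime (g mod q) q" using g(1) assms(2) by simp
      moreover have "g mod q < q" using assms(2) by simp
      ultimately show ?thesis using g(2) psi'(2) z(2) by simp
    qed
    moreover have "{n. n < q \<and> coprime n q \<and> psi' n = 0} \<subseteq> {n. n < q \<and> coprime n q \<and> psi n = 0}"
      using psi'(3) by force
    ultimately have "{n. n < q \<and> coprime n q \<and> psi' n = 0} \<subset> {n. n < q \<and> coprime n q \<and> psi n = 0}"
      by blast
    then have "card {n. n < q \<and> coprime n q \<and> psi' n = 0} < card {n. n < q \<and> coprime n q \<and> psi n = 0}"
      by (intro psubset_card_mono) auto
    from less.hyps[OF this psi'(1)] obtain chi where "dirichlet_char q chi" "\<forall>n. psi' n \<noteq> 0 \<longrightarrow> chi n = psi' n" by blast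
    then have "chi n = psi n" if "psi n \<noteq> 0" for n using psi'(3)[OF that] that by simp
    then show ?thesis using \<open>dirichlet_char q chi\<close> by blast
  qed
qed

text \<open>Start from the trivial subgroup. The order \<open>k\<close> of \<open>c\<close> exceeds
  1, so there is a \<open>k\<close>-th root of unity other than 1 to prescribe at \<open>c\<close>;
  extending to all classes does the rest.\<close>

lemma exists_dirichlet_char_ne_1:
  assumes q: "q > 0" and c: "coprime c q" "\<not> [c = 1] (mod q)"
  shows "\<exists>chi. dirichlet_char q chi \<and> chi c \<noteq> 1"
proof -
  define psi where "psi = (\<lambda>n. if [n = 1] (mod q) then 1 else (0::complex))"
  have pc: "partial_char q psi"
    unfolding partial_char_def psi_def
  proof (intro conjI allI impI)
    fix n assume "(if [n = 1] (mod q) then 1 else (0::complex)) \<noteq> 0"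
    then have "[1 = n] (mod q)" by (auto split: if_splits simp: cong_sym)
    then show "coprime n q" using cong_imp_coprime[of 1 n q] by simp
  next
    fix m n assume "(if [m = 1] (mod q) then 1 else (0::complex)) \<noteq> 0" "(if [n = 1] (mod q) then 1 else (0::complex)) \<noteq> 0"
    then have "[m = 1] (mod q)" "[n = 1] (mod q)" by (auto split: if_splits)
    then show "(if [m * n = 1] (mod q) then 1 else (0::complex)) = (if [m = 1] (mod q) then 1 else 0) * (if [n = 1] (mod q) then 1 else 0)"
      using cong_mult[of m 1 q n 1] by simp
  next
    fix m n :: nat assume "[m = n] (mod q)"
    then show "(if [m = 1] (mod q) then 1 else (0::complex)) = (if [n = 1] (mod q) then 1 else 0)"
      by (metis cong_sym cong_trans)
  qed simp
  obtain k where k: "k > 0" "psi (c ^ k) \<noteq> 0" "\<And>r. 0 < r \<Longrightarrow> r < k \<Longrightarrow> psi (c ^ r) = 0"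
    using partial_char_extend_root[OF pc q c(1)] by blast
  have psik: "psi (c ^ k) = 1" using k(2) by (auto simp: psi_def split: if_splits)
  have "k \<noteq> 1" using c(2) k(2) by (auto simp: psi_def)
  then have "k > 1" using k(1) by simp
  obtain z :: complex where z: "z ^ k = 1" "z \<noteq> 1"
  proof -
    have "card {z::complex. z ^ k = 1} = k" using k(1) by (intro card_roots_unity_eq) auto
    moreover have "card {1::complex} = 1" by simp
    ultimately have "{z::complex. z ^ k = 1} \<noteq> {1}" using \<open>k > 1\<close> by (metis less_irrefl)
    moreover have "(1::complex) \<in> {z. z ^ k = 1}" by simp
    ultimately show ?thesis using that by blast
  qed
  obtain psi' where psi': "partial_char q psi'" "psi' c = z"
    using partial_char_extend_step[OF pc q c(1) k, of z] z psik by auto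
  obtain chi where chi: "dirichlet_char q chi" "\<forall>n. psi' n \<noteq> 0 \<longrightarrow> chi n = psi' n"
    using partial_char_extend[OF psi'(1) q] by blast
  have "z \<noteq> 0" using z k(1) by (metis power_0_left less_numeral_extra(3) zero_neq_one)
  then have "chi c = z" using chi(2) psi'(2) by simp
  then show ?thesis using chi(1) z by blast
qed

section \<open>Orthogonality relations and the count of square roots\<close>

lemma sum_nonprincipal_char:
  assumes chi: "dirichlet_char q chi" "chi \<noteq> principal_char q" and q: "q > 0"
  shows "(\<Sum>n<q. chi n) = 0"
proof -
  obtain c where c: "coprime c q" "chi c \<noteq> 1"
  proof -
    obtain n where n: "chi n \<noteq> principal_char q n" using chi(2) by blast
    then have "coprime n q" using dirichlet_char_nonzero_iff[OF chi(1), of n] by (auto simp: principal_char_def split: if_splits)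
    then show ?thesis using n that by (auto simp: principal_char_def)
  qed
  have inj: "inj_on (\<lambda>n. c * n mod q) {..<q}"
  proof (rule inj_onI)
    fix m n assume "m \<in> {..<q}" "n \<in> {..<q}" "c * m mod q = c * n mod q"
    then have "[m = n] (mod q)" using cong_mult_lcancel_nat[of c q m n] c(1) by (simp add: cong_def)
    then show "m = n" using \<open>m \<in> {..<q}\<close> \<open>n \<in> {..<q}\<close> by (simp add: cong_def)
  qed
  moreover have "(\<lambda>n. c * n mod q) ` {..<q} \<subseteq> {..<q}" using q by auto
  ultimately have "bij_betw (\<lambda>n. c * n mod q) {..<q} {..<q}"
    by (simp add: bij_betw_def endo_inj_surj)
  then have "(\<Sum>n<q. chi n) = (\<Sum>n<q. chi (c * n mod q))"
    by (rule sum.reindex_bij_betw[symmetric])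
  also have "\<dots> = (\<Sum>n<q. chi c * chi n)"
    by (intro sum.cong refl) (metis dirichlet_char_cong[OF chi(1)] dirichlet_char_mult[OF chi(1)] cong_mod_left cong_refl)
  also have "\<dots> = chi c * (\<Sum>n<q. chi n)" by (simp add: sum_distrib_left)
  finally show ?thesis using c(2) by simp
qed

lemma sum_principal_char:
  assumes "q > 1"
  shows "(\<Sum>n<q. principal_char q n) = of_nat (totient q)"
proof -
  have "(\<Sum>n<q. principal_char q n) = (\<Sum>n\<in>{n\<in>{..<q}. coprime n q}. 1)"
    unfolding principal_char_def by (intro sum.inter_filter[symmetric]) auto
  also have "\<dots> = of_nat (card {n\<in>{..<q}. coprime n q})" by simp
  also have "{n\<in>{..<q}. coprime n q} = totatives q"
  proof -
    have "\<not> coprime 0 q" "\<not> coprime q q" using assms by auto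
    then have "n \<in> {n\<in>{..<q}. coprime n q} \<longleftrightarrow> n \<in> totatives q" for n
      by (cases "n = 0"; cases "n = q") (auto simp: totatives_def)
    then show ?thesis by blast
  qed
  finally show ?thesis by (simp add: totient_def)
qed

text \<open>Multiplication by a character \<open>psi\<close> with \<open>psi c \<noteq> 1\<close>
  permutes all characters and multiplies the sum by \<open>psi c\<close>. Its inverse is
  multiplication by the conjugate, since the product of \<open>psi\<close> and its conjugate is
  principal and acts as the identity on characters.\<close>

lemma sum_over_chars:
  assumes "q > 0" "coprime c q"
  shows "(\<Sum>chi | dirichlet_char q chi. chi c) = (if [c = 1] (mod q) then of_nat (card {chi. dirichlet_char q chi}) else 0)"
proof (cases "[c = 1] (mod q)")
  case True
  then have "chi c = 1" if "dirichlet_char q chi" for chi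
    using dirichlet_char_cong[OF that True] dirichlet_char_one[OF that] by simp
  then have "(\<Sum>chi | dirichlet_char q chi. chi c) = (\<Sum>chi | dirichlet_char q chi. 1)"
    by (intro sum.cong refl) auto
  then show ?thesis using True by simp
next
  case False
  obtain psi where psi: "dirichlet_char q psi" "psi c \<noteq> 1"
    using exists_dirichlet_char_ne_1[OF assms False] by blast
  have "bij_betw (\<lambda>chi n. psi n * chi n) {chi. dirichlet_char q chi} {chi. dirichlet_char q chi}"
  proof (rule bij_betwI[where g = "\<lambda>chi n. cnj (psi n) * chi n"])
    show "(\<lambda>chi n. psi n * chi n) \<in> {chi. dirichlet_char q chi} \<rightarrow> {chi. dirichlet_char q chi}"
      using dirichlet_char_times[OF psi(1)] by auto
    show "(\<lambda>chi n. cnj (psi n) * chi n) \<in> {chi. dirichlet_char q chi} \<rightarrow> {chi. dirichlet_char q chi}"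
      using dirichlet_char_times[OF dirichlet_char_cnj[OF psi(1)]] by auto
    fix chi assume "chi \<in> {chi. dirichlet_char q chi}"
    then have chi: "dirichlet_char q chi" by simp
    have *: "psi n * (cnj (psi n) * chi n) = chi n" for n
      using dirichlet_char_times_cnj[OF psi(1) assms(1), of n] dirichlet_char_times_principal[OF chi, of n]
      by (simp add: mult.assoc[symmetric])
    show "(\<lambda>n. cnj (psi n) * (psi n * chi n)) = chi"
    proof
      show "cnj (psi n) * (psi n * chi n) = chi n" for n
        unfolding mult.left_commute[of "cnj (psi n)"] by (rule *)
    qed
    show "(\<lambda>n. psi n * (cnj (psi n) * chi n)) = chi"
      by (rule ext) (rule *)
  qed
  then have "(\<Sum>chi | dirichlet_char q chi. chi c) = (\<Sum>chi | dirichlet_char q chi. psi c * chi c)"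
    by (rule sum.reindex_bij_betw[symmetric])
  also have "\<dots> = psi c * (\<Sum>chi | dirichlet_char q chi. chi c)" by (simp add: sum_distrib_left)
  finally show ?thesis using psi(2) False by simp
qed

text \<open>The double sum of \<open>chi n\<close> over a period and over all characters is
  evaluated in both orders: summing over \<open>chi\<close> first, only \<open>n = 1\<close>
  survives; summing over \<open>n\<close> first, only the principal character.\<close>

lemma card_dirichlet_chars:
  assumes "q > 1"
  shows "card {chi. dirichlet_char q chi} = totient q"
proof -
  let ?D = "{chi. dirichlet_char q chi}"
  have fin: "finite ?D" using assms by (intro finite_dirichlet_chars) simp
  have "(\<Sum>n<q. \<Sum>chi\<in>?D. chi n) = (\<Sum>n<q. if n = 1 then of_nat (card ?D) else 0)"
  proof (intro sum.cong refl)
    fix n assume n: "n \<in> {..<q}"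
    show "(\<Sum>chi\<in>?D. chi n) = (if n = 1 then of_nat (card ?D) else (0::complex))"
    proof (cases "coprime n q")
      case True
      have "[n = 1] (mod q) \<longleftrightarrow> n = 1" using n assms by (simp add: cong_def)
      then show ?thesis using sum_over_chars[OF _ True] assms by simp
    next
      case False
      then have "chi n = 0" if "chi \<in> ?D" for chi using dirichlet_char_nonzero_iff that by blast
      then have "(\<Sum>chi\<in>?D. chi n) = 0" by (intro sum.neutral) blast
      moreover have "n \<noteq> 1" using False by auto
      ultimately show ?thesis by simp
    qed
  qed
  also have "\<dots> = of_nat (card ?D)" using assms by simp
  finally have 1: "(\<Sum>n<q. \<Sum>chi\<in>?D. chi n) = of_nat (card ?D)" .
  have "(\<Sum>n<q. \<Sum>chi\<in>?D. chi n) = (\<Sum>chi\<in>?D. \<Sum>n<q. chi n)" by (rule sum.swap)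
  also have "\<dots> = (\<Sum>chi\<in>?D. if chi = principal_char q then of_nat (totient q) else 0)"
    using sum_nonprincipal_char[of q] sum_principal_char[OF assms] assms by (intro sum.cong refl) auto
  also have "\<dots> = of_nat (totient q)" using fin dirichlet_char_principal by simp
  finally have "of_nat (card ?D) = (of_nat (totient q) :: complex)" using 1 by simp
  then show ?thesis by (simp only: of_nat_eq_iff)
qed

text \<open>On classes coprime to \<open>q\<close>, \<open>cnj (chi n)\<close> is the value of
  \<open>chi\<close> at the inverse \<open>n ^ (totient q - 1)\<close>, which reduces the sum to one
  over all characters at the single class of \<open>a / n\<close>.\<close>

lemma char_orthogonality:
  assumes q: "q > 1" and a: "coprime a q"
  shows "(\<Sum>chi | dirichlet_char q chi. chi a * cnj (chi n)) = (if [n = a] (mod q) then of_nat (totient q) else 0)"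
proof (cases "coprime n q")
  case True
  let ?m = "n ^ (totient q - 1)"
  have tp: "totient q > 0" using q by simp
  have m: "n * ?m = n ^ totient q" using tp by (metis Suc_diff_1 power_Suc)
  have chi_m: "chi ?m = cnj (chi n)" if "dirichlet_char q chi" for chi
  proof -
    have "chi n * chi ?m = 1"
      using dirichlet_char_mult[OF that, of n ?m] dirichlet_char_power[OF that, of n] dirichlet_char_power_totient[OF that True]
      unfolding m by simp
    moreover have "chi n * cnj (chi n) = 1"
      using dirichlet_char_times_cnj[OF that] q True by (simp add: principal_char_def)
    ultimately show ?thesis by (metis mult_cancel_left mult_zero_left zero_neq_one)
  qed
  have "(\<Sum>chi | dirichlet_char q chi. chi a * cnj (chi n)) = (\<Sum>chi | dirichlet_char q chi. chi (a * ?m))"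
    using chi_m dirichlet_char_mult by (intro sum.cong refl) auto
  also have "\<dots> = (if [a * ?m = 1] (mod q) then of_nat (totient q) else 0)"
    using sum_over_chars[of q "a * ?m"] card_dirichlet_chars[OF q] q a True by simp
  also have "[a * ?m = 1] (mod q) \<longleftrightarrow> [n = a] (mod q)"
  proof
    assume "[a * ?m = 1] (mod q)"
    then have "[n * (a * ?m) = n * 1] (mod q)" by (rule cong_scalar_left)
    moreover have "[a * (n * ?m) = a * 1] (mod q)" unfolding m by (intro cong_scalar_left euler_theorem True)
    ultimately show "[n = a] (mod q)" by (simp add: cong_def mult_ac)
  next
    assume "[n = a] (mod q)"
    then have "[a * ?m = n * ?m] (mod q)" by (intro cong_scalar_right) (rule cong_sym)
    then show "[a * ?m = 1] (mod q)" using euler_theorem[OF True] unfolding m by (metis cong_trans)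
  qed
  finally show ?thesis .
next
  case False
  then have "\<not> [n = a] (mod q)" using a cong_imp_coprime cong_sym by blast
  moreover have "chi n = 0" if "dirichlet_char q chi" for chi using False dirichlet_char_nonzero_iff[OF that] by blast
  then have "(\<Sum>chi | dirichlet_char q chi. chi a * cnj (chi n)) = 0" by (intro sum.neutral) auto
  ultimately show ?thesis by simp
qed

text \<open>Detect \<open>x ^ 2 = a\<close> by orthogonality and sum over \<open>x\<close> first:
  the inner sum of \<open>cnj (chi x ^ 2)\<close> vanishes unless \<open>chi ^ 2\<close> is
  principal. This is how \<open>r(a) - r(b)\<close> will match the poles coming from these
  characters.\<close>

lemma r_sq_eq_sum_chars:
  assumes q: "q > 1" and a: "coprime a q"
  shows "of_nat (r_sq q a) = (\<Sum>chi | dirichlet_char q chi \<and> (\<lambda>n. chi n ^ 2) = principal_char q. chi a)"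
proof -
  let ?D = "{chi. dirichlet_char q chi}"
  have fin: "finite ?D" using q by (intro finite_dirichlet_chars) simp
  have "(\<Sum>x\<in>{x\<in>{0..<q}. coprime x q}. \<Sum>chi\<in>?D. chi a * cnj (chi (x ^ 2))) =
     (\<Sum>x\<in>{x\<in>{0..<q}. coprime x q}. if [x ^ 2 = a] (mod q) then of_nat (totient q) else 0)"
    by (intro sum.cong refl char_orthogonality[OF q a])
  also have "\<dots> = of_nat (card ({x\<in>{0..<q}. coprime x q} \<inter> {x. [x ^ 2 = a] (mod q)}) * totient q)"
    by (subst sum.If_cases) auto
  also have "{x\<in>{0..<q}. coprime x q} \<inter> {x. [x ^ 2 = a] (mod q)} = {x\<in>{0..<q}. coprime x q \<and> [x ^ 2 = a] (mod q)}" by blast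
  finally have 1: "(\<Sum>x\<in>{x\<in>{0..<q}. coprime x q}. \<Sum>chi\<in>?D. chi a * cnj (chi (x ^ 2))) = of_nat (r_sq q a * totient q)"
    by (simp only: r_sq_def)
  have "(\<Sum>x\<in>{x\<in>{0..<q}. coprime x q}. \<Sum>chi\<in>?D. chi a * cnj (chi (x ^ 2))) =
    (\<Sum>chi\<in>?D. \<Sum>x\<in>{x\<in>{0..<q}. coprime x q}. chi a * cnj (chi (x ^ 2)))" by (rule sum.swap)
  also have "\<dots> = (\<Sum>chi\<in>?D. if (\<lambda>n. chi n ^ 2) = principal_char q then chi a * of_nat (totient q) else 0)"
  proof (intro sum.cong refl)
    fix chi assume "chi \<in> ?D"
    then have chi: "dirichlet_char q chi" by simp
    let ?s = "\<lambda>n. chi n ^ 2"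
    have "(\<Sum>x\<in>{x\<in>{0..<q}. coprime x q}. chi a * cnj (chi (x ^ 2))) = (\<Sum>x<q. chi a * cnj (?s x))"
    proof (rule sum.mono_neutral_cong_left)
      show "\<forall>x\<in>{..<q} - {x \<in> {0..<q}. coprime x q}. chi a * cnj (?s x) = 0"
        using dirichlet_char_nonzero_iff[OF chi] by auto
    qed (auto simp: dirichlet_char_power[OF chi])
    also have "\<dots> = chi a * cnj (\<Sum>x<q. ?s x)" by (simp add: sum_distrib_left)
    also have "\<dots> = (if ?s = principal_char q then chi a * of_nat (totient q) else 0)"
    proof (cases "?s = principal_char q")
      case True
      then have "(\<Sum>x<q. ?s x) = (\<Sum>x<q. principal_char q x)" by (intro sum.cong refl) (rule fun_cong)
      then have "(\<Sum>x<q. ?s x) = of_nat (totient q)" using sum_principal_char[OF q] by (rule trans)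
      then show ?thesis unfolding if_P[OF True] by (simp only: complex_cnj_of_nat)
    next
      case False
      then have "(\<Sum>x<q. ?s x) = 0" using sum_nonprincipal_char[OF dirichlet_char_square[OF chi]] q by simp
      then show ?thesis using False by (simp only: if_False complex_cnj_zero mult_zero_right)
    qed
    finally show "(\<Sum>x\<in>{x\<in>{0..<q}. coprime x q}. chi a * cnj (chi (x ^ 2))) = (if ?s = principal_char q then chi a * of_nat (totient q) else 0)" .
  qed
  also have "\<dots> = (\<Sum>chi | dirichlet_char q chi \<and> (\<lambda>n. chi n ^ 2) = principal_char q. chi a * of_nat (totient q))"
    using fin by (subst sum.inter_filter[symmetric]) auto
  also have "\<dots> = (\<Sum>chi | dirichlet_char q chi \<and> (\<lambda>n. chi n ^ 2) = principal_char q. chi a) * of_nat (totient q)"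
    by (simp add: sum_distrib_right)
  finally have "of_nat (r_sq q a) * of_nat (totient q) = (\<Sum>chi | dirichlet_char q chi \<and> (\<lambda>n. chi n ^ 2) = principal_char q. chi a) * (of_nat (totient q) :: complex)"
    unfolding 1 by simp
  moreover have "(of_nat (totient q) :: complex) \<noteq> 0" using q by simp
  ultimately show ?thesis by (simp only: mult_cancel_right) simp
qed

section \<open>Dirichlet series\<close>

lemma norm_of_nat_powr: "norm (of_nat n powr s :: complex) = real n powr Re s"
  by (subst norm_powr_real_powr) auto

lemma norm_dirichlet_term: "norm (a n / of_nat n powr s) = norm (a n) * real n powr (- Re s)"
  by (simp add: norm_divide norm_of_nat_powr powr_minus_divide)

lemma summable_ln_powr:
  fixes x :: real
  assumes "1 < x"
  shows "summable (\<lambda>n. (1 + ln (real n)) * real n powr (- x))"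
proof (rule summable_comparison_test'[where N = 1])
  \<comment> \<open>Half of the excess over 1 is spent on dominating the logarithm.\<close>
  define e where "e = (x - 1) / 2"
  have e: "0 < e" using assms by (simp add: e_def)
  have "- x + e < -1" using assms by (simp add: e_def field_simps)
  then have "summable (\<lambda>n. real n powr (- x + e))" by (simp add: summable_real_powr_iff)
  then show "summable (\<lambda>n. (1 + 1 / e) * real n powr (- x + e))" by (rule summable_mult)
  fix n :: nat assume n: "1 \<le> n"
  have "ln (real n) \<le> real n powr e / e" using n e by (intro ln_powr_bound) auto
  moreover have "1 \<le> real n powr e" using n e by (intro ge_one_powr_ge_zero) auto
  ultimately have "1 + ln (real n) \<le> (1 + 1 / e) * real n powr e" by (simp add: algebra_simps)
  then have "(1 + ln (real n)) * real n powr (- x) \<le> ((1 + 1 / e) * real n powr e) * real n powr (- x)"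
    by (intro mult_right_mono) auto
  also have "\<dots> = (1 + 1 / e) * real n powr (- x + e)" by (simp only: powr_add mult_ac)
  finally show "norm ((1 + ln (real n)) * real n powr (- x)) \<le> (1 + 1 / e) * real n powr (- x + e)"
    using n by simp
qed

text \<open>The coefficient bound \<open>1 + ln n\<close> covers both a character and its product
  with the von Mangoldt function.\<close>

lemma summable_dirichlet_abs:
  fixes a :: "nat \<Rightarrow> complex"
  assumes a: "\<And>n. n \<ge> 1 \<Longrightarrow> norm (a n) \<le> 1 + ln (real n)" and s: "1 < Re s"
  shows "summable (\<lambda>n. norm (a n / of_nat n powr s))"
proof (rule summable_comparison_test'[where N = 1])
  show "summable (\<lambda>n. (1 + ln (real n)) * real n powr (- Re s))" using s by (rule summable_ln_powr)
  show "norm (norm (a n / of_nat n powr s)) \<le> (1 + ln (real n)) * real n powr (- Re s)" if "1 \<le> n" for n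
    using a[OF that] by (simp add: norm_dirichlet_term abs_mult mult_right_mono)
qed

lemma has_field_derivative_dirichlet_L:
  fixes a :: "nat \<Rightarrow> complex"
  assumes a: "\<And>n. n \<ge> 1 \<Longrightarrow> norm (a n) \<le> 1 + ln (real n)" and s: "1 < Re s"
  shows "(dirichlet_L a has_field_derivative - dirichlet_L (\<lambda>n. of_real (ln (real n)) * a n) s) (at s)"
proof -
  let ?S = "{s. 1 < Re s}"
  let ?f = "\<lambda>n s. a n / of_nat n powr s"
  let ?f' = "\<lambda>n s. - (of_real (ln (real n)) * a n / of_nat n powr s)"
  have S: "open ?S" by (rule open_halfspace_Re_gt)
  have "\<exists>g g'. \<forall>s\<in>?S. ((\<lambda>n. ?f n s) sums g s) \<and> ((\<lambda>n. ?f' n s) sums g' s) \<and> (g has_field_derivative g' s) (at s)"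
  proof (rule series_and_derivative_comparison_complex[OF S])
    fix n s assume "s \<in> ?S"
    show "((\<lambda>s. ?f n s) has_field_derivative ?f' n s) (at s)"
    \<comment> \<open>The term \<open>n = 0\<close> vanishes identically, since
      \<open>0 powr s = 0\<close> and division by 0 yields 0.\<close>
    proof (cases "n = 0")
      case False
      then have "((\<lambda>s. a n / of_nat n powr s) has_field_derivative - (a n * (Ln (of_nat n) * of_nat n powr s)) / (of_nat n powr s * of_nat n powr s)) (at s)"
        by (auto intro!: derivative_eq_intros)
      then show ?thesis using False by (simp add: divide_simps mult_ac)
    qed simp
  next
    fix s assume s: "s \<in> ?S"
    \<comment> \<open>The majorant uses the abscissa halfway between 1 and \<open>Re s\<close>; the
      ball of radius \<open>Re s - \<sigma>\<close> stays to the right of it.\<close>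
    define \<sigma> where "\<sigma> = (1 + Re s) / 2"
    have \<sigma>: "1 < \<sigma>" "\<sigma> < Re s" using s by (auto simp: \<sigma>_def)
    show "\<exists>d h. 0 < d \<and> summable h \<and> range h \<subseteq> \<real>\<^sub>\<ge>\<^sub>0 \<and> (\<forall>\<^sub>F n in sequentially. \<forall>y\<in>ball s d \<inter> ?S. cmod (?f n y) \<le> cmod (h n))"
    proof (intro exI conjI)
      show "0 < Re s - \<sigma>" using \<sigma> by simp
      show "summable (\<lambda>n. complex_of_real (norm ((1 + ln (real n)) * real n powr (- \<sigma>))))"
      proof (rule summable_of_real)
        have "summable (\<lambda>n. (1 + ln (real n)) * real n powr (- \<sigma>))" using \<sigma> by (intro summable_ln_powr)
        then show "summable (\<lambda>n. norm ((1 + ln (real n)) * real n powr (- \<sigma>)))"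
          by (rule summable_cong[THEN iffD1, rotated]) (auto intro!: eventually_sequentiallyI[of 1])
      qed
      show "range (\<lambda>n. complex_of_real (norm ((1 + ln (real n)) * real n powr (- \<sigma>)))) \<subseteq> \<real>\<^sub>\<ge>\<^sub>0" by auto
      show "\<forall>\<^sub>F n in sequentially. \<forall>y\<in>ball s (Re s - \<sigma>) \<inter> ?S. cmod (?f n y) \<le> cmod (complex_of_real (norm ((1 + ln (real n)) * real n powr (- \<sigma>))))"
      proof (intro eventually_sequentiallyI[of 1] ballI)
        fix n :: nat and y assume n: "1 \<le> n" and y: "y \<in> ball s (Re s - \<sigma>) \<inter> ?S"
        have "Re s - Re y \<le> norm (s - y)" using complex_Re_le_cmod[of "s - y"] by simp
        then have "\<sigma> \<le> Re y" using y by (simp add: dist_norm)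
        then have "real n powr (- Re y) \<le> real n powr (- \<sigma>)" using n by (intro powr_mono) auto
        then have "norm (a n) * real n powr (- Re y) \<le> (1 + ln (real n)) * real n powr (- \<sigma>)"
          using a[OF n] n by (intro mult_mono) auto
        then show "cmod (?f n y) \<le> cmod (complex_of_real (norm ((1 + ln (real n)) * real n powr (- \<sigma>))))"
          unfolding norm_dirichlet_term norm_of_real using n by simp
      qed
    qed
  qed
  then obtain g g' where g: "\<And>s. s \<in> ?S \<Longrightarrow> (\<lambda>n. ?f n s) sums g s" "\<And>s. s \<in> ?S \<Longrightarrow> (\<lambda>n. ?f' n s) sums g' s"
     "\<And>s. s \<in> ?S \<Longrightarrow> (g has_field_derivative g' s) (at s)" by blast
  have eq: "g y = dirichlet_L a y" if "y \<in> ?S" for y using g(1)[OF that] by (simp add: dirichlet_L_def sums_iff)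
  have "(g has_field_derivative g' s) (at s)" using g(3)[of s] s by simp
  then have D: "(dirichlet_L a has_field_derivative g' s) (at s)"
    by (rule has_field_derivative_transform_within_open[OF _ S _ eq]) (use s in simp_all)
  have "(\<lambda>n. of_real (ln (real n)) * a n / of_nat n powr s) sums (- g' s)"
    using sums_minus[OF g(2)[of s]] s by simp
  then have "dirichlet_L (\<lambda>n. of_real (ln (real n)) * a n) s = - g' s"
    unfolding dirichlet_L_def by (rule sums_unique[symmetric])
  then show ?thesis using D by simp
qed

section \<open>Dirichlet convolution and the logarithmic derivative for
  \<open>Re s > 1\<close>\<close>

text \<open>Absolute convergence allows the double series over \<open>m, d \<ge> 1\<close> to be
  regrouped along \<open>n = m * d\<close>; sending \<open>(m, d)\<close> to
  \<open>(m * d, d)\<close> is a bijection onto the pairs of a positive number and one of its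
  divisors.\<close>

lemma dirichlet_convolution_sums:
  fixes u v :: "nat \<Rightarrow> complex"
  assumes u: "summable (\<lambda>n. norm (u n))" "u 0 = 0" and v: "summable (\<lambda>n. norm (v n))" "v 0 = 0"
  shows "(\<lambda>n. \<Sum>d | d dvd n. u (n div d) * v d) sums (suminf u * suminf v)"
proof -
  let ?P = "{1::nat..}"
  have toP: "(f has_sum S) ?P" if "summable (\<lambda>n. norm (f n))" "f 0 = 0" "f sums S" for f :: "nat \<Rightarrow> complex" and S
  proof -
    have "(f has_sum S) UNIV" using that by (intro norm_summable_imp_has_sum)
    moreover have "(f has_sum S) UNIV \<longleftrightarrow> (f has_sum S) ?P"
    proof (rule has_sum_cong_neutral)
      fix x assume "x \<in> UNIV - ?P"
      then have "x = 0" by auto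
      then show "f x = 0" using that(2) by simp
    qed auto
    ultimately show ?thesis by simp
  qed
  have U: "(u has_sum suminf u) ?P" by (rule toP[OF u summable_sums[OF summable_norm_cancel[OF u(1)]]])
  have V: "(v has_sum suminf v) ?P" by (rule toP[OF v summable_sums[OF summable_norm_cancel[OF v(1)]]])
  have Ua: "(\<lambda>n. norm (u n)) summable_on ?P"
    by (rule summable_on_subset_banach[OF norm_summable_imp_summable_on]) (use u in auto)
  have Va: "(\<lambda>n. norm (v n)) summable_on ?P"
    by (rule summable_on_subset_banach[OF norm_summable_imp_summable_on]) (use v in auto)
  have "(\<lambda>p. norm (case p of (m, d) \<Rightarrow> u m * v d)) summable_on ?P \<times> ?P"
  proof (rule Infinite_Sum.abs_summable_on_Sigma_iff[THEN iffD2], intro conjI ballI)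
    show "(\<lambda>y. norm (case (x, y) of (m, d) \<Rightarrow> u m * v d)) summable_on ?P" for x
      using Va by (simp add: norm_mult summable_on_cmult_right)
    have "(\<lambda>x. norm (infsum (\<lambda>y. norm (case (x, y) of (m, d) \<Rightarrow> u m * v d)) ?P)) = (\<lambda>x. norm (u x) * norm (infsum (\<lambda>y. norm (v y)) ?P))"
      using Va by (simp add: norm_mult infsum_cmult_right abs_mult)
    then show "(\<lambda>x. norm (infsum (\<lambda>y. norm (case (x, y) of (m, d) \<Rightarrow> u m * v d)) ?P)) summable_on ?P"
      using Ua by (simp add: summable_on_cmult_left)
  qed
  then have sm: "(\<lambda>(m, d). u m * v d) summable_on ?P \<times> ?P" by (rule Infinite_Sum.abs_summable_summable)
  have "((\<lambda>(m, d). u m * v d) has_sum (suminf u * suminf v)) (?P \<times> ?P)"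
  proof (rule has_sum_SigmaI)
    show "((\<lambda>y. case (x, y) of (m, d) \<Rightarrow> u m * v d) has_sum (u x * suminf v)) ?P" for x
      using has_sum_cmult_right[OF V] by simp
    show "((\<lambda>x. u x * suminf v) has_sum (suminf u * suminf v)) ?P"
      by (rule has_sum_cmult_left[OF U])
  qed (rule sm)
  also have "?this \<longleftrightarrow> ((\<lambda>(n, d). u (n div d) * v d) has_sum (suminf u * suminf v)) (Sigma ?P (\<lambda>n. {d. d dvd n}))"
    by (rule has_sum_reindex_bij_witness[where j = "\<lambda>(m, d). (m * d, d)" and i = "\<lambda>(n, d). (n div d, d)"])
       (auto simp: Suc_le_eq dvd_div_eq_0_iff intro!: Nat.gr0I)
  finally have "((\<lambda>n. \<Sum>d | d dvd n. u (n div d) * v d) has_sum (suminf u * suminf v)) ?P"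
  proof (rule has_sum_SigmaD)
    fix n assume "n \<in> ?P"
    then have "finite {d. d dvd n}" by (intro finite_divisors_nat) auto
    then show "((\<lambda>y. case (n, y) of (n, d) \<Rightarrow> u (n div d) * v d) has_sum (\<Sum>d | d dvd n. u (n div d) * v d)) {d. d dvd n}"
      by simp
  qed
  also have "?this \<longleftrightarrow> ((\<lambda>n. \<Sum>d | d dvd n. u (n div d) * v d) has_sum (suminf u * suminf v)) UNIV"
  proof (rule has_sum_cong_neutral)
    fix n assume "n \<in> UNIV - ?P"
    then have "n = 0" by auto
    \<comment> \<open>Every number divides 0, and a sum over an infinite set is 0 by
      convention.\<close>
    then show "(\<Sum>d | d dvd n. u (n div d) * v d) = 0" by (simp)
  qed auto
  finally show ?thesis by (rule has_sum_imp_sums)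
qed

definition mangoldt_char :: "(nat \<Rightarrow> complex) \<Rightarrow> nat \<Rightarrow> complex" where
  "mangoldt_char chi n = mangoldt n * chi n"

lemma norm_mangoldt_char_le:
  assumes "\<And>n. norm (chi n) \<le> 1" "n \<ge> 1"
  shows "norm (mangoldt_char chi n) \<le> 1 + ln (real n)"
proof -
  have "norm (mangoldt_char chi n) = mangoldt n * norm (chi n)"
    by (simp add: mangoldt_char_def norm_mult)
  also have "\<dots> \<le> mangoldt n * 1" using assms(1) by (intro mult_left_mono mangoldt_nonneg)
  also have "\<dots> \<le> ln (real n)" using mangoldt_le[of n] assms(2) by simp
  finally show ?thesis by simp
qed

context
  fixes q :: nat and chi :: "nat \<Rightarrow> complex"
  assumes q: "q > 1" and chi: "dirichlet_char q chi"
begin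

lemma norm_chi_le: "norm (chi n) \<le> 1"
  using norm_dirichlet_char_le_1[OF chi] q by simp

lemma norm_chi_le_ln: "n \<ge> 1 \<Longrightarrow> norm (chi n) \<le> 1 + ln (real n)"
  using norm_chi_le[of n] ln_ge_zero[of "real n"] by linarith

text \<open>This is the identity \<open>ln n = (\<Sum>d | d dvd n. mangoldt d)\<close> twisted by
  \<open>chi\<close>, which complete multiplicativity allows. It is kept in product form because the
  nonvanishing of the L-function is deduced from it.\<close>

lemma dirichlet_L_log_deriv_eq:
  assumes s: "1 < Re s"
  shows "deriv (dirichlet_L chi) s = - (dirichlet_L chi s * dirichlet_L (mangoldt_char chi) s)"
proof -
  have c0: "chi 0 = 0" using dirichlet_char_nonzero_iff[OF chi, of 0] q by auto
  have "(\<lambda>n. \<Sum>d | d dvd n. (chi (n div d) / of_nat (n div d) powr s) * (mangoldt_char chi d / of_nat d powr s)) sums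
     (dirichlet_L chi s * dirichlet_L (mangoldt_char chi) s)"
    unfolding dirichlet_L_def
    by (rule dirichlet_convolution_sums)
       (use s norm_chi_le norm_chi_le_ln norm_mangoldt_char_le in \<open>auto intro!: summable_dirichlet_abs\<close>)
  moreover have "(\<Sum>d | d dvd n. (chi (n div d) / of_nat (n div d) powr s) * (mangoldt_char chi d / of_nat d powr s))
     = of_real (ln (real n)) * chi n / of_nat n powr s" for n
  proof (cases "n = 0")
    case False
    have "(\<Sum>d | d dvd n. (chi (n div d) / of_nat (n div d) powr s) * (mangoldt_char chi d / of_nat d powr s)) =
      (\<Sum>d | d dvd n. mangoldt d * (chi n / of_nat n powr s))"
    proof (intro sum.cong refl)
      have key: "x * ((m * c) / y) = m * (x * (c / y))" for x m c y :: complex by simp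
      fix d assume "d \<in> {d. d dvd n}"
      then have d: "n div d * d = n" by simp
      have "chi (n div d) * chi d = chi n" using dirichlet_char_mult[OF chi, of "n div d" d] d by simp
      moreover have "of_nat (n div d) powr s * of_nat d powr s = of_nat n powr s"
        using powr_times_real[of "of_nat (n div d)" "of_nat d" s] by (simp flip: of_nat_mult add: d)
      ultimately have "chi (n div d) / of_nat (n div d) powr s * (chi d / of_nat d powr s) = chi n / of_nat n powr s"
        by simp
      then show "(chi (n div d) / of_nat (n div d) powr s) * (mangoldt_char chi d / of_nat d powr s) = mangoldt d * (chi n / of_nat n powr s)"
        using key[of "chi (n div d) / of_nat (n div d) powr s" "mangoldt d" "chi d" "of_nat d powr s"]
        by (simp only: mangoldt_char_def)
    qed
    also have "\<dots> = (\<Sum>d | d dvd n. mangoldt d) * (chi n / of_nat n powr s)" by (simp only: sum_distrib_right)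
    also have "(\<Sum>d | d dvd n. mangoldt d :: complex) = of_real (ln (real n))" using False by (rule mangoldt_sum)
    finally show ?thesis by simp
  qed simp
  ultimately have "dirichlet_L (\<lambda>n. of_real (ln (real n)) * chi n) s = dirichlet_L chi s * dirichlet_L (mangoldt_char chi) s"
    unfolding dirichlet_L_def[of "\<lambda>n. of_real (ln (real n)) * chi n"] by (simp only: sums_iff)
  then show ?thesis using DERIV_imp_deriv[OF has_field_derivative_dirichlet_L[OF norm_chi_le_ln s]] by simp
qed

text \<open>The first term is 1 and the rest is at most 2/3: \<open>1 / n^2\<close> is bounded by
  \<open>1 / ((n - 1/2) * (n + 1/2))\<close>, which telescopes. The bound is uniform in the height,
  so values on \<open>Re s = 2\<close> can serve as a normalisation.\<close>

lemma norm_dirichlet_L_ge: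
  assumes s: "2 \<le> Re s"
  shows "1/4 \<le> norm (dirichlet_L chi s)"
proof -
  let ?t = "\<lambda>n. chi n / of_nat n powr s"
  have c0: "chi 0 = 0" using dirichlet_char_nonzero_iff[OF chi, of 0] q by auto
  have sm: "summable (\<lambda>n. norm (?t n))" using s norm_chi_le_ln by (intro summable_dirichlet_abs) auto
  have sm2: "summable (\<lambda>n. norm (?t (n + 2)))" using summable_iff_shift[of "\<lambda>n. norm (?t n)" 2] sm by simp
  have T: "(\<lambda>n. 1 / (real n + 3/2) - 1 / (real (Suc n) + 3/2)) sums (1 / (real 0 + 3/2) - 0)"
    by (rule telescope_sums') real_asymp
  have le: "norm (?t (n + 2)) \<le> 1 / (real n + 3/2) - 1 / (real (Suc n) + 3/2)" for n
  proof -
    have "norm (?t (n + 2)) \<le> 1 * real (n + 2) powr (- 2)"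
      unfolding norm_dirichlet_term using norm_chi_le[of "n + 2"] s by (intro mult_mono powr_mono) auto
    also have "\<dots> = 1 / (real n + 2)\<^sup>2" by (simp add: powr_minus_divide)
    also have "\<dots> \<le> 1 / ((real n + 3/2) * (real n + 5/2))"
    proof (rule divide_left_mono)
      show "(real n + 3/2) * (real n + 5/2) \<le> (real n + 2)\<^sup>2" by (simp add: power2_eq_square algebra_simps)
      show "0 < (real n + 2)\<^sup>2 * ((real n + 3/2) * (real n + 5/2))" by (intro mult_pos_pos zero_less_power) auto
    qed simp
    also have "\<dots> = 1 / (real n + 3/2) - 1 / (real (Suc n) + 3/2)" by (simp add: field_simps)
    finally show ?thesis .
  qed
  have "norm (\<Sum>n. ?t (n + 2)) \<le> (\<Sum>n. norm (?t (n + 2)))" by (rule summable_norm[OF sm2])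
  also have "\<dots> \<le> (\<Sum>n. 1 / (real n + 3/2) - 1 / (real (Suc n) + 3/2))"
    by (rule suminf_le[OF le sm2 sums_summable[OF T]])
  also have "\<dots> = 2/3" using T by (simp add: sums_iff)
  finally have tail: "norm (\<Sum>n. ?t (n + 2)) \<le> 2/3" .
  have "dirichlet_L chi s = (\<Sum>n. ?t (n + 2)) + (\<Sum>n<2. ?t n)"
    unfolding dirichlet_L_def by (rule suminf_split_initial_segment[OF summable_norm_cancel[OF sm]])
  also have "(\<Sum>n<2. ?t n) = 1" using dirichlet_char_one[OF chi] c0 by (simp add: numeral_2_eq_2)
  finally have "norm (1 :: complex) = norm (dirichlet_L chi s - (\<Sum>n. ?t (n + 2)))" by simp
  also have "\<dots> \<le> norm (dirichlet_L chi s) + norm (\<Sum>n. ?t (n + 2))" by (rule norm_triangle_ineq4)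
  finally have "1 \<le> norm (dirichlet_L chi s) + norm (\<Sum>n. ?t (n + 2))" by simp
  then show ?thesis using tail by simp
qed

text \<open>Solve the linear differential equation for the L-function on the half-plane of absolute convergence.\<close>

lemma dirichlet_L_nonzero:
  assumes s: "1 < Re s"
  shows "dirichlet_L chi s \<noteq> 0"
proof -
  let ?S = "{s. 1 < Re s}"
  let ?F = "dirichlet_L (mangoldt_char chi)"
  have S: "open ?S" "convex ?S" by (auto intro: open_halfspace_Re_gt convex_halfspace_Re_gt)
  have "?F holomorphic_on ?S"
    unfolding holomorphic_on_open[OF S(1)]
    using has_field_derivative_dirichlet_L[of "mangoldt_char chi"] norm_mangoldt_char_le[of chi, OF norm_chi_le] by blast
  then obtain \<Phi> where \<Phi>: "\<And>s. s \<in> ?S \<Longrightarrow> (\<Phi> has_field_derivative ?F s) (at s within ?S)"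
    using holomorphic_convex_primitive'[OF S(2,1)] by blast
  have "\<exists>c. \<forall>s\<in>?S. dirichlet_L chi s * exp (\<Phi> s) = c"
  proof (rule has_field_derivative_zero_constant[OF S(2)])
    fix s assume s: "s \<in> ?S"
    have "(dirichlet_L chi has_field_derivative deriv (dirichlet_L chi) s) (at s within ?S)"
      using has_field_derivative_dirichlet_L[OF norm_chi_le_ln, of s] s
      by (auto simp: DERIV_imp_deriv intro: has_field_derivative_at_within)
    from DERIV_mult[OF this DERIV_chain2[OF DERIV_exp \<Phi>[OF s]]]
    show "((\<lambda>s. dirichlet_L chi s * exp (\<Phi> s)) has_field_derivative 0) (at s within ?S)"
      using dirichlet_L_log_deriv_eq[of s] s by (simp add: algebra_simps)
  qed
  then obtain c where c: "\<And>s. s \<in> ?S \<Longrightarrow> dirichlet_L chi s * exp (\<Phi> s) = c" by blast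
  have "dirichlet_L chi 2 \<noteq> 0" using norm_dirichlet_L_ge[of 2] by auto
  then have "c \<noteq> 0" using c[of 2] by auto
  then show ?thesis using c[of s] s by auto
qed

lemma dirichlet_L_neg_log_deriv:
  assumes s: "1 < Re s"
  shows "- (deriv (dirichlet_L chi) s / dirichlet_L chi s) = dirichlet_L (mangoldt_char chi) s"
  using dirichlet_L_log_deriv_eq[OF s] dirichlet_L_nonzero[OF s] by simp

end

section \<open>Summation by parts and continuation to \<open>Re s > 0\<close>\<close>

lemma powr_diff_bound:
  fixes s :: complex and x y :: real
  assumes x: "0 < x" "x \<le> y" and s: "0 < Re s"
  shows "norm (of_real x powr (- s) - of_real y powr (- s)) \<le> norm s * x powr (- Re s - 1) * (y - x)"
proof -
  have z: "\<exists>t. z = of_real t \<and> x \<le> t" if "z \<in> closed_segment (of_real x) (of_real y)" for z :: complex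
  proof -
    have "z \<in> of_real ` closed_segment x y" using that by (simp add: closed_segment_of_real)
    then show ?thesis using x by (auto simp: closed_segment_eq_real_ivl)
  qed
  have "norm (of_real x powr (- s) - of_real y powr (- s)) \<le> norm s * x powr (- Re s - 1) * norm (of_real x - of_real y :: complex)"
  proof (rule field_differentiable_bound[of "closed_segment (of_real x) (of_real y)"])
    fix z assume "z \<in> closed_segment (of_real x) (of_real y :: complex)"
    then obtain t where t: "z = of_real t" "x \<le> t" using z by blast
    then have "z \<notin> \<real>\<^sub>\<le>\<^sub>0" using x by (auto simp: complex_nonpos_Reals_iff)
    then show "((\<lambda>z. z powr (- s)) has_field_derivative - s * z powr (- s - 1)) (at z within closed_segment (of_real x) (of_real y))"
      by (rule has_field_derivative_at_within[OF has_field_derivative_powr])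
    have "norm (z powr (- s - 1)) = t powr (- Re s - 1)" using t x by (simp add: norm_powr_real_powr)
    also have "\<dots> \<le> x powr (- Re s - 1)" using t x s by (intro powr_mono2') auto
    finally show "norm (- s * z powr (- s - 1)) \<le> norm s * x powr (- Re s - 1)"
      unfolding norm_mult norm_minus_cancel by (intro mult_left_mono) auto
  qed auto
  also have "norm (of_real x - of_real y :: complex) = y - x"
    using x by (simp flip: of_real_diff)
  finally show ?thesis .
qed

text \<open>Summation by parts of a Dirichlet series produces series with such a bound.\<close>

lemma half_plane_series:
  fixes b :: "nat \<Rightarrow> complex \<Rightarrow> complex" and W :: "complex \<Rightarrow> real"
  assumes hol: "\<And>n. b n holomorphic_on {s. 0 < Re s}"
    and bd: "\<And>n s. 0 < Re s \<Longrightarrow> norm (b n s) \<le> W s * real n powr (- Re s - 1)"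
    and W: "continuous_on UNIV W" "\<And>s. 0 \<le> W s"
  shows "\<And>s. 0 < Re s \<Longrightarrow> summable (\<lambda>n. b n s)"
    and "(\<lambda>s. \<Sum>n. b n s) holomorphic_on {s. 0 < Re s}"
    and "\<exists>C\<ge>0. \<forall>s. 1/10 \<le> Re s \<longrightarrow> norm (\<Sum>n. b n s) \<le> C * W s"
proof -
  let ?S = "{s. 0 < Re s}"
  have sm: "summable (\<lambda>n. real n powr (- \<sigma> - 1))" if "0 < \<sigma>" for \<sigma>
    using that by (simp add: summable_real_powr_iff)
  show smb: "summable (\<lambda>n. b n s)" if "0 < Re s" for s
    by (rule summable_comparison_test'[OF summable_mult[OF sm[OF that]], of 0]) (use bd[OF that] in auto)
  show "(\<lambda>s. \<Sum>n. b n s) holomorphic_on ?S"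
  proof (rule holomorphic_uniform_sequence)
    show "open ?S" by (rule open_halfspace_Re_gt)
    show "(\<lambda>s. \<Sum>n<N. b n s) holomorphic_on ?S" for N using hol by (intro holomorphic_on_sum)
    fix s assume s: "s \<in> ?S"
    \<comment> \<open>A closed ball of half the distance to the imaginary axis stays in the
      half-plane and is compact, so \<open>W\<close> is bounded on it.\<close>
    define d where "d = Re s / 2"
    have d: "0 < d" using s by (simp add: d_def)
    have Re: "d \<le> Re y" if "y \<in> cball s d" for y
    proof -
      have "Re s - Re y \<le> d" using that complex_Re_le_cmod[of "s - y"] by (simp add: dist_norm)
      then show ?thesis by (simp add: d_def)
    qed
    have "continuous_on (cball s d) W" using W(1) by (rule continuous_on_subset) simp
    moreover have "cball s d \<noteq> {}" using d by simp
    ultimately obtain x where K: "\<And>y. y \<in> cball s d \<Longrightarrow> W y \<le> W x"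
      using continuous_attains_sup[OF compact_cball] by metis
    show "\<exists>d. 0 < d \<and> cball s d \<subseteq> ?S \<and> uniform_limit (cball s d) (\<lambda>N s. \<Sum>n<N. b n s) (\<lambda>s. \<Sum>n. b n s) sequentially"
    proof (intro exI conjI)
      show "cball s d \<subseteq> ?S" using Re d by fastforce
      show "uniform_limit (cball s d) (\<lambda>N s. \<Sum>n<N. b n s) (\<lambda>s. \<Sum>n. b n s) sequentially"
      proof (rule Weierstrass_m_test)
        show "summable (\<lambda>n. W x * real n powr (- d - 1))" by (intro summable_mult sm d)
        fix n y assume y: "y \<in> cball s d"
        have "norm (b n y) \<le> W y * real n powr (- Re y - 1)" using bd Re[OF y] d by simp
        also have "\<dots> \<le> W x * real n powr (- d - 1)"
        proof (cases "n = 0")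
          case False
          then show ?thesis using K[OF y] W(2)[of y] Re[OF y] by (intro mult_mono powr_mono) auto
        qed simp
        finally show "norm (b n y) \<le> W x * real n powr (- d - 1)" .
      qed
    qed (use d in auto)
  qed
  show "\<exists>C\<ge>0. \<forall>s. 1/10 \<le> Re s \<longrightarrow> norm (\<Sum>n. b n s) \<le> C * W s"
  proof (intro exI conjI allI impI)
    \<comment> \<open>The abscissa 1/10 is the leftmost one reached by discs of radius 19/10 around
      points with real part 2.\<close>
    let ?C = "\<Sum>n. real n powr (- (1/10) - 1)"
    have sm1: "summable (\<lambda>n. real n powr (- (1/10) - 1))" by (rule sm) simp
    then show "0 \<le> ?C" by (rule suminf_nonneg) simp
    fix s assume s: "1/10 \<le> Re s"
    have "norm (b n s) \<le> W s * real n powr (- (1/10) - 1)" for n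
    proof (cases "n = 0")
      case False
      have "norm (b n s) \<le> W s * real n powr (- Re s - 1)" using bd s by simp
      also have "\<dots> \<le> W s * real n powr (- (1/10) - 1)" using False s W(2) by (intro mult_left_mono powr_mono) auto
      finally show ?thesis .
    qed (use bd[of s 0] s in simp)
    then have "norm (\<Sum>n. b n s) \<le> (\<Sum>n. W s * real n powr (- (1/10) - 1))"
      by (rule norm_suminf_le) (rule summable_mult[OF sm1])
    also have "\<dots> = ?C * W s" by (simp only: suminf_mult[OF sm1] mult.commute)
    finally show "norm (\<Sum>n. b n s) \<le> ?C * W s" .
  qed
qed

text \<open>Summation by parts turns the series into one with terms of size
  \<open>norm s * n powr (- Re s - 1)\<close>, absolutely convergent for \<open>Re s > 0\<close>.
  The boundary term tends to 0 there, so both series agree, and holomorphy and linear growth in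
  \<open>norm s\<close> are read off the transformed one.\<close>

lemma dirichlet_L_bounded_sums:
  fixes a :: "nat \<Rightarrow> complex"
  assumes B: "\<And>N. norm (\<Sum>n=1..N. a n) \<le> B"
  shows "\<And>s. 0 < Re s \<Longrightarrow> (\<lambda>n. a n / of_nat n powr s) sums dirichlet_L a s"
    and "dirichlet_L a holomorphic_on {s. 0 < Re s}"
    and "\<exists>C\<ge>0. \<forall>s. 1/10 \<le> Re s \<longrightarrow> norm (dirichlet_L a s) \<le> C * norm s"
proof -
  define A where "A = (\<lambda>N. \<Sum>n=1..N. a n)"
  define b where "b = (\<lambda>n s. A n * (of_nat n powr (- s) - of_nat (Suc n) powr (- s)))"
  have B0: "0 \<le> B" using B[of 0] by simp
  have bd: "norm (b n s) \<le> (B * norm s) * real n powr (- Re s - 1)" if s: "0 < Re s" for n s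
  proof (cases "n = 0")
    case False
    have "norm (b n s) \<le> B * (norm s * real n powr (- Re s - 1) * (real (Suc n) - real n))"
      unfolding b_def norm_mult using B[of n] powr_diff_bound[of "real n" "real (Suc n)" s] s False
      by (intro mult_mono) (auto simp: A_def B0)
    then show ?thesis by simp
  qed (simp add: b_def A_def)
  have bh: "b n holomorphic_on {s. 0 < Re s}" for n
    unfolding b_def by (cases "n = 0") (auto simp: A_def intro!: holomorphic_intros)
  have Wc: "continuous_on UNIV (\<lambda>s::complex. B * norm s)" by (intro continuous_intros)
  have W0: "0 \<le> B * norm s" for s :: complex using B0 by simp
  have H1: "summable (\<lambda>n. b n s)" if "0 < Re s" for s
    by (rule half_plane_series(1)[of b "\<lambda>s. B * norm s", OF bh bd Wc W0 that])
  have H2: "(\<lambda>s. \<Sum>n. b n s) holomorphic_on {s. 0 < Re s}"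
    by (rule half_plane_series(2)[of b "\<lambda>s. B * norm s", OF bh bd Wc W0])
  have H3: "\<exists>C\<ge>0. \<forall>s. 1/10 \<le> Re s \<longrightarrow> norm (\<Sum>n. b n s) \<le> C * (B * norm s)"
    by (rule half_plane_series(3)[of b "\<lambda>s. B * norm s", OF bh bd Wc W0])
  \<comment> \<open>The term \<open>n = 0\<close> contributes nothing as \<open>A 0 = 0\<close>; the
    boundary term carries \<open>Suc N\<close>, one step beyond the last summand.\<close>
  have abel: "(\<Sum>n<Suc N. a n / of_nat n powr s) = (\<Sum>n<Suc N. b n s) + A N * of_nat (Suc N) powr (- s)" for N s
  proof (induction N)
    case 0
    show ?case by (simp add: b_def A_def)
  next
    case (Suc N)
    have "A (Suc N) = A N + a (Suc N)" by (simp add: A_def)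
    moreover have "a (Suc N) / of_nat (Suc N) powr s = a (Suc N) * of_nat (Suc N) powr (- s)" by (simp add: powr_minus_divide)
    ultimately show ?case using Suc.IH by (simp add: b_def algebra_simps)
  qed
  have S: "(\<lambda>n. a n / of_nat n powr s) sums (\<Sum>n. b n s)" if s: "0 < Re s" for s
  proof -
    have "(\<lambda>N. A N * of_nat (Suc N) powr (- s)) \<longlonglongrightarrow> 0"
    proof (rule Lim_null_comparison)
      show "\<forall>\<^sub>F N in sequentially. norm (A N * of_nat (Suc N) powr (- s)) \<le> B * real (Suc N) powr (- Re s)"
        using B unfolding A_def norm_mult norm_of_nat_powr by (intro always_eventually allI mult_mono B0) auto
      have "(\<lambda>N. real (Suc N) powr (- Re s)) \<longlonglongrightarrow> 0" using s by real_asymp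
      then show "(\<lambda>N. B * real (Suc N) powr (- Re s)) \<longlonglongrightarrow> 0" by (rule tendsto_mult_right_zero)
    qed
    then have "(\<lambda>N. \<Sum>n<Suc N. a n / of_nat n powr s) \<longlonglongrightarrow> (\<Sum>n. b n s) + 0"
      unfolding abel using summable_sums[OF H1[OF s]] unfolding sums_def by (intro tendsto_add LIMSEQ_Suc)
    then have "(\<lambda>N. \<Sum>n<Suc N. a n / of_nat n powr s) \<longlonglongrightarrow> (\<Sum>n. b n s)" by (simp only: add_0_right)
    then show ?thesis unfolding sums_def by (rule LIMSEQ_imp_Suc)
  qed
  then have eq: "dirichlet_L a s = (\<Sum>n. b n s)" if "0 < Re s" for s
    using that by (simp add: dirichlet_L_def sums_iff)
  show "(\<lambda>n. a n / of_nat n powr s) sums dirichlet_L a s" if "0 < Re s" for s using S[OF that] eq[OF that] by simp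
  show "dirichlet_L a holomorphic_on {s. 0 < Re s}"
    using H2 by (rule holomorphic_transform) (simp add: eq)
  obtain C where "C \<ge> 0" "\<forall>s. 1/10 \<le> Re s \<longrightarrow> norm (\<Sum>n. b n s) \<le> C * (B * norm s)" using H3 by blast
  then show "\<exists>C\<ge>0. \<forall>s. 1/10 \<le> Re s \<longrightarrow> norm (dirichlet_L a s) \<le> C * norm s"
    using B0 by (intro exI[of _ "C * B"]) (auto simp: eq mult.assoc)
qed

text \<open>Complete periods contribute 0, so only the last, incomplete period counts, apart from
  the value at 0, which the sums starting at 1 omit.\<close>

lemma periodic_sums_bounded:
  fixes d :: "nat \<Rightarrow> complex"
  assumes q: "q > 0" and per: "\<And>n. d (n + q) = d n" and s0: "(\<Sum>n<q. d n) = 0"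
  shows "\<exists>B. \<forall>N. norm (\<Sum>n=1..N. d n) \<le> B"
proof -
  have per': "d (n + k * q) = d n" for n k
  proof (induction k)
    case (Suc k)
    have "d (n + Suc k * q) = d ((n + k * q) + q)" by (simp add: algebra_simps)
    then show ?case using per Suc by simp
  qed simp
  have blk: "(\<Sum>n<k * q + r. d n) = (\<Sum>n<r. d n)" for k r
  proof (induction k)
    case (Suc k)
    have "(\<Sum>n<Suc k * q + r. d n) = (\<Sum>n<q + (k * q + r). d n)" by (simp add: algebra_simps)
    also have "\<dots> = (\<Sum>n<q. d n) + (\<Sum>n<k * q + r. d (n + q))"
      using sum.nat_group sum.atLeastLessThan_concat[of 0 q "q + (k * q + r)" d] sum.shift_bounds_nat_ivl[of d 0 q "k * q + r"]
      by (simp add: atLeast0LessThan add.commute)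
    finally show ?case using s0 per Suc by simp
  qed simp
  have "norm (\<Sum>n=1..N. d n) \<le> (\<Sum>n<q. norm (d n)) + norm (d 0)" for N
  proof -
    have "(\<Sum>n=1..N. d n) = (\<Sum>n<Suc N. d n) - d 0"
      by (simp add: lessThan_Suc_atMost atMost_atLeast0 sum.atLeast_Suc_atMost)
    also have "(\<Sum>n<Suc N. d n) = (\<Sum>n<Suc N mod q. d n)"
      using blk[of "Suc N div q" "Suc N mod q"] by simp
    also have "norm ((\<Sum>n<Suc N mod q. d n) - d 0) \<le> (\<Sum>n<Suc N mod q. norm (d n)) + norm (d 0)"
      by (intro order_trans[OF norm_triangle_ineq4] add_right_mono norm_sum)
    also have "(\<Sum>n<Suc N mod q. norm (d n)) \<le> (\<Sum>n<q. norm (d n))"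
      using q by (intro sum_mono2) (auto intro: less_trans)
    finally show ?thesis by simp
  qed
  then show ?thesis by blast
qed

section \<open>Logarithmic derivatives and zeros\<close>

text \<open>Quotient rule for \<open>u * R * G / d\<close> with \<open>u' = 1\<close> and
  \<open>d' = - c\<close>, divided by the function itself. In the application \<open>u\<close> is
  the linear factor of a zero and \<open>d\<close> the denominator of its Blaschke factor.\<close>

lemma log_deriv_blaschke_algebra:
  fixes d G u R G' c :: complex
  assumes "d \<noteq> 0" "G \<noteq> 0" "u \<noteq> 0" "R \<noteq> 0"
  shows "((R * G + G' * (u * R)) * d + u * R * G * c) / (d * d) / (u * R * G / d) = G' / G + (1 / u + c / d)"
  using assms by (simp add: field_simps)

text \<open>Zeros in the disc of radius \<open>r\<close> are divided out one at a time by Blaschke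
  factors of the disc of radius \<open>R\<close>. Such a factor has modulus 1 on the outer circle,
  so the bound \<open>K\<close> persists, while the value at 0 grows by at least
  \<open>R / r\<close>. Hence \<open>K < norm (f 0) * (R / r) ^ N\<close> leaves room for at most
  \<open>N\<close> zeros; at \<open>N = 0\<close> it contradicts the bound at 0. This is Jensen's
  zero count together with the resulting partial fractions.\<close>

lemma blaschke_log_deriv:
  fixes f :: "complex \<Rightarrow> complex" and r R R' K :: real
  assumes r: "0 < r" "r < R" "R < R'"
  shows "f holomorphic_on ball 0 R' \<Longrightarrow> f 0 \<noteq> 0 \<Longrightarrow> (\<forall>z\<in>cball 0 R. norm (f z) \<le> K) \<Longrightarrow>
     K < norm (f 0) * (R / r) ^ N \<Longrightarrow>
     \<exists>zs g. length zs \<le> N \<and> (\<forall>\<rho>\<in>set zs. f \<rho> = 0 \<and> norm \<rho> \<le> r) \<and> g holomorphic_on ball 0 R' \<and>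
        (\<forall>z\<in>cball 0 r. g z \<noteq> 0) \<and> (\<forall>z\<in>cball 0 R. norm (g z) \<le> K) \<and> norm (f 0) \<le> norm (g 0) \<and>
        (\<forall>z\<in>ball 0 R. f z \<noteq> 0 \<longrightarrow> deriv f z / f z = deriv g z / g z +
            (\<Sum>\<rho>\<leftarrow>zs. 1 / (z - \<rho>) + cnj \<rho> / (of_real (R^2) - cnj \<rho> * z)))"
proof (induction N arbitrary: f)
  case 0
  then show ?case using r by (auto dest!: bspec[where x=0])
next
  case (Suc N)
  show ?case
  proof (cases "\<forall>z\<in>cball 0 r. f z \<noteq> 0")
    case True
    show ?thesis
      by (rule exI[of _ "[]"], rule exI[of _ f]) (use Suc.prems True in auto)
  next
    case False
    then obtain \<rho> where \<rho>: "norm \<rho> \<le> r" "f \<rho> = 0" by auto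
    then have \<rho>0: "\<rho> \<noteq> 0" using Suc.prems(2) by auto
    have \<rho>S: "\<rho> \<in> ball 0 R'" using \<rho> r by auto
    have den: "of_real (R^2) - cnj \<rho> * z \<noteq> 0" if "norm z \<le> R" for z
    proof
      assume "of_real (R^2) - cnj \<rho> * z = 0"
      then have "norm (cnj \<rho> * z) = norm (of_real (R^2) :: complex)" by simp
      then have "norm \<rho> * norm z = R^2" by (simp add: norm_mult norm_power)
      moreover have "norm \<rho> * norm z \<le> r * R" using \<rho> that r by (intro mult_mono) auto
      moreover have "r * R < R * R" using r by simp
      ultimately show False by (simp add: power2_eq_square)
    qed
    \<comment> \<open>The difference quotient at the zero, continued by the derivative: a
      holomorphic cofactor of \<open>z - \<rho>\<close>.\<close>
    define f1 where "f1 = (\<lambda>z. if z = \<rho> then deriv f \<rho> else (f z - f \<rho>) / (z - \<rho>))"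
    have f1h: "f1 holomorphic_on ball 0 R'"
      unfolding f1_def by (rule pole_lemma) (use Suc.prems \<rho>S in \<open>auto simp: interior_open\<close>)
    have ff1: "f z = (z - \<rho>) * f1 z" for z
      using \<rho> by (auto simp: f1_def)
    define g1 where "g1 = (\<lambda>z. f1 z * ((of_real (R^2) - cnj \<rho> * z) / of_real R))"
    have g1h: "g1 holomorphic_on ball 0 R'"
      unfolding g1_def using f1h r by (intro holomorphic_intros) auto
    have f10: "f1 0 = - f 0 / \<rho>" using ff1[of 0] \<rho>0 by (simp add: field_simps)
    have g10: "norm (g1 0) = norm (f 0) * (R / norm \<rho>)"
      using r \<rho>0 by (simp add: g1_def f10 norm_mult norm_divide norm_power power2_eq_square field_simps)
    have g10r: "norm (g1 0) \<ge> norm (f 0) * (R / r)"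
      unfolding g10 using r \<rho> \<rho>0 by (intro mult_left_mono divide_left_mono) auto
    have R1: "R / r \<ge> 1" using r by (simp add: field_simps)
    have g1f: "norm (g1 0) \<ge> norm (f 0)"
      using g10r mult_left_mono[OF R1, of "norm (f 0)"] by auto
    \<comment> \<open>On the circle \<open>norm z = R\<close> one has
      \<open>R^2 = z * cnj z\<close>, so the new factor has the modulus of the factor
      \<open>z - \<rho>\<close> that was removed.\<close>
    have g1S: "norm (g1 z) \<le> K" if "norm z = R" for z
    proof -
      have zz: "z * cnj z = of_real (R^2)" using that by (simp add: complex_norm_square[symmetric])
      have "of_real (R^2) - cnj \<rho> * z = z * cnj (z - \<rho>)" using zz by (simp add: algebra_simps)
      then have "norm (of_real (R^2) - cnj \<rho> * z) = R * norm (z - \<rho>)"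
        using that by (metis complex_mod_cnj norm_mult)
      then have "norm (g1 z) = norm (f1 z) * norm (z - \<rho>)"
        using r by (simp add: g1_def norm_mult norm_divide)
      also have "\<dots> = norm (f z)" by (simp add: ff1 norm_mult)
      also have "\<dots> \<le> K" using Suc.prems(3) that by auto
      finally show ?thesis .
    qed
    have g1K: "\<forall>z\<in>cball 0 R. norm (g1 z) \<le> K"
    proof
      fix z :: complex assume z: "z \<in> cball 0 R"
      show "norm (g1 z) \<le> K"
      proof (rule maximum_modulus_frontier[of g1 "cball 0 R"])
        show "g1 holomorphic_on interior (cball 0 R)"
          using g1h by (rule holomorphic_on_subset) (use r in auto)
        show "continuous_on (closure (cball 0 R)) g1"
          using g1h by (intro holomorphic_on_imp_continuous_on) (auto elim!: holomorphic_on_subset simp: subset_iff intro: order_le_less_trans[OF _ r(3)])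
      qed (use z g1S r in auto)
    qed
    have "K < norm (f 0) * (R / r) * (R / r) ^ N" using Suc.prems(4) by simp
    also have "\<dots> \<le> norm (g1 0) * (R / r) ^ N" using g10r r by (intro mult_right_mono) auto
    finally have K: "K < norm (g1 0) * (R / r) ^ N" .
    have "g1 0 \<noteq> 0" using g1f Suc.prems(2) by auto
    from Suc.IH[OF g1h this g1K K] obtain zs g where zs:
      "length zs \<le> N" "\<forall>\<rho>\<in>set zs. g1 \<rho> = 0 \<and> norm \<rho> \<le> r" "g holomorphic_on ball 0 R'"
      "\<forall>z\<in>cball 0 r. g z \<noteq> 0" "\<forall>z\<in>cball 0 R. norm (g z) \<le> K" "norm (g1 0) \<le> norm (g 0)"
      and eq: "\<forall>z\<in>ball 0 R. g1 z \<noteq> 0 \<longrightarrow> deriv g1 z / g1 z = deriv g z / g z +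
            (\<Sum>\<rho>\<leftarrow>zs. 1 / (z - \<rho>) + cnj \<rho> / (of_real (R^2) - cnj \<rho> * z))" by blast
    have fg: "f z = (z - \<rho>) * of_real R * g1 z / (of_real (R^2) - cnj \<rho> * z)" if "norm z \<le> R" for z
      using den[OF that] r by (simp add: ff1 g1_def field_simps)
    have ld: "deriv f z / f z = deriv g1 z / g1 z + (1 / (z - \<rho>) + cnj \<rho> / (of_real (R^2) - cnj \<rho> * z))"
      if z: "z \<in> ball 0 R" "f z \<noteq> 0" for z
    proof -
      have nz: "norm z < R" using z by auto
      have g1z: "g1 z \<noteq> 0" and zr: "z \<noteq> \<rho>" using fg[of z] nz z(2) by auto
      have d1: "(g1 has_field_derivative deriv g1 z) (at z)"
        using g1h nz r by (intro holomorphic_derivI[of _ "ball 0 R'"]) auto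
      define d where "d = of_real (R^2) - cnj \<rho> * z"
      have dz: "d \<noteq> 0" using den[of z] nz by (simp add: d_def)
      have D: "((\<lambda>z. (z - \<rho>) * of_real R * g1 z / (of_real (R^2) - cnj \<rho> * z)) has_field_derivative
         ((of_real R * g1 z + deriv g1 z * ((z - \<rho>) * of_real R)) * d + (z - \<rho>) * of_real R * g1 z * cnj \<rho>) / (d * d)) (at z)"
        using d1 dz unfolding d_def
        by (auto intro!: derivative_eq_intros)
      have "(f has_field_derivative ((of_real R * g1 z + deriv g1 z * ((z - \<rho>) * of_real R)) * d + (z - \<rho>) * of_real R * g1 z * cnj \<rho>) / (d * d)) (at z)"
        by (rule has_field_derivative_transform_within_open[OF D, of "ball 0 R"]) (use z fg in auto)
      then have "deriv f z = ((of_real R * g1 z + deriv g1 z * ((z - \<rho>) * of_real R)) * d + (z - \<rho>) * of_real R * g1 z * cnj \<rho>) / (d * d)"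
        by (rule DERIV_imp_deriv)
      moreover have "f z = (z - \<rho>) * of_real R * g1 z / d" using fg nz by (simp add: d_def)
      moreover have "z - \<rho> \<noteq> 0" "(of_real R :: complex) \<noteq> 0" using zr r by auto
      ultimately have "deriv f z / f z = ((of_real R * g1 z + deriv g1 z * ((z - \<rho>) * of_real R)) * d + (z - \<rho>) * of_real R * g1 z * cnj \<rho>) / (d * d)
           / ((z - \<rho>) * of_real R * g1 z / d)" by simp
      also have "\<dots> = deriv g1 z / g1 z + (1 / (z - \<rho>) + cnj \<rho> / d)"
        unfolding log_deriv_blaschke_algebra[OF dz g1z \<open>z - \<rho> \<noteq> 0\<close> \<open>(of_real R :: complex) \<noteq> 0\<close>] by simp
      finally show ?thesis unfolding d_def .
    qed
    show ?thesis
    proof (intro exI conjI ballI impI)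
      show "length (\<rho> # zs) \<le> Suc N" using zs by simp
      show "f x = 0" "norm x \<le> r" if "x \<in> set (\<rho> # zs)" for x
        using that zs(2) \<rho> fg[of x] r by auto
      show "g holomorphic_on ball 0 R'" by fact
      show "norm (f 0) \<le> norm (g 0)" using g1f zs by simp
      show "g z \<noteq> 0" if "z \<in> cball 0 r" for z using that zs by auto
      show "norm (g z) \<le> K" if "z \<in> cball 0 R" for z using that zs by auto
      show "deriv f z / f z = deriv g z / g z +
            (\<Sum>\<rho>\<leftarrow>\<rho> # zs. 1 / (z - \<rho>) + cnj \<rho> / (of_real (R^2) - cnj \<rho> * z))" if z: "z \<in> ball 0 R" "f z \<noteq> 0" for z
      proof -
        have "g1 z \<noteq> 0" using fg[of z] z by auto
        then show ?thesis using ld[OF z] eq z(1) by simp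
      qed
    qed
  qed
qed

text \<open>As \<open>Re h < M\<close>, the point \<open>h z\<close> is closer to 0 than to
  \<open>2 M\<close>, so \<open>h / (2 M - h)\<close> maps the unit disc into itself and fixes 0.
  Schwarz's lemma bounds this quotient by \<open>norm z\<close>; solving for \<open>h\<close> gives
  the estimate.\<close>

lemma borel_caratheodory_unit:
  fixes h :: "complex \<Rightarrow> complex"
  assumes h: "h holomorphic_on ball 0 1" "h 0 = 0" and M: "0 < M"
    and Re: "\<And>z. norm z < 1 \<Longrightarrow> Re (h z) < M" and z: "norm z < 1"
  shows "norm (h z) \<le> 2 * M * norm z / (1 - norm z)"
proof -
  define \<phi> where "\<phi> = (\<lambda>z. h z / (2 * of_real M - h z))"
  have nz: "2 * of_real M - h w \<noteq> 0" if "norm w < 1" for w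
  proof
    assume "2 * of_real M - h w = 0"
    then have "Re (2 * of_real M - h w) = 0" by simp
    then show False using Re[OF that] M by simp
  qed
  have "norm (\<phi> z) \<le> norm z"
  proof (rule Schwarz_Lemma(1))
    show "\<phi> holomorphic_on ball 0 1"
      unfolding \<phi>_def using h nz by (intro holomorphic_intros) auto
    show "\<phi> 0 = 0" by (simp add: \<phi>_def h)
    show "norm (\<phi> w) < 1" if w: "norm w < 1" for w
    proof -
      have "(Re (h w))\<^sup>2 < (2 * M - Re (h w))\<^sup>2"
      proof -
        have "(2 * M - Re (h w))\<^sup>2 - (Re (h w))\<^sup>2 = 4 * M * (M - Re (h w))"
          by (simp add: power2_eq_square algebra_simps)
        also have "\<dots> > 0" using M Re[OF w] by simp
        finally show ?thesis by simp
      qed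
      then have "norm (h w) < norm (2 * of_real M - h w)"
        unfolding cmod_def by (intro real_sqrt_less_mono) simp
      then show ?thesis using nz[OF w] by (simp add: \<phi>_def norm_divide)
    qed
  qed (use z in auto)
  then have "norm (h z) \<le> norm z * norm (2 * of_real M - h z)"
    using nz[OF z] by (simp add: \<phi>_def norm_divide field_simps)
  also have "\<dots> \<le> norm z * (2 * M + norm (h z))"
    using M norm_triangle_ineq4[of "2 * of_real M" "h z"] by (intro mult_left_mono) (auto simp: norm_mult)
  finally have "norm (h z) * (1 - norm z) \<le> 2 * M * norm z" by (simp add: algebra_simps)
  then show ?thesis using z by (simp add: field_simps)
qed

text \<open>A zero-free function on a disc has a logarithm; normalised to vanish at 0, its real part
  is at most \<open>M\<close>. The Borel-Caratheodory inequality bounds it on an intermediate disc,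
  and Cauchy's estimate bounds its derivative, which is the logarithmic derivative of
  \<open>g\<close>.\<close>

lemma log_deriv_bound_nonvanishing:
  fixes g :: "complex \<Rightarrow> complex"
  assumes rr: "0 < r'" "r' < r"
    and g: "g holomorphic_on ball 0 r" "\<And>z. z \<in> ball 0 r \<Longrightarrow> g z \<noteq> 0"
    and K: "\<And>z. z \<in> ball 0 r \<Longrightarrow> norm (g z) \<le> exp M * norm (g 0)" and M: "0 < M"
    and z: "norm z \<le> r'"
  shows "norm (deriv g z / g z) \<le> 32 * r * M / (r - r')\<^sup>2"
proof -
  obtain h0 where h0: "h0 holomorphic_on ball 0 r" "\<And>x. x \<in> ball 0 r \<Longrightarrow> exp (h0 x) = g x"
    using holomorphic_logarithm_exists[of "ball 0 r" g 0] g rr by (auto simp: convex_ball)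
  define h where "h = (\<lambda>x. h0 x - h0 0)"
  have hh: "h holomorphic_on ball 0 r" unfolding h_def by (intro holomorphic_intros h0)
  have gh: "g x = g 0 * exp (h x)" if "x \<in> ball 0 r" for x
  proof -
    have "exp (h x) = exp (h0 x) / exp (h0 0)" by (simp add: h_def exp_diff)
    also have "\<dots> = g x / g 0" using h0(2)[OF that] h0(2)[of 0] rr by simp
    finally show ?thesis using g(2)[of 0] rr by simp
  qed
  have Re: "Re (h x) \<le> M" if "x \<in> ball 0 r" for x
  proof -
    have "norm (g 0) * exp (Re (h x)) \<le> exp M * norm (g 0)"
      using K[OF that] gh[OF that] by (simp add: norm_mult)
    then show ?thesis using g(2)[of 0] rr by simp
  qed
  define r1 where "r1 = (r + r') / 2"
  have r1: "r' < r1" "r1 < r" using rr by (auto simp: r1_def)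
  have hb: "norm (h x) \<le> 4 * M * r / (r - r1)" if x: "norm x \<le> r1" for x
  proof -
    \<comment> \<open>Borel-Caratheodory asks for a strict bound on the real part, hence
      \<open>2 * M\<close> in place of \<open>M\<close>.\<close>
    have "norm (h (of_real r * (x / of_real r))) \<le> 2 * (2 * M) * norm (x / of_real r) / (1 - norm (x / of_real r))"
    proof (rule borel_caratheodory_unit[of "\<lambda>z. h (of_real r * z)"])
      show "(\<lambda>z. h (of_real r * z)) holomorphic_on ball 0 1"
        by (rule holomorphic_on_compose_gen[unfolded o_def, where t = "ball 0 r"])
           (use hh rr in \<open>auto intro!: holomorphic_intros simp: norm_mult\<close>)
      show "Re (h (of_real r * w)) < 2 * M" if "norm w < 1" for w
        using Re[of "of_real r * w"] that rr M by (auto simp: norm_mult)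
    qed (use M x r1 rr in \<open>auto simp: h_def norm_divide\<close>)
    also have "of_real r * (x / of_real r) = x" using rr by simp
    also have "2 * (2 * M) * norm (x / of_real r) / (1 - norm (x / of_real r)) = 4 * M * norm x / (r - norm x)"
      using rr x r1 by (simp add: norm_divide divide_simps)
    also have "\<dots> \<le> 4 * M * r / (r - r1)"
      using M x r1 rr by (intro frac_le mult_left_mono) auto
    finally show ?thesis .
  qed
  define \<delta> where "\<delta> = r1 - r'"
  have sub: "norm w \<le> r1" if "dist z w \<le> \<delta>" for w
    using that z norm_triangle_ineq2[of w z] by (auto simp: \<delta>_def dist_norm norm_minus_commute)
  \<comment> \<open>The bound on \<open>h\<close> is doubled because Cauchy's estimate requires
    values in an open ball.\<close>
  have B: "norm ((deriv ^^ 1) h z) \<le> fact 1 * (4 * M * r / (r - r1) + 4 * M * r / (r - r1)) / \<delta> ^ 1"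
  proof (rule Cauchy_higher_deriv_bound[where y=0])
    have sub': "cball z \<delta> \<subseteq> ball 0 r" using sub r1 by (fastforce simp: dist_commute)
    show "h holomorphic_on ball z \<delta>"
      using hh by (rule holomorphic_on_subset) (use sub' ball_subset_cball in blast)
    show "continuous_on (cball z \<delta>) h"
      by (rule holomorphic_on_imp_continuous_on, rule holomorphic_on_subset[OF hh sub'])
    show "h w \<in> ball 0 (4 * M * r / (r - r1) + 4 * M * r / (r - r1))" if "w \<in> ball z \<delta>" for w
    proof -
      have "4 * M * r / (r - r1) > 0" using M rr r1 by simp
      then show ?thesis using hb[of w] sub[of w] that by auto
    qed
  qed (use r1 in \<open>auto simp: \<delta>_def\<close>)
  have \<delta>: "\<delta> = (r - r') / 2" "r - r1 = (r - r') / 2" by (auto simp: \<delta>_def r1_def field_simps)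
  have B': "norm (deriv h z) \<le> 32 * r * M / (r - r')\<^sup>2"
  proof -
    define e where "e = r - r'"
    have "e > 0" using rr by (simp add: e_def)
    then show ?thesis using B unfolding \<delta> e_def[symmetric] by (simp add: power2_eq_square field_simps)
  qed
  have zb: "z \<in> ball 0 r" using z rr by auto
  have "((\<lambda>x. g 0 * exp (h x)) has_field_derivative g 0 * (exp (h z) * deriv h z)) (at z)"
    using holomorphic_derivI[OF hh _ zb] by (auto intro!: derivative_eq_intros)
  then have "(g has_field_derivative g 0 * (exp (h z) * deriv h z)) (at z)"
    by (rule has_field_derivative_transform_within_open[of _ _ _ "ball 0 r"]) (use zb gh in auto)
  then have "deriv g z / g z = deriv h z"
    using gh[OF zb] g(2)[OF zb] g(2)[of 0] rr by (simp add: DERIV_imp_deriv)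
  then show ?thesis using B' by simp
qed
text \<open>The radii 8/5 < 9/5 < 19/10 < 2 around a point with real part 2 serve, in this order,
  for evaluation, for the zeros divided out, for the growth bound and for holomorphy. The quotient
  left by the Blaschke factors is zero-free on radius 9/5, and its logarithmic derivative is bounded
  by the preceding lemma.\<close>

lemma log_deriv_partial_fractions:
  fixes f :: "complex \<Rightarrow> complex" and M :: real
  assumes hol: "f holomorphic_on {s. 0 < Re s}" and s0: "Re s0 = 2" "f s0 \<noteq> 0"
    and bd: "\<And>s. norm (s - s0) \<le> 19/10 \<Longrightarrow> norm (f s) \<le> exp M * norm (f s0)" and M: "1 \<le> M"
    and nz: "\<And>s. 1/2 < Re s \<Longrightarrow> f s \<noteq> 0"
  obtains zs where "length zs \<le> 21 * M" "\<And>\<rho>. \<rho> \<in> set zs \<Longrightarrow> Re \<rho> \<le> 1/2 \<and> norm (\<rho> - s0) \<le> 9/5"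
    "\<And>s. 1/2 < Re s \<Longrightarrow> norm (s - s0) \<le> 8/5 \<Longrightarrow>
        norm (deriv f s / f s - (\<Sum>\<rho>\<leftarrow>zs. 1 / (s - \<rho>))) \<le> 2000 * M"
proof -
  define F where "F = (\<lambda>z. f (s0 + z))"
  have pos: "0 < Re (s0 + z)" if "norm z < 2" for z
    using that s0 abs_Re_le_cmod[of z] by auto
  have Fh: "F holomorphic_on ball 0 2"
    unfolding F_def
  proof (rule holomorphic_on_compose_gen[unfolded o_def, OF _ hol])
    show "(\<lambda>z. s0 + z) ` ball 0 2 \<subseteq> {s. 0 < Re s}"
    proof (rule image_subsetI)
      fix z :: complex assume "z \<in> ball 0 2"
      then show "s0 + z \<in> {s. 0 < Re s}" using pos[of z] by simp
    qed
  qed (intro holomorphic_intros)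
  have dF: "deriv F z = deriv f (s0 + z)" if "norm z < 2" for z
  proof -
    have "(f has_field_derivative deriv f (s0 + z)) (at (s0 + z))"
      by (rule holomorphic_derivI[OF hol]) (use pos[OF that] in \<open>auto simp: open_halfspace_Re_gt\<close>)
    then have "(F has_field_derivative deriv f (s0 + z)) (at z)"
      unfolding F_def by (rule DERIV_chain2[where Db = 1, simplified]) (auto intro!: derivative_eq_intros)
    then show ?thesis by (rule DERIV_imp_deriv)
  qed
  \<comment> \<open>With \<open>R / r = 19/18 \<ge> exp (1/19)\<close>, the choice
    \<open>N \<ge> 20 * M\<close> makes \<open>(R / r) ^ N\<close> exceed
    \<open>exp M\<close>.\<close>
  define N where "N = nat \<lceil>20 * M\<rceil>"
  have N: "20 * M \<le> N" "N \<le> 21 * M" using M unfolding N_def by linarith+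
  have e1: "exp (1/19) \<le> (19/18::real)"
  proof -
    have "18/19 \<le> exp (-(1/19)::real)" using exp_ge_add_one_self[of "-(1/19)::real"] by simp
    then show ?thesis by (simp add: exp_minus field_simps)
  qed
  have "exp M < exp (of_nat N * (1/19))" using N M by simp
  also have "\<dots> = exp (1/19) ^ N" by (simp only: exp_of_nat_mult)
  also have "\<dots> \<le> (19/18) ^ N" using e1 by (intro power_mono) auto
  finally have eN: "exp M < (19/18) ^ N" .
  have F0: "F 0 = f s0" by (simp add: F_def)
  have "\<exists>zs g. length zs \<le> N \<and> (\<forall>\<rho>\<in>set zs. F \<rho> = 0 \<and> norm \<rho> \<le> 9/5) \<and> g holomorphic_on ball 0 2 \<and>
        (\<forall>z\<in>cball 0 (9/5). g z \<noteq> 0) \<and> (\<forall>z\<in>cball 0 (19/10). norm (g z) \<le> exp M * norm (f s0)) \<and> norm (F 0) \<le> norm (g 0) \<and>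
        (\<forall>z\<in>ball 0 (19/10). F z \<noteq> 0 \<longrightarrow> deriv F z / F z = deriv g z / g z +
            (\<Sum>\<rho>\<leftarrow>zs. 1 / (z - \<rho>) + cnj \<rho> / (of_real ((19/10)^2) - cnj \<rho> * z)))"
  proof (rule blaschke_log_deriv[OF _ _ _ Fh])
    show "\<forall>z\<in>cball 0 (19/10). norm (F z) \<le> exp M * norm (f s0)"
    proof
      fix z :: complex assume "z \<in> cball 0 (19/10)"
      then show "norm (F z) \<le> exp M * norm (f s0)" using bd[of "s0 + z"] by (simp add: F_def)
    qed
    have "exp M * norm (f s0) < (19/18) ^ N * norm (f s0)" using eN s0 by (intro mult_strict_right_mono) auto
    moreover have "(19/10) / (9/5) = (19/18::real)" by simp
    ultimately show "exp M * norm (f s0) < norm (F 0) * ((19/10) / (9/5)) ^ N" by (simp only: F0 mult.commute)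
  qed (use s0 F0 in auto)
  then obtain zs g where zs: "length zs \<le> N" "\<forall>\<rho>\<in>set zs. F \<rho> = 0 \<and> norm \<rho> \<le> 9/5"
    and g: "g holomorphic_on ball 0 2" "\<forall>z\<in>cball 0 (9/5). g z \<noteq> 0"
      "\<forall>z\<in>cball 0 (19/10). norm (g z) \<le> exp M * norm (f s0)" "norm (f s0) \<le> norm (g 0)"
    and eq: "\<forall>z\<in>ball 0 (19/10). F z \<noteq> 0 \<longrightarrow> deriv F z / F z = deriv g z / g z +
            (\<Sum>\<rho>\<leftarrow>zs. 1 / (z - \<rho>) + cnj \<rho> / (of_real ((19/10)^2) - cnj \<rho> * z))"
    unfolding F0 by blast
  show ?thesis
  proof (rule that[of "map (\<lambda>\<rho>. s0 + \<rho>) zs"])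
    show "real (length (map ((+) s0) zs)) \<le> 21 * M" using zs(1) N by simp
    show "Re \<rho> \<le> 1/2 \<and> norm (\<rho> - s0) \<le> 9/5" if \<rho>: "\<rho> \<in> set (map ((+) s0) zs)" for \<rho>
    proof -
      from \<rho> obtain z where z: "z \<in> set zs" "\<rho> = s0 + z" by auto
      then have "f \<rho> = 0" "norm z \<le> 9/5" using bspec[OF zs(2) z(1)] by (auto simp: F_def)
      then show ?thesis using nz[of \<rho>] z by force
    qed
    fix s assume s: "1/2 < Re s" "norm (s - s0) \<le> 8/5"
    define z where "z = s - s0"
    have nz': "norm z \<le> 8/5" using s by (simp add: z_def)
    have Fz: "F z = f s" "deriv F z = deriv f s" using dF[of z] nz' by (auto simp: F_def z_def)
    have 1: "deriv f s / f s = deriv g z / g z +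
            (\<Sum>\<rho>\<leftarrow>zs. 1 / (z - \<rho>) + cnj \<rho> / (of_real ((19/10)^2) - cnj \<rho> * z))"
      using bspec[OF eq, of z] nz' nz[OF s(1)] unfolding Fz by simp
    have 2: "(\<Sum>\<rho>\<leftarrow>map ((+) s0) zs. 1 / (s - \<rho>)) = (\<Sum>\<rho>\<leftarrow>zs. 1 / (z - \<rho>))"
      by (simp add: o_def z_def algebra_simps)
    have 3: "norm (deriv g z / g z) \<le> 32 * (9/5) * M / (9/5 - 8/5)\<^sup>2"
    proof (rule log_deriv_bound_nonvanishing)
      show "g holomorphic_on ball 0 (9/5)" by (rule holomorphic_on_subset[OF g(1)]) auto
      show "norm (g z) \<le> exp M * norm (g 0)" if "z \<in> ball 0 (9/5)" for z
        using bspec[OF g(3), of z] g(4) that by (force intro: order_trans[OF _ mult_left_mono])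
    qed (use g(2) M nz' in auto)
    have 4: "norm (\<Sum>\<rho>\<leftarrow>zs. cnj \<rho> / (of_real ((19/10)^2) - cnj \<rho> * z)) \<le> 3 * N"
    proof -
      \<comment> \<open>The denominator is at least
        \<open>361/100 - (9/5) * (8/5) \<ge> 7/10\<close>.\<close>
      have "norm (cnj \<rho> / (of_real ((19/10)^2) - cnj \<rho> * z)) \<le> 3" if "\<rho> \<in> set zs" for \<rho>
      proof -
        have \<rho>: "norm \<rho> \<le> 9/5" using bspec[OF zs(2) that] by simp
        have "norm (cnj \<rho> * z) \<le> (9/5) * (8/5)" unfolding norm_mult using \<rho> nz' by (intro mult_mono) auto
        moreover have "norm (of_real ((19/10)^2) :: complex) \<le> norm (of_real ((19/10)^2) - cnj \<rho> * z) + norm (cnj \<rho> * z)"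
          using norm_triangle_sub[of "of_real ((19/10)^2) :: complex" "cnj \<rho> * z"] by linarith
        moreover have "norm (of_real ((19/10)^2) :: complex) = 361/100" by (simp add: norm_power power2_eq_square del: of_real_power)
        ultimately have "norm (of_real ((19/10)^2) - cnj \<rho> * z) \<ge> 7/10" by simp
        then have "norm (cnj \<rho> / (of_real ((19/10)^2) - cnj \<rho> * z)) \<le> (9/5) / (7/10)"
          unfolding norm_divide using \<rho> by (intro frac_le) auto
        then show ?thesis by simp
      qed
      then have "norm (\<Sum>\<rho>\<leftarrow>zs. cnj \<rho> / (of_real ((19/10)^2) - cnj \<rho> * z)) \<le> 3 * length zs"
      proof (induction zs)
        case (Cons a zs)
        then show ?case using norm_triangle_mono[OF Cons.prems[of a] Cons.IH] by (simp del: of_real_power)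
      qed simp
      then show ?thesis using zs(1) by simp
    qed
    have "deriv f s / f s - (\<Sum>\<rho>\<leftarrow>map ((+) s0) zs. 1 / (s - \<rho>)) =
       deriv g z / g z + (\<Sum>\<rho>\<leftarrow>zs. cnj \<rho> / (of_real ((19/10)^2) - cnj \<rho> * z))"
      unfolding 1 2 sum_list_addf by simp
    also have "norm \<dots> \<le> 32 * (9/5) * M / (9/5 - 8/5)\<^sup>2 + 3 * N"
      using norm_triangle_mono[OF 3 4] .
    \<comment> \<open>The two contributions are \<open>1440 * M\<close> and at most
      \<open>63 * M\<close>.\<close>
    also have "\<dots> \<le> 2000 * M" using N by (simp add: power2_eq_square)
    finally show "norm (deriv f s / f s - (\<Sum>\<rho>\<leftarrow>map ((+) s0) zs. 1 / (s - \<rho>))) \<le> 2000 * M" .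
  qed
qed

section \<open>Mean values of logarithmic derivatives over unit windows\<close>

text \<open>Since \<open>Re \<rho> \<le> 1/2\<close>, the distance is at least
  \<open>sqrt (c^2 + (t - Im \<rho>)^2)\<close>, whose reciprocal has the primitive
  \<open>arsinh ((t - Im \<rho>) / c)\<close>. The average loses only \<open>ln (1/c)\<close>,
  whereas the pointwise bound loses \<open>1 / c\<close>: this gain drives the whole proof.\<close>

lemma integral_inverse_dist_le:
  fixes c t0 :: real and \<rho> :: complex
  assumes c: "0 < c" "c \<le> 1" and \<rho>: "Re \<rho> \<le> 1/2" "\<bar>Im \<rho> - t0\<bar> \<le> 9/5"
  shows "(\<lambda>t. 1 / norm (Complex (1/2 + c) t - \<rho>)) integrable_on {t0 - 1/2..t0 + 1/2}"
    and "integral {t0 - 1/2..t0 + 1/2} (\<lambda>t. 1 / norm (Complex (1/2 + c) t - \<rho>)) \<le> 12 * (1 + ln (1/c))"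
proof -
  have ne: "Complex (1/2 + c) t - \<rho> \<noteq> 0" for t
  proof
    assume "Complex (1/2 + c) t - \<rho> = 0"
    then have "Re (Complex (1/2 + c) t - \<rho>) = 0" by simp
    then show False using c \<rho> by simp
  qed
  show int: "(\<lambda>t. 1 / norm (Complex (1/2 + c) t - \<rho>)) integrable_on {t0 - 1/2..t0 + 1/2}"
    by (rule integrable_continuous_interval)
       (use ne in \<open>auto intro!: continuous_intros simp: Complex_eq\<close>)
  define \<gamma> where "\<gamma> = Im \<rho>"
  have D: "((\<lambda>t. arsinh ((t - \<gamma>) / c)) has_vector_derivative 1 / sqrt (c\<^sup>2 + (t - \<gamma>)\<^sup>2)) (at t within S)" for t S
  proof -
    have "sqrt (((t - \<gamma>) / c)\<^sup>2 + 1) = sqrt ((c\<^sup>2 + (t - \<gamma>)\<^sup>2) / c\<^sup>2)"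
      using c by (simp add: field_simps power_divide)
    also have "\<dots> = sqrt (c\<^sup>2 + (t - \<gamma>)\<^sup>2) / c" using c by (simp add: real_sqrt_divide)
    finally have eq: "1 / sqrt (((t - \<gamma>) / c)\<^sup>2 + 1) * (1/c) = 1 / sqrt (c\<^sup>2 + (t - \<gamma>)\<^sup>2)" using c by simp
    have "((\<lambda>t. arsinh ((t - \<gamma>) / c)) has_field_derivative 1 / sqrt (((t - \<gamma>) / c)\<^sup>2 + 1) * (1/c)) (at t within S)"
      by (rule DERIV_chain2[OF arsinh_real_has_field_derivative]) (use c in \<open>auto intro!: derivative_eq_intros\<close>)
    then show ?thesis unfolding eq by (simp only: has_real_derivative_iff_has_vector_derivative)
  qed
  have I: "((\<lambda>t. 1 / sqrt (c\<^sup>2 + (t - \<gamma>)\<^sup>2)) has_integral arsinh ((t0 + 1/2 - \<gamma>) / c) - arsinh ((t0 - 1/2 - \<gamma>) / c)) {t0 - 1/2..t0 + 1/2}"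
    by (rule fundamental_theorem_of_calculus) (use D in auto)
  \<comment> \<open>The ends of the window lie within \<open>1/2 + 9/5 < 3\<close> of
    \<open>Im \<rho>\<close>, so \<open>arsinh (3 / c)\<close> controls both.\<close>
  have ars: "arsinh (3 / c) \<le> 6 + ln (1 / c)"
  proof -
    have "sqrt ((3/c)\<^sup>2 + 1) \<le> sqrt ((4/c)\<^sup>2)"
    proof (rule real_sqrt_le_mono)
      have "1 \<le> 1/c" using c by simp
      then have "1 \<le> (1/c)\<^sup>2" by (rule one_le_power)
      then show "(3/c)\<^sup>2 + 1 \<le> (4/c)\<^sup>2" by (simp add: power_divide)
    qed
    then have "3/c + sqrt ((3/c)\<^sup>2 + 1) \<le> 7 / c" using c by (simp add: real_sqrt_divide)
    moreover have "0 < 3/c + sqrt ((3/c)\<^sup>2 + 1)" using c by (intro add_pos_nonneg) auto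
    ultimately have "arsinh (3/c) \<le> ln (7 / c)" unfolding arsinh_real_def by (intro ln_mono)
    also have "\<dots> = ln 7 + ln (1 / c)" using c by (simp add: ln_div)
    also have "ln 7 \<le> (6::real)" using ln_le_minus_one[of 7] by simp
    finally show ?thesis by simp
  qed
  have "integral {t0 - 1/2..t0 + 1/2} (\<lambda>t. 1 / norm (Complex (1/2 + c) t - \<rho>)) \<le>
     integral {t0 - 1/2..t0 + 1/2} (\<lambda>t. 1 / sqrt (c\<^sup>2 + (t - \<gamma>)\<^sup>2))"
  proof (rule integral_le[OF int])
    show "(\<lambda>t. 1 / sqrt (c\<^sup>2 + (t - \<gamma>)\<^sup>2)) integrable_on {t0 - 1/2..t0 + 1/2}" using I by blast
    show "1 / norm (Complex (1/2 + c) t - \<rho>) \<le> 1 / sqrt (c\<^sup>2 + (t - \<gamma>)\<^sup>2)" for t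
    proof (rule divide_left_mono)
      show "sqrt (c\<^sup>2 + (t - \<gamma>)\<^sup>2) \<le> norm (Complex (1/2 + c) t - \<rho>)"
        unfolding cmod_def \<gamma>_def using c \<rho> by (intro real_sqrt_le_mono add_mono) (auto intro: power_mono)
      show "0 < norm (Complex (1/2 + c) t - \<rho>) * sqrt (c\<^sup>2 + (t - \<gamma>)\<^sup>2)"
        using ne c by (intro mult_pos_pos) (auto simp: add_pos_nonneg)
    qed auto
  qed
  also have "\<dots> = arsinh ((t0 + 1/2 - \<gamma>) / c) - arsinh ((t0 - 1/2 - \<gamma>) / c)"
    using I by (rule integral_unique)
  also have "\<dots> \<le> arsinh (3 / c) - arsinh (- (3 / c))"
  proof (rule diff_mono)
    show "arsinh ((t0 + 1/2 - \<gamma>) / c) \<le> arsinh (3 / c)"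
    proof -
      have "(t0 + 1/2 - \<gamma>) / c \<le> 3 / c" using c \<rho> unfolding \<gamma>_def by (intro divide_right_mono; linarith)
      then show ?thesis by (metis order_le_less arsinh_real_strict_mono)
    qed
    have "- (3 / c) = (-3) / c" by simp
    also have "\<dots> \<le> (t0 - 1/2 - \<gamma>) / c" using c \<rho> unfolding \<gamma>_def by (intro divide_right_mono; linarith)
    finally show "arsinh (- (3 / c)) \<le> arsinh ((t0 - 1/2 - \<gamma>) / c)"
      by (metis order_le_less arsinh_real_strict_mono)
  qed
  also have "\<dots> = 2 * arsinh (3 / c)" by simp
  also have "\<dots> \<le> 12 * (1 + ln (1/c))"
  proof -
    have *: "2 * A \<le> 12 * (1 + l)" if "A \<le> 6 + l" "0 \<le> l" for A l :: real
      using that by (simp add: algebra_simps)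
    show ?thesis by (rule *[OF ars]) (use c in \<open>intro ln_ge_zero, auto\<close>)
  qed
  finally show "integral {t0 - 1/2..t0 + 1/2} (\<lambda>t. 1 / norm (Complex (1/2 + c) t - \<rho>)) \<le> 12 * (1 + ln (1/c))" .
qed

text \<open>Growth is measured relative to the value at the centre \<open>2 + i t\<close>, as
  Jensen's count and the Borel-Caratheodory bound depend only on this ratio. Polynomial growth makes
  its logarithm \<open>O(ln t)\<close>, and the radius 19/10 keeps the discs inside
  \<open>Re s \<ge> 1/10\<close>.\<close>

definition tame :: "(complex \<Rightarrow> complex) \<Rightarrow> bool" where
  "tame f \<longleftrightarrow> f holomorphic_on {s. 0 < Re s} \<and> (\<forall>s. 1/2 < Re s \<longrightarrow> f s \<noteq> 0) \<and>
     (\<exists>K k. \<forall>t s. norm (s - Complex 2 t) \<le> 19/10 \<longrightarrow>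
        norm (f s) \<le> K * (1 + \<bar>t\<bar>) ^ k * norm (f (Complex 2 t)))"

lemma tame_log_deriv_holomorphic:
  assumes "tame f"
  shows "(\<lambda>s. deriv f s / f s) holomorphic_on {s. 1/2 < Re s}"
proof -
  have "f holomorphic_on {s. 1/2 < Re s}"
    using assms unfolding tame_def by (auto elim: holomorphic_on_subset)
  moreover have "open {s. 1/2 < Re s}" by (rule open_halfspace_Re_gt)
  ultimately show ?thesis
    using assms unfolding tame_def by (intro holomorphic_on_divide holomorphic_deriv) auto
qed

text \<open>The pointwise bound with loss \<open>1 / c\<close> is meant for horizontal sides of
  contours, where the kernel tends to 0; the mean bound with loss \<open>ln (1 / c)\<close> is meant
  for the vertical line. Both come from the same list of zeros near the height \<open>t0\<close>,
  whose length is logarithmic in \<open>t0\<close>.\<close>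

lemma tame_log_deriv_bounds:
  assumes "tame f"
  obtains C where "C > 0"
    "\<And>t0 c s. 0 < c \<Longrightarrow> c \<le> 1 \<Longrightarrow> 1/2 + c \<le> Re s \<Longrightarrow> Re s \<le> 3/2 \<Longrightarrow> \<bar>Im s - t0\<bar> \<le> 1/2 \<Longrightarrow>
       norm (deriv f s / f s) \<le> C * (1 + ln (1 + \<bar>t0\<bar>)) / c"
    "\<And>t0 c. 0 < c \<Longrightarrow> c \<le> 1 \<Longrightarrow> integral {t0 - 1/2..t0 + 1/2} (\<lambda>t. norm (deriv f (Complex (1/2 + c) t) / f (Complex (1/2 + c) t)))
       \<le> C * (1 + ln (1 + \<bar>t0\<bar>)) * (1 + ln (1/c))"
proof -
  from assms obtain K0 k where hol: "f holomorphic_on {s. 0 < Re s}" and nz: "\<And>s. 1/2 < Re s \<Longrightarrow> f s \<noteq> 0"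
    and K0: "\<And>t s. norm (s - Complex 2 t) \<le> 19/10 \<Longrightarrow> norm (f s) \<le> K0 * (1 + \<bar>t\<bar>) ^ k * norm (f (Complex 2 t))"
    unfolding tame_def by metis
  \<comment> \<open>At least 3, so that \<open>ln K \<ge> 1\<close> and hence
    \<open>M t \<ge> 1\<close>, as the partial fraction lemma demands.\<close>
  define K where "K = max K0 3"
  define B where "B = ln K + real k"
  have K3: "K \<ge> 3" by (simp add: K_def)
  have lnK: "ln K \<ge> 1"
  proof -
    have "exp 1 \<le> K" using K3 exp_le by linarith
    then show ?thesis using K3 by (subst ln_ge_iff) auto
  qed
  have B: "B \<ge> 1" using lnK by (simp add: B_def)
  define M where "M = (\<lambda>t::real. B * (1 + ln (1 + \<bar>t\<bar>)))"
  have M1: "M t \<ge> 1" for t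
    unfolding M_def using B ln_ge_zero[of "1 + \<bar>t\<bar>"] mult_mono[of 1 B 1 "1 + ln (1 + \<bar>t\<bar>)"] by simp
  have bd: "norm (f s) \<le> exp (M t) * norm (f (Complex 2 t))" if "norm (s - Complex 2 t) \<le> 19/10" for t s
  proof -
    have "ln K + real k * ln (1 + \<bar>t\<bar>) \<le> M t"
      using lnK by (simp add: M_def B_def algebra_simps)
    then have "exp (ln K + real k * ln (1 + \<bar>t\<bar>)) \<le> exp (M t)" by simp
    moreover have "exp (ln K + real k * ln (1 + \<bar>t\<bar>)) = K * (1 + \<bar>t\<bar>) ^ k"
      using K3 by (simp add: exp_add exp_of_nat_mult)
    moreover have "K0 * (1 + \<bar>t\<bar>) ^ k \<le> K * (1 + \<bar>t\<bar>) ^ k" by (intro mult_right_mono) (auto simp: K_def)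
    ultimately have "K0 * (1 + \<bar>t\<bar>) ^ k \<le> exp (M t)" by linarith
    then have "K0 * (1 + \<bar>t\<bar>) ^ k * norm (f (Complex 2 t)) \<le> exp (M t) * norm (f (Complex 2 t))"
      by (rule mult_right_mono) simp
    then show ?thesis using K0[OF that] by linarith
  qed
  have main: "\<exists>zs. length zs \<le> 21 * M t0 \<and> (\<forall>\<rho>\<in>set zs. Re \<rho> \<le> 1/2 \<and> \<bar>Im \<rho> - t0\<bar> \<le> 9/5) \<and>
     (\<forall>s. 1/2 < Re s \<longrightarrow> Re s \<le> 3/2 \<longrightarrow> \<bar>Im s - t0\<bar> \<le> 1/2 \<longrightarrow>
      norm (deriv f s / f s) \<le> (\<Sum>\<rho>\<leftarrow>zs. 1 / norm (s - \<rho>)) + 2000 * M t0)" for t0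
  proof -
    obtain zs where zs: "length zs \<le> 21 * M t0" "\<And>\<rho>. \<rho> \<in> set zs \<Longrightarrow> Re \<rho> \<le> 1/2 \<and> norm (\<rho> - Complex 2 t0) \<le> 9/5"
      and eq: "\<And>s. 1/2 < Re s \<Longrightarrow> norm (s - Complex 2 t0) \<le> 8/5 \<Longrightarrow>
        norm (deriv f s / f s - (\<Sum>\<rho>\<leftarrow>zs. 1 / (s - \<rho>))) \<le> 2000 * M t0"
      by (rule log_deriv_partial_fractions[OF hol _ _ bd[of _ t0] M1[of t0] nz]) (use nz in auto)
    show ?thesis
    proof (intro exI[of _ zs] conjI ballI allI impI)
      fix \<rho> assume \<rho>: "\<rho> \<in> set zs"
      show "Re \<rho> \<le> 1/2" using zs(2)[OF \<rho>] by simp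
      show "\<bar>Im \<rho> - t0\<bar> \<le> 9/5" using zs(2)[OF \<rho>] abs_Im_le_cmod[of "\<rho> - Complex 2 t0"] by simp
    next
      fix s assume s: "1/2 < Re s" "Re s \<le> 3/2" "\<bar>Im s - t0\<bar> \<le> 1/2"
      have "norm (s - Complex 2 t0) = sqrt ((Re s - 2)\<^sup>2 + (Im s - t0)\<^sup>2)" by (simp add: cmod_def)
      \<comment> \<open>The window sits in the disc of evaluation because
        \<open>sqrt (5/2) < 8/5\<close>.\<close>
      also have "\<dots> \<le> sqrt ((3/2)\<^sup>2 + (1/2)\<^sup>2)"
        using s by (intro real_sqrt_le_mono add_mono abs_le_square_iff[THEN iffD1]) auto
      also have "\<dots> \<le> 8/5" by (rule real_le_lsqrt) (auto simp: power2_eq_square)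
      finally have "norm (deriv f s / f s - (\<Sum>\<rho>\<leftarrow>zs. 1 / (s - \<rho>))) \<le> 2000 * M t0" using eq s by blast
      moreover have "norm (\<Sum>\<rho>\<leftarrow>zs. 1 / (s - \<rho>)) \<le> (\<Sum>\<rho>\<leftarrow>zs. 1 / norm (s - \<rho>))"
        by (induction zs) (auto intro!: norm_triangle_le simp: norm_divide)
      ultimately show "norm (deriv f s / f s) \<le> (\<Sum>\<rho>\<leftarrow>zs. 1 / norm (s - \<rho>)) + 2000 * M t0"
        using norm_triangle_sub[of "deriv f s / f s" "\<Sum>\<rho>\<leftarrow>zs. 1 / (s - \<rho>)"] by linarith
    qed (use zs in auto)
  qed
  show ?thesis
  proof (rule that[of "3000 * B"])
    show "3000 * B > 0" using B by simp
  next
    fix t0 c :: real and s assume c: "0 < c" "c \<le> 1" and s: "1/2 + c \<le> Re s" "Re s \<le> 3/2" "\<bar>Im s - t0\<bar> \<le> 1/2"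
    from main[of t0] obtain zs where zs: "length zs \<le> 21 * M t0" "\<And>\<rho>. \<rho>\<in>set zs \<Longrightarrow> Re \<rho> \<le> 1/2 \<and> \<bar>Im \<rho> - t0\<bar> \<le> 9/5"
     "\<And>s. 1/2 < Re s \<Longrightarrow> Re s \<le> 3/2 \<Longrightarrow> \<bar>Im s - t0\<bar> \<le> 1/2 \<Longrightarrow>
      norm (deriv f s / f s) \<le> (\<Sum>\<rho>\<leftarrow>zs. 1 / norm (s - \<rho>)) + 2000 * M t0" by blast
    have "1 / norm (s - \<rho>) \<le> 1 / c" if "\<rho> \<in> set zs" for \<rho>
    proof -
      have "c \<le> norm (s - \<rho>)" using zs(2)[OF that] s complex_Re_le_cmod[of "s - \<rho>"] by simp
      then show ?thesis using c by (intro divide_left_mono mult_pos_pos) auto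
    qed
    then have "(\<Sum>\<rho>\<leftarrow>zs. 1 / norm (s - \<rho>)) \<le> (\<Sum>\<rho>\<leftarrow>zs. 1 / c)" by (rule sum_list_mono)
    also have "\<dots> = length zs * (1 / c)" by (simp add: sum_list_triv)
    also have "\<dots> \<le> 21 * M t0 * (1 / c)" using zs(1) c by (intro mult_right_mono) auto
    finally have "norm (deriv f s / f s) \<le> 21 * M t0 * (1 / c) + 2000 * M t0 * 1"
      using zs(3)[of s] s c by simp
    also have "\<dots> \<le> 21 * M t0 * (1 / c) + 2000 * M t0 * (1/c)"
      using M1[of t0] c by (intro add_left_mono mult_left_mono) auto
    also have "\<dots> \<le> 3000 * M t0 / c" using M1[of t0] c by (simp add: field_simps)
    finally show "norm (deriv f s / f s) \<le> 3000 * B * (1 + ln (1 + \<bar>t0\<bar>)) / c" by (simp add: M_def)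
  next
    fix t0 c :: real assume c: "0 < c" "c \<le> 1"
    from main[of t0] obtain zs where zs: "length zs \<le> 21 * M t0" "\<And>\<rho>. \<rho>\<in>set zs \<Longrightarrow> Re \<rho> \<le> 1/2 \<and> \<bar>Im \<rho> - t0\<bar> \<le> 9/5"
     "\<And>s. 1/2 < Re s \<Longrightarrow> Re s \<le> 3/2 \<Longrightarrow> \<bar>Im s - t0\<bar> \<le> 1/2 \<Longrightarrow>
      norm (deriv f s / f s) \<le> (\<Sum>\<rho>\<leftarrow>zs. 1 / norm (s - \<rho>)) + 2000 * M t0" by blast
    let ?J = "{t0 - 1/2..t0 + 1/2}"
    have sl: "(\<lambda>t. \<Sum>\<rho>\<leftarrow>zs. 1 / norm (Complex (1/2 + c) t - \<rho>)) integrable_on ?J \<and>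
      integral ?J (\<lambda>t. \<Sum>\<rho>\<leftarrow>zs. 1 / norm (Complex (1/2 + c) t - \<rho>)) \<le> length zs * (12 * (1 + ln (1/c)))"
      using zs(2)
    proof (induction zs)
      case Nil
      show ?case by (simp add: integrable_0)
    next
      case (Cons \<rho> zs)
      have "Re \<rho> \<le> 1/2" "\<bar>Im \<rho> - t0\<bar> \<le> 9/5" using Cons.prems[of \<rho>] by auto
      note I = integral_inverse_dist_le[OF c this]
      have IH: "(\<lambda>t. \<Sum>\<rho>\<leftarrow>zs. 1 / norm (Complex (1/2 + c) t - \<rho>)) integrable_on ?J"
        "integral ?J (\<lambda>t. \<Sum>\<rho>\<leftarrow>zs. 1 / norm (Complex (1/2 + c) t - \<rho>)) \<le> length zs * (12 * (1 + ln (1/c)))"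
        using Cons.IH Cons.prems by auto
      show ?case
        using integrable_add[OF I(1) IH(1)] integral_add[OF I(1) IH(1)] I(2) IH(2)
        by (simp add: algebra_simps)
    qed
    have dhol: "(\<lambda>s. deriv f s / f s) holomorphic_on {s. 1/2 < Re s}"
      using assms by (rule tame_log_deriv_holomorphic)
    have "continuous_on ?J (\<lambda>t. deriv f (Complex (1/2 + c) t) / f (Complex (1/2 + c) t))"
      by (rule continuous_on_compose2[OF holomorphic_on_imp_continuous_on[OF dhol]])
         (use c in \<open>auto intro!: continuous_intros simp: Complex_eq\<close>)
    then have int: "(\<lambda>t. norm (deriv f (Complex (1/2 + c) t) / f (Complex (1/2 + c) t))) integrable_on ?J"
      by (intro integrable_continuous_interval continuous_on_norm)
    have "integral ?J (\<lambda>t. norm (deriv f (Complex (1/2 + c) t) / f (Complex (1/2 + c) t))) \<le>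
      integral ?J (\<lambda>t. (\<Sum>\<rho>\<leftarrow>zs. 1 / norm (Complex (1/2 + c) t - \<rho>)) + 2000 * M t0)"
    proof (rule integral_le[OF int])
      show "(\<lambda>t. (\<Sum>\<rho>\<leftarrow>zs. 1 / norm (Complex (1/2 + c) t - \<rho>)) + 2000 * M t0) integrable_on ?J"
        using sl by (intro integrable_add) auto
      fix t assume "t \<in> ?J"
      then have "\<bar>t - t0\<bar> \<le> 1/2" unfolding atLeastAtMost_iff by arith
      then show "norm (deriv f (Complex (1/2 + c) t) / f (Complex (1/2 + c) t)) \<le>
          (\<Sum>\<rho>\<leftarrow>zs. 1 / norm (Complex (1/2 + c) t - \<rho>)) + 2000 * M t0"
        using zs(3)[of "Complex (1/2 + c) t"] c by simp
    qed
    also have "\<dots> = integral ?J (\<lambda>t. \<Sum>\<rho>\<leftarrow>zs. 1 / norm (Complex (1/2 + c) t - \<rho>)) + 2000 * M t0"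
      using sl by (subst integral_add) auto
    also have "\<dots> \<le> length zs * (12 * (1 + ln (1/c))) + 2000 * M t0" using sl by simp
    also have "\<dots> \<le> 21 * M t0 * (12 * (1 + ln (1/c))) + 2000 * M t0 * (1 + ln (1/c))"
    proof (rule add_mono)
      have l: "0 \<le> ln (1/c)" using c by (intro ln_ge_zero) auto
      show "length zs * (12 * (1 + ln (1/c))) \<le> 21 * M t0 * (12 * (1 + ln (1/c)))"
        using zs(1) l by (intro mult_right_mono) auto
      show "2000 * M t0 \<le> 2000 * M t0 * (1 + ln (1/c))"
        using mult_left_mono[of 1 "1 + ln (1/c)" "2000 * M t0"] l M1[of t0] by simp
    qed
    also have "\<dots> = 2252 * (M t0 * (1 + ln (1/c)))" by (simp add: algebra_simps)
    also have "\<dots> \<le> 3000 * (M t0 * (1 + ln (1/c)))"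
    proof -
      have "0 \<le> ln (1/c)" using c by (intro ln_ge_zero) auto
      then have "0 \<le> M t0 * (1 + ln (1/c))" using M1[of t0] by simp
      then show ?thesis by linarith
    qed
    finally show "integral ?J (\<lambda>t. norm (deriv f (Complex (1/2 + c) t) / f (Complex (1/2 + c) t))) \<le>
       3000 * B * (1 + ln (1 + \<bar>t0\<bar>)) * (1 + ln (1/c))" by (simp add: M_def)
  qed
qed

section \<open>Perron's formula\<close>

lemma contour_integral_rectpath_split:
  assumes cont: "continuous_on (path_image (rectpath (Complex x0 y0) (Complex x1 y1))) f"
  shows "contour_integral (rectpath (Complex x0 y0) (Complex x1 y1)) f =
     contour_integral (linepath (Complex x0 y0) (Complex x1 y0)) f +
     contour_integral (linepath (Complex x1 y0) (Complex x1 y1)) f -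
     contour_integral (linepath (Complex x0 y1) (Complex x1 y1)) f -
     contour_integral (linepath (Complex x0 y0) (Complex x0 y1)) f"
    and "f contour_integrable_on linepath (Complex x0 y0) (Complex x1 y0)"
    and "f contour_integrable_on linepath (Complex x0 y1) (Complex x1 y1)"
    and "f contour_integrable_on linepath (Complex x0 y0) (Complex x0 y1)"
    and "f contour_integrable_on linepath (Complex x1 y0) (Complex x1 y1)"
proof -
  have pi: "path_image (rectpath (Complex x0 y0) (Complex x1 y1)) =
     closed_segment (Complex x0 y0) (Complex x1 y0) \<union> (closed_segment (Complex x1 y0) (Complex x1 y1) \<union>
     (closed_segment (Complex x1 y1) (Complex x0 y1) \<union> closed_segment (Complex x0 y1) (Complex x0 y0)))"
    by (simp add: rectpath_def Let_def path_image_join)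
  have c: "f contour_integrable_on linepath (Complex x0 y0) (Complex x1 y0)"
    "f contour_integrable_on linepath (Complex x1 y0) (Complex x1 y1)"
    "f contour_integrable_on linepath (Complex x1 y1) (Complex x0 y1)"
    "f contour_integrable_on linepath (Complex x0 y1) (Complex x0 y0)"
    using cont unfolding pi by (auto intro!: contour_integrable_continuous_linepath elim: continuous_on_subset)
  then show "f contour_integrable_on linepath (Complex x0 y0) (Complex x1 y0)"
    "f contour_integrable_on linepath (Complex x0 y1) (Complex x1 y1)"
    "f contour_integrable_on linepath (Complex x0 y0) (Complex x0 y1)"
    "f contour_integrable_on linepath (Complex x1 y0) (Complex x1 y1)"
    by (auto intro: contour_integrable_reversepath_eq[THEN iffD1, of "linepath _ _", simplified])
  have r: "contour_integral (linepath (Complex x1 y1) (Complex x0 y1)) f = - contour_integral (linepath (Complex x0 y1) (Complex x1 y1)) f"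
     "contour_integral (linepath (Complex x0 y1) (Complex x0 y0)) f = - contour_integral (linepath (Complex x0 y0) (Complex x0 y1)) f"
    using contour_integral_reversepath[of "linepath (Complex x0 y1) (Complex x1 y1)" f]
      contour_integral_reversepath[of "linepath (Complex x0 y0) (Complex x0 y1)" f] by auto
  show "contour_integral (rectpath (Complex x0 y0) (Complex x1 y1)) f =
     contour_integral (linepath (Complex x0 y0) (Complex x1 y0)) f +
     contour_integral (linepath (Complex x1 y0) (Complex x1 y1)) f -
     contour_integral (linepath (Complex x0 y1) (Complex x1 y1)) f -
     contour_integral (linepath (Complex x0 y0) (Complex x0 y1)) f"
    unfolding rectpath_def Let_def using c r by (simp add: contour_integrable_joinI)
qed

lemma norm_contour_integral_segment_le:
  assumes "f contour_integrable_on linepath a b" "0 \<le> B" "\<And>w. w \<in> closed_segment a b \<Longrightarrow> norm (f w) \<le> B"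
    and "norm (b - a) \<le> l"
  shows "norm (contour_integral (linepath a b) f) \<le> B * l"
proof -
  have "norm (contour_integral (linepath a b) f) \<le> B * norm (b - a)"
    using assms(1-3) by (rule contour_integral_bound_linepath)
  also have "\<dots> \<le> B * l" using assms by (intro mult_left_mono)
  finally show ?thesis .
qed

text \<open>The horizontal sides have total length \<open>2 * (x1 - x0)\<close> and account for the
  error. The three conclusions move a line across the rectangle, or close it to the left or to the
  right when the far side is small as well.\<close>

lemma vertical_integrals_rect:
  fixes f :: "complex \<Rightarrow> complex"
  assumes x: "x0 \<le> x1" and T: "0 < T" and B: "0 \<le> B"
    and cont: "continuous_on (path_image (rectpath (Complex x0 (-T)) (Complex x1 T))) f"
    and V: "(f has_contour_integral V) (rectpath (Complex x0 (-T)) (Complex x1 T))"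
    and hor: "\<And>w. x0 \<le> Re w \<Longrightarrow> Re w \<le> x1 \<Longrightarrow> \<bar>Im w\<bar> = T \<Longrightarrow> norm (f w) \<le> B"
  shows "norm (contour_integral (linepath (Complex x1 (-T)) (Complex x1 T)) f -
            contour_integral (linepath (Complex x0 (-T)) (Complex x0 T)) f - V) \<le> B * (2 * (x1 - x0))"
    and "(\<And>w. Re w = x0 \<Longrightarrow> \<bar>Im w\<bar> \<le> T \<Longrightarrow> norm (f w) \<le> B) \<Longrightarrow>
        norm (contour_integral (linepath (Complex x1 (-T)) (Complex x1 T)) f - V) \<le> B * (2 * (x1 - x0) + 2 * T)"
    and "(\<And>w. Re w = x1 \<Longrightarrow> \<bar>Im w\<bar> \<le> T \<Longrightarrow> norm (f w) \<le> B) \<Longrightarrow>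
        norm (contour_integral (linepath (Complex x0 (-T)) (Complex x0 T)) f + V) \<le> B * (2 * (x1 - x0) + 2 * T)"
proof -
  note S = contour_integral_rectpath_split[OF cont]
  define a b where "a = contour_integral (linepath (Complex x0 (-T)) (Complex x1 (-T))) f"
    and "b = contour_integral (linepath (Complex x0 T) (Complex x1 T)) f"
  define p q where "p = contour_integral (linepath (Complex x1 (-T)) (Complex x1 T)) f"
    and "q = contour_integral (linepath (Complex x0 (-T)) (Complex x0 T)) f"
  have e: "V = a + p - b - q"
    using contour_integral_unique[OF V] S(1) by (simp add: a_def b_def p_def q_def)
  have a: "norm a \<le> B * (x1 - x0)"
    unfolding a_def
    by (rule norm_contour_integral_segment_le[OF S(2) B hor])
       (use x T in \<open>auto simp: closed_segment_same_Im closed_segment_eq_real_ivl cmod_def\<close>)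
  have b: "norm b \<le> B * (x1 - x0)"
    unfolding b_def
    by (rule norm_contour_integral_segment_le[OF S(3) B hor])
       (use x T in \<open>auto simp: closed_segment_same_Im closed_segment_eq_real_ivl cmod_def\<close>)
  have eq: "p - q - V = b - a" using e by simp
  have n1: "norm (p - q - V) \<le> B * (2 * (x1 - x0))"
    unfolding eq using norm_triangle_ineq4[of b a] a b by (simp add: algebra_simps)
  then show "norm (contour_integral (linepath (Complex x1 (-T)) (Complex x1 T)) f -
            contour_integral (linepath (Complex x0 (-T)) (Complex x0 T)) f - V) \<le> B * (2 * (x1 - x0))"
    by (simp add: p_def q_def)
  {
    assume left: "\<And>w. Re w = x0 \<Longrightarrow> \<bar>Im w\<bar> \<le> T \<Longrightarrow> norm (f w) \<le> B"
    have "norm q \<le> B * (2 * T)" unfolding q_def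
      by (rule norm_contour_integral_segment_le[OF S(4) B left])
         (use T in \<open>auto simp: closed_segment_same_Re closed_segment_eq_real_ivl cmod_def real_sqrt_mult\<close>)
    then have "norm ((p - q - V) + q) \<le> B * (2 * (x1 - x0)) + B * (2 * T)"
      using n1 by (intro norm_triangle_mono)
    then show "norm (contour_integral (linepath (Complex x1 (-T)) (Complex x1 T)) f - V) \<le> B * (2 * (x1 - x0) + 2 * T)"
      by (simp add: p_def algebra_simps)
  }
  {
    assume right: "\<And>w. Re w = x1 \<Longrightarrow> \<bar>Im w\<bar> \<le> T \<Longrightarrow> norm (f w) \<le> B"
    have "norm p \<le> B * (2 * T)" unfolding p_def
      by (rule norm_contour_integral_segment_le[OF S(5) B right])
         (use T in \<open>auto simp: closed_segment_same_Re closed_segment_eq_real_ivl cmod_def real_sqrt_mult\<close>)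
    then have "norm (p - (p - q - V)) \<le> B * (2 * T) + B * (2 * (x1 - x0))"
      using n1 norm_triangle_ineq4[of p "p - q - V"] by linarith
    then show "norm (contour_integral (linepath (Complex x0 (-T)) (Complex x0 T)) f + V) \<le> B * (2 * (x1 - x0) + 2 * T)"
      by (simp add: q_def algebra_simps)
  }
qed

section \<open>Truncated Perron kernels\<close>

lemma norm_ge_of_box_boundary:
  "T \<le> norm w" if "\<bar>Im w\<bar> = T \<or> T \<le> \<bar>Re w\<bar>" for w :: complex
  using that abs_Re_le_cmod[of w] abs_Im_le_cmod[of w] by auto

text \<open>For \<open>l \<le> 0\<close> the exponential does not grow to the right, where the
  kernel has no poles. A rectangle of width \<open>T\<close> has three outer sides of total length
  \<open>4 * T\<close>, against a kernel of size \<open>1 / T^2\<close>.\<close>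

lemma perron_kernel_neg:
  fixes c l T :: real
  assumes c: "0 < c" and l: "l \<le> 0" and T: "0 < T"
  shows "norm (contour_integral (linepath (Complex c (-T)) (Complex c T)) (\<lambda>w. exp (of_real l * w) / (w * (w + 1))))
     \<le> 4 * exp (c * l) / T"
proof -
  let ?f = "\<lambda>w::complex. exp (of_real l * w) / (w * (w + 1))"
  have hol: "?f holomorphic_on {w. 0 < Re w}"
  proof -
    have "w \<noteq> 0" "w + 1 \<noteq> 0" if "0 < Re w" for w :: complex
      using that by (auto simp: complex_eq_iff)
    then show ?thesis by (intro holomorphic_intros) auto
  qed
  have pi: "path_image (rectpath (Complex c (-T)) (Complex (c + T) T)) \<subseteq> {w. 0 < Re w}"
    using c T by (auto simp: path_image_rectpath)
  have V: "(?f has_contour_integral 0) (rectpath (Complex c (-T)) (Complex (c + T) T))"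
    by (rule Cauchy_theorem_convex_simple[OF hol]) (use pi in \<open>auto simp: convex_halfspace_Re_gt\<close>)
  have bd: "norm (?f w) \<le> exp (c * l) / T\<^sup>2" if w: "c \<le> Re w" "\<bar>Im w\<bar> = T \<or> T \<le> Re w" for w
  proof -
    have "T \<le> norm w" using w by (intro norm_ge_of_box_boundary) auto
    moreover have "T \<le> norm (w + 1)" using w c by (intro norm_ge_of_box_boundary) auto
    ultimately have "T * T \<le> norm w * norm (w + 1)" using T by (intro mult_mono) auto
    moreover have "l * Re w \<le> c * l" using mult_right_mono_neg[of c "Re w" l] w l by (simp add: mult.commute)
    ultimately show ?thesis unfolding norm_divide norm_mult norm_exp_eq_Re
      using T by (intro frac_le) (auto simp: power2_eq_square)
  qed
  have "norm (contour_integral (linepath (Complex c (-T)) (Complex c T)) ?f + 0) \<le> exp (c * l) / T\<^sup>2 * (2 * (c + T - c) + 2 * T)"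
    by (rule vertical_integrals_rect(3)[OF _ T _ _ V])
       (use T c bd in \<open>auto intro!: holomorphic_on_imp_continuous_on holomorphic_on_subset[OF hol pi]\<close>)
  also have "\<dots> = 4 * exp (c * l) / T" using T by (simp add: power2_eq_square field_simps)
  finally show ?thesis by simp
qed

lemma exp_over_linear_rectpath:
  fixes l :: real and z :: complex
  assumes "z \<in> box a b"
  shows "((\<lambda>w. exp (of_real l * w) / (w - z)) has_contour_integral (2 * pi * \<i> * exp (of_real l * z))) (rectpath a b)"
proof -
  have ab: "Re a \<le> Re b" "Im a \<le> Im b" using assms by (auto simp: in_box_complex_iff)
  have "((\<lambda>w. exp (of_real l * w) / (w - z)) has_contour_integral (2 * pi * \<i> * winding_number (rectpath a b) z * exp (of_real l * z))) (rectpath a b)"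
    by (rule Cauchy_integral_formula_convex_simple[where S = UNIV])
       (use assms ab in \<open>auto intro!: holomorphic_intros simp: path_image_rectpath_cbox_minus_box\<close>)
  then show ?thesis using winding_number_rectpath[OF assms] by simp
qed

text \<open>For \<open>l \<ge> 0\<close> the contour closes to the left and collects the poles at 0
  and -1. The second kernel, with a double pole at 0, is what a simple pole of the generating
  function produces; its residue sum \<open>l - 1 + exp (- l)\<close> carries the linear main
  term.\<close>

lemma perron_kernel_pos:
  fixes c l T :: real
  assumes c: "0 < c" "c \<le> 1" and l: "0 \<le> l" and T: "4 \<le> T"
  shows "norm (contour_integral (linepath (Complex c (-T)) (Complex c T)) (\<lambda>w. exp (of_real l * w) / (w * (w + 1)))
      - 2 * pi * \<i> * (1 - exp (- of_real l))) \<le> 16 * exp (c * l) / T" (is ?A)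
    and "norm (contour_integral (linepath (Complex c (-T)) (Complex c T)) (\<lambda>w. exp (of_real l * w) / (w^2 * (w + 1)))
      - 2 * pi * \<i> * (of_real l - 1 + exp (- of_real l))) \<le> 16 * exp (c * l) / T" (is ?B)
proof -
  let ?f = "\<lambda>w::complex. exp (of_real l * w) / (w * (w + 1))"
  let ?g = "\<lambda>w::complex. exp (of_real l * w) / (w^2 * (w + 1))"
  let ?R = "rectpath (Complex (c - T) (-T)) (Complex c T)"
  have w0: "w \<noteq> 0" "w + 1 \<noteq> 0" if "w \<in> path_image ?R" for w
    using that T c by (auto simp: path_image_rectpath complex_eq_iff)
  have box: "0 \<in> box (Complex (c - T) (-T)) (Complex c T)" "-1 \<in> box (Complex (c - T) (-T)) (Complex c T)"
    using c T by (auto simp: in_box_complex_iff)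
  note I0 = exp_over_linear_rectpath[OF box(1), of l, simplified]
  note I1 = exp_over_linear_rectpath[OF box(2), of l, simplified]
  have Vf: "(?f has_contour_integral (2 * pi * \<i> * (1 - exp (- of_real l)))) ?R"
  proof (rule has_contour_integral_eq)
    show "((\<lambda>w. exp (of_real l * w) / w - exp (of_real l * w) / (w + 1)) has_contour_integral (2 * pi * \<i> * (1 - exp (- of_real l)))) ?R"
      using has_contour_integral_diff[OF I0 I1] by (simp add: algebra_simps)
    show "exp (of_real l * w) / w - exp (of_real l * w) / (w + 1) = ?f w" if "w \<in> path_image ?R" for w
      using w0[OF that] by (simp add: divide_simps) (simp add: algebra_simps)
  qed
  \<comment> \<open>The double pole is reduced to the simple one: the integrand is the derivative of
    \<open>- exp (l * w) / w\<close>, so it integrates to 0 over a closed path.\<close>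
  have I2: "((\<lambda>w. exp (of_real l * w) / w^2 - of_real l * (exp (of_real l * w) / w)) has_contour_integral 0) ?R"
  proof -
    have "((\<lambda>w. exp (of_real l * w) / w^2 - of_real l * (exp (of_real l * w) / w)) has_contour_integral
       (- exp (of_real l * pathfinish ?R) / pathfinish ?R - (- exp (of_real l * pathstart ?R) / pathstart ?R))) ?R"
    proof (rule contour_integral_primitive[of "-{0}"])
      show "((\<lambda>w. - exp (of_real l * w) / w) has_field_derivative exp (of_real l * x) / x\<^sup>2 - of_real l * (exp (of_real l * x) / x)) (at x within - {0})"
        if "x \<in> - {0}" for x
        using that by (auto intro!: derivative_eq_intros simp: field_simps power2_eq_square)
    qed (use w0 in auto)
    then show ?thesis by simp
  qed
  have Vg: "(?g has_contour_integral (2 * pi * \<i> * (of_real l - 1 + exp (- of_real l)))) ?R"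
  proof (rule has_contour_integral_eq)
    show "((\<lambda>w. (exp (of_real l * w) / w^2 - of_real l * (exp (of_real l * w) / w)) + of_real l * (exp (of_real l * w) / w)
        - (exp (of_real l * w) / w - exp (of_real l * w) / (w + 1))) has_contour_integral (2 * pi * \<i> * (of_real l - 1 + exp (- of_real l)))) ?R"
      using has_contour_integral_diff[OF has_contour_integral_add[OF I2 has_contour_integral_lmul[OF I0, of "of_real l"]] has_contour_integral_diff[OF I0 I1]]
      by (simp add: algebra_simps)
    show "(exp (of_real l * w) / w^2 - of_real l * (exp (of_real l * w) / w)) + of_real l * (exp (of_real l * w) / w)
        - (exp (of_real l * w) / w - exp (of_real l * w) / (w + 1)) = ?g w" if "w \<in> path_image ?R" for w
      using w0[OF that] by (simp add: divide_simps power2_eq_square) (simp add: algebra_simps)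
  qed
  have cont: "continuous_on (path_image ?R) ?f" "continuous_on (path_image ?R) ?g"
    using w0 by (auto intro!: continuous_intros)
  have T1: "1 \<le> T / 2" using T by simp
  have bd: "norm (?f w) \<le> 4 * exp (c * l) / T\<^sup>2 \<and> norm (?g w) \<le> 4 * exp (c * l) / T\<^sup>2"
    if w: "Re w \<le> c" "\<bar>Im w\<bar> = T \<or> Re w \<le> c - T" for w
  proof -
    have n1: "T / 2 \<le> norm w"
      using w T c abs_Re_le_cmod[of w] abs_Im_le_cmod[of w] by auto
    \<comment> \<open>On the left side \<open>Re w \<le> c - T\<close> with
      \<open>c \<le> 1\<close>, and \<open>T \<ge> 4\<close> gives \<open>T - 2 \<ge> T / 2\<close>,
      so even the shifted factor \<open>w + 1\<close> is large enough.\<close>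
    have n2: "T / 2 \<le> norm (w + 1)"
      using w T c abs_Re_le_cmod[of "w + 1"] abs_Im_le_cmod[of "w + 1"] by auto
    have *: "(T/2) * (T/2) \<le> norm w * norm (w + 1)" using T n1 n2 by (intro mult_mono) auto
    have "1 * (norm w * norm (w + 1)) \<le> norm w * (norm w * norm (w + 1))"
      using n1 T1 by (intro mult_right_mono) auto
    then have **: "(T/2) * (T/2) \<le> (norm w)\<^sup>2 * norm (w + 1)" using * by (simp add: power2_eq_square mult.assoc)
    have e: "exp (l * Re w) \<le> exp (c * l)" using mult_left_mono[OF w(1) l] by (simp add: mult.commute)
    have eq: "4 * exp (c * l) / T\<^sup>2 = exp (c * l) / ((T/2) * (T/2))" by (simp add: power2_eq_square)
    show ?thesis unfolding norm_divide norm_mult norm_exp_eq_Re norm_power eq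
      using T e * ** by (intro conjI frac_le) auto
  qed
  have "norm (contour_integral (linepath (Complex c (-T)) (Complex c T)) ?f - 2 * pi * \<i> * (1 - exp (- of_real l)))
      \<le> 4 * exp (c * l) / T\<^sup>2 * (2 * (c - (c - T)) + 2 * T)"
    by (rule vertical_integrals_rect(2)[OF _ _ _ cont(1) Vf]) (use T bd in auto)
  also have "\<dots> = 16 * exp (c * l) / T" using T by (simp add: power2_eq_square field_simps)
  finally show ?A .
  have "norm (contour_integral (linepath (Complex c (-T)) (Complex c T)) ?g - 2 * pi * \<i> * (of_real l - 1 + exp (- of_real l)))
      \<le> 4 * exp (c * l) / T\<^sup>2 * (2 * (c - (c - T)) + 2 * T)"
    by (rule vertical_integrals_rect(2)[OF _ _ _ cont(2) Vg]) (use T bd in auto)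
  also have "\<dots> = 16 * exp (c * l) / T" using T by (simp add: power2_eq_square field_simps)
  finally show ?B .
qed

lemma perron_kernel:
  fixes c l T :: real
  assumes c: "0 < c" "c \<le> 1" and T: "4 \<le> T"
  shows "norm (contour_integral (linepath (Complex c (-T)) (Complex c T)) (\<lambda>w. exp (of_real l * w) / (w * (w + 1)))
      - 2 * pi * \<i> * of_real (max 0 (1 - exp (- l)))) \<le> 16 * exp (c * l) / T"
proof (cases "l \<le> 0")
  case True
  then have "max 0 (1 - exp (-l)) = 0" by simp
  moreover have "4 * exp (c * l) / T \<le> 16 * exp (c * l) / T" using T by (intro divide_right_mono) auto
  ultimately show ?thesis using perron_kernel_neg[OF c(1) True, of T] T by simp
next
  case False
  then have "of_real (max 0 (1 - exp (-l))) = 1 - exp (- complex_of_real l)"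
    by (simp flip: exp_of_real of_real_minus)
  then show ?thesis using perron_kernel_pos(1)[OF c _ T, of l] False by simp
qed

text \<open>On \<open>Re w = 1\<close> the series converges uniformly on the segment and may be
  integrated term by term. The truncation error of a term is at most a constant times
  \<open>norm (a n) * exp (- lam n) / T\<close>, summable in \<open>n\<close>, so the limit in
  \<open>T\<close> passes through the sum. General frequencies \<open>lam\<close> allow both
  \<open>ln n\<close> and \<open>2 * ln n\<close>.\<close>

lemma perron_series:
  fixes a :: "nat \<Rightarrow> complex" and lam :: "nat \<Rightarrow> real" and L :: real
  assumes summ: "summable (\<lambda>n. norm (a n) * exp (- lam n))"
    and G: "\<And>w. Re w = 1 \<Longrightarrow> (\<lambda>n. a n * exp (- of_real (lam n) * w)) sums G w"
  shows "((\<lambda>T. contour_integral (linepath (Complex 1 (-T)) (Complex 1 T)) (\<lambda>w. G w * exp (of_real L * w) / (w * (w + 1))))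
     \<longlongrightarrow> 2 * pi * \<i> * (\<Sum>n. a n * of_real (max 0 (1 - exp (lam n - L))))) at_top"
proof -
  define K where "K = (\<lambda>T n. contour_integral (linepath (Complex 1 (-T)) (Complex 1 T)) (\<lambda>w. exp (of_real (L - lam n) * w) / (w * (w + 1))))"
  define S where "S = (\<Sum>n. norm (a n) * exp (- lam n))"
  define m where "m = (\<lambda>n. max 0 (1 - exp (lam n - L)))"
  have nz: "w \<noteq> 0" "w + 1 \<noteq> 0" "1 \<le> norm w" "1 \<le> norm (w + 1)" if "Re w = 1" for w :: complex
    using that abs_Re_le_cmod[of w] abs_Re_le_cmod[of "w + 1"] by (auto simp: complex_eq_iff)
  have seg: "w \<in> closed_segment (Complex 1 (-T)) (Complex 1 T) \<Longrightarrow> Re w = 1" for w T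
    by (auto simp: closed_segment_same_Re)
  have ms: "summable (\<lambda>n. norm (a n * of_real (m n)))"
  proof (rule summable_comparison_test'[where N = 0])
    show "summable (\<lambda>n. exp L * (norm (a n) * exp (- lam n)))" using summ by (rule summable_mult)
    fix n :: nat
    have "m n \<le> exp (L - lam n)"
      unfolding m_def using exp_gt_zero[of "L - lam n"]
    proof (cases "lam n \<le> L")
      case True
      then have "1 \<le> exp (L - lam n)" by simp
      moreover have "0 < exp (lam n - L)" by simp
      ultimately show "max 0 (1 - exp (lam n - L)) \<le> exp (L - lam n)" by linarith
    next
      case False
      then show "max 0 (1 - exp (lam n - L)) \<le> exp (L - lam n)" by (simp add: max_def)
    qed
    then have "norm (a n) * m n \<le> norm (a n) * exp (L - lam n)" by (intro mult_left_mono) auto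
    then show "norm (norm (a n * of_real (m n))) \<le> exp L * (norm (a n) * exp (- lam n))"
      by (simp add: norm_mult m_def exp_diff exp_minus divide_inverse mult_ac)
  qed
  have sums: "(\<lambda>n. a n * K T n) sums contour_integral (linepath (Complex 1 (-T)) (Complex 1 T)) (\<lambda>w. G w * exp (of_real L * w) / (w * (w + 1)))" for T
  proof -
    let ?p = "linepath (Complex 1 (-T)) (Complex 1 T)"
    let ?t = "\<lambda>n w. a n * (exp (of_real (L - lam n) * w) / (w * (w + 1)))"
    have kc: "(\<lambda>w. exp (of_real (L - lam n) * w) / (w * (w + 1))) contour_integrable_on ?p" for n
      by (rule contour_integrable_continuous_linepath) (use nz seg in \<open>auto intro!: continuous_intros\<close>)
    have tc: "?t n contour_integrable_on ?p" for n using kc by (rule contour_integrable_lmul)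
    have U: "uniform_limit (path_image ?p) (\<lambda>N w. \<Sum>n<N. ?t n w) (\<lambda>w. \<Sum>n. ?t n w) sequentially"
    proof (rule Weierstrass_m_test)
      show "summable (\<lambda>n. exp L * (norm (a n) * exp (- lam n)))" using summ by (rule summable_mult)
      fix n w assume "w \<in> path_image ?p"
      then have w: "Re w = 1" using seg by auto
      have "1 * 1 \<le> norm w * norm (w + 1)" using nz(3,4)[OF w] by (intro mult_mono) auto
      then have "exp (L - lam n) / (norm w * norm (w + 1)) \<le> exp (L - lam n) / 1"
        by (intro divide_left_mono) auto
      then have "norm (a n) * (exp (L - lam n) / (norm w * norm (w + 1))) \<le> norm (a n) * exp (L - lam n)"
        by (intro mult_left_mono) auto
      moreover have "norm (?t n w) = norm (a n) * (exp (L - lam n) / (norm w * norm (w + 1)))"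
        by (simp add: norm_mult norm_divide w)
      moreover have "exp (L - lam n) = exp L * exp (- lam n)" by (simp flip: exp_add)
      ultimately show "norm (?t n w) \<le> exp L * (norm (a n) * exp (- lam n))"
        by (simp only: mult_ac)
    qed
    have V: "(\<lambda>N. contour_integral ?p (\<lambda>w. \<Sum>n<N. ?t n w)) \<longlonglongrightarrow> contour_integral ?p (\<lambda>w. \<Sum>n. ?t n w)"
    proof (rule contour_integral_uniform_limit(2)[OF _ U, where B = "norm (Complex 1 T - Complex 1 (-T))"])
      show "\<forall>\<^sub>F N in sequentially. (\<lambda>w. \<Sum>n<N. ?t n w) contour_integrable_on ?p"
        by (intro always_eventually allI contour_integrable_sum finite_lessThan tc)
    qed auto
    have "contour_integral ?p (\<lambda>w. \<Sum>n<N. ?t n w) = (\<Sum>n<N. a n * K T n)" for N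
    proof -
      have "contour_integral ?p (\<lambda>w. \<Sum>n<N. ?t n w) = (\<Sum>n<N. contour_integral ?p (?t n))"
        by (rule contour_integral_sum[OF finite_lessThan tc])
      also have "\<dots> = (\<Sum>n<N. a n * K T n)"
        unfolding K_def by (intro sum.cong refl contour_integral_lmul kc)
      finally show ?thesis .
    qed
    moreover have "contour_integral ?p (\<lambda>w. \<Sum>n. ?t n w) = contour_integral ?p (\<lambda>w. G w * exp (of_real L * w) / (w * (w + 1)))"
    proof (rule contour_integral_eq)
      fix w assume "w \<in> path_image ?p"
      then have w: "Re w = 1" using seg by auto
      have "(\<lambda>n. a n * exp (- of_real (lam n) * w) * (exp (of_real L * w) / (w * (w + 1)))) sums (G w * (exp (of_real L * w) / (w * (w + 1))))"
        by (intro sums_mult2 G w)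
      moreover have "a n * exp (- of_real (lam n) * w) * (exp (of_real L * w) / (w * (w + 1))) = ?t n w" for n
        by (simp add: algebra_simps exp_diff exp_minus divide_inverse)
      ultimately show "(\<Sum>n. ?t n w) = G w * exp (of_real L * w) / (w * (w + 1))"
        by (simp only: sums_unique[symmetric] times_divide_eq_right)
    qed
    ultimately show ?thesis using V by (simp add: sums_def)
  qed
  have bd: "norm (contour_integral (linepath (Complex 1 (-T)) (Complex 1 T)) (\<lambda>w. G w * exp (of_real L * w) / (w * (w + 1)))
      - 2 * pi * \<i> * (\<Sum>n. a n * of_real (m n))) \<le> 16 * exp L * S / T" if T: "4 \<le> T" for T
  proof -
    have D: "(\<lambda>n. a n * K T n - 2 * pi * \<i> * (a n * of_real (m n))) sums
       (contour_integral (linepath (Complex 1 (-T)) (Complex 1 T)) (\<lambda>w. G w * exp (of_real L * w) / (w * (w + 1))) - 2 * pi * \<i> * (\<Sum>n. a n * of_real (m n)))"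
      by (intro sums_diff sums sums_mult summable_sums summable_norm_cancel[OF ms])
    have t: "norm (a n * K T n - 2 * pi * \<i> * (a n * of_real (m n))) \<le> 16 * exp L / T * (norm (a n) * exp (- lam n))" for n
    proof -
      have "norm (K T n - 2 * pi * \<i> * of_real (m n)) \<le> 16 * exp (L - lam n) / T"
        using perron_kernel[of 1 T "L - lam n"] T by (simp add: K_def m_def)
      then have "norm (a n) * norm (K T n - 2 * pi * \<i> * of_real (m n)) \<le> norm (a n) * (16 * exp (L - lam n) / T)"
        by (intro mult_left_mono) auto
      also have "norm (a n) * norm (K T n - 2 * pi * \<i> * of_real (m n)) = norm (a n * K T n - 2 * pi * \<i> * (a n * of_real (m n)))"
        unfolding norm_mult[symmetric] by (simp add: algebra_simps)
      finally show ?thesis by (simp add: exp_diff exp_minus divide_inverse mult_ac)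
    qed
    have sm: "summable (\<lambda>n. 16 * exp L / T * (norm (a n) * exp (- lam n)))" using summ by (rule summable_mult)
    have "norm (\<Sum>n. a n * K T n - 2 * pi * \<i> * (a n * of_real (m n))) \<le> (\<Sum>n. 16 * exp L / T * (norm (a n) * exp (- lam n)))"
      by (rule norm_suminf_le[OF t sm])
    also have "\<dots> = 16 * exp L * S / T" unfolding S_def by (subst suminf_mult[OF summ]) simp
    finally show ?thesis using D by (simp add: sums_iff)
  qed
  have "((\<lambda>T. contour_integral (linepath (Complex 1 (-T)) (Complex 1 T)) (\<lambda>w. G w * exp (of_real L * w) / (w * (w + 1))))
     \<longlongrightarrow> 2 * pi * \<i> * (\<Sum>n. a n * of_real (m n))) at_top"
  proof (rule LIM_zero_cancel, rule Lim_null_comparison)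
    show "\<forall>\<^sub>F T in at_top. norm (contour_integral (linepath (Complex 1 (-T)) (Complex 1 T)) (\<lambda>w. G w * exp (of_real L * w) / (w * (w + 1)))
      - 2 * pi * \<i> * (\<Sum>n. a n * of_real (m n))) \<le> 16 * exp L * S / T"
      using bd by (intro eventually_at_top_linorderI[of 4])
    show "((\<lambda>T. 16 * exp L * S / T) \<longlongrightarrow> 0) at_top"
      by (intro tendsto_divide_0[OF tendsto_const] filterlim_at_top_imp_at_infinity filterlim_ident)
  qed
  then show ?thesis unfolding m_def .
qed

section \<open>Moving the line of integration to \<open>Re w = 1 / L\<close>\<close>

text \<open>The window at height \<open>j\<close> carries a factor \<open>ln j\<close> from the
  number of nearby zeros and \<open>1 / j^2\<close> from the kernel; the logarithm is absorbed by
  \<open>1 + ln x \<le> 2 * sqrt x\<close>.\<close>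

lemma window_weight_summable: "summable (\<lambda>j::nat. (1 + ln (1 + real j)) / (1 + (real j)\<^sup>2))"
proof (rule summable_comparison_test'[where N = 0])
  have "summable (\<lambda>j. real (Suc j) powr (-3/2))"
    using summable_real_powr_iff[of "-3/2"] by (subst summable_Suc_iff) simp
  then show "summable (\<lambda>j. 4 * (real (Suc j) powr (-3/2)))" by (rule summable_mult)
  fix j :: nat
  define x where "x = 1 + real j"
  have x: "1 \<le> x" by (simp add: x_def)
  have l: "1 + ln x \<le> 2 * sqrt x"
    using ln_le_minus_one[of "sqrt x"] x by (simp add: ln_sqrt)
  have s: "x\<^sup>2 \<le> 2 * (1 + (real j)\<^sup>2)"
    using sum_squares_bound[of 1 "real j"] by (simp add: x_def power2_eq_square algebra_simps)
  have "(1 + ln x) / (1 + (real j)\<^sup>2) \<le> 2 * sqrt x / (x\<^sup>2 / 2)"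
    using l s x by (intro frac_le) auto
  also have "\<dots> = 4 * (sqrt x / x\<^sup>2)" by simp
  also have "sqrt x / x\<^sup>2 = x powr (-3/2)"
  proof -
    have "sqrt x = x powr (1/2)" using x by (simp add: powr_half_sqrt)
    moreover have "x\<^sup>2 = x powr 2" using x by (simp add: powr_numeral)
    ultimately have "sqrt x / x\<^sup>2 = x powr (1/2 - 2)" by (simp only: powr_diff)
    then show ?thesis by simp
  qed
  finally show "norm ((1 + ln (1 + real j)) / (1 + (real j)\<^sup>2)) \<le> 4 * (real (Suc j) powr (-3/2))"
    using x by (simp add: x_def add.commute)
qed

text \<open>Half-integer end points make the unit windows tile the interval; the heights
  \<open>j\<close> and \<open>-j\<close> share one bound, and counting \<open>j = 0\<close> twice is
  harmless as the bounds are nonnegative.\<close>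

lemma integral_windows_le:
  fixes v :: "real \<Rightarrow> real" and u :: "nat \<Rightarrow> real"
  assumes int: "\<And>a b. v integrable_on {a..b}"
    and u: "\<And>j::int. integral {of_int j - 1/2..of_int j + 1/2} v \<le> u (nat \<bar>j\<bar>)" and u0: "\<And>j. 0 \<le> u j"
  shows "integral {-(real N + 1/2)..real N + 1/2} v \<le> 2 * (\<Sum>j\<le>N. u j)"
proof (induction N)
  case 0
  then show ?case using u[of 0] u0[of 0] by simp
next
  case (Suc N)
  have 1: "integral {-(real N + 1/2)..real (Suc N) + 1/2} v =
      integral {-(real N + 1/2)..real N + 1/2} v + integral {real N + 1/2..real (Suc N) + 1/2} v"
    by (rule Henstock_Kurzweil_Integration.integral_combine[symmetric]) (use int in auto)
  have 2: "integral {-(real (Suc N) + 1/2)..real (Suc N) + 1/2} v =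
      integral {-(real (Suc N) + 1/2)..-(real N + 1/2)} v + integral {-(real N + 1/2)..real (Suc N) + 1/2} v"
    by (rule Henstock_Kurzweil_Integration.integral_combine[symmetric]) (use int in auto)
  have e: "{real N + 1/2..real (Suc N) + 1/2} = {of_int (int (Suc N)) - 1/2..of_int (int (Suc N)) + 1/2}"
    "{-(real (Suc N) + 1/2)..-(real N + 1/2)} = {of_int (- int (Suc N)) - 1/2..of_int (- int (Suc N)) + (1/2::real)}"
    by auto
  have "integral {real N + 1/2..real (Suc N) + 1/2} v \<le> u (Suc N)"
    unfolding e using u[of "int (Suc N)"] by (simp only: abs_of_nat nat_int)
  moreover have "integral {-(real (Suc N) + 1/2)..-(real N + 1/2)} v \<le> u (Suc N)"
    unfolding e using u[of "- int (Suc N)"] by (simp only: abs_of_nat nat_int abs_minus_cancel)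
  ultimately show ?case unfolding 2 1 using Suc.IH by simp
qed

text \<open>Shifting the line of integration to \<open>Re w = 1 / L\<close>, the factor \<open>exp (L * w)\<close> is bounded, and the
  contribution of the remaining singularities of \<open>G\<close> on the imaginary axis is only logarithmic in \<open>L\<close>.\<close>

lemma perron_asymptotics:
  fixes G :: "complex \<Rightarrow> complex" and A :: "real \<Rightarrow> complex" and \<mu> :: complex and C \<eta> B :: real
  assumes hol: "G holomorphic_on {w. 0 < Re w}"
    and bd1: "\<And>t0 c w. 0 < c \<Longrightarrow> c \<le> 1 \<Longrightarrow> c \<le> Re w \<Longrightarrow> Re w \<le> 1 \<Longrightarrow> \<bar>Im w - t0\<bar> \<le> 1/2 \<Longrightarrow>
       norm (G w) \<le> C * (1 + ln (1 + \<bar>t0\<bar>)) / c"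
    and bd2: "\<And>t0 c. 0 < c \<Longrightarrow> c \<le> 1 \<Longrightarrow> integral {t0 - 1/2..t0 + 1/2} (\<lambda>t. norm (G (Complex c t)))
       \<le> C * (1 + ln (1 + \<bar>t0\<bar>)) * (1 + ln (1/c))"
    and C: "0 \<le> C" and \<eta>: "0 < \<eta>" "\<eta> \<le> 1/2"
    and near: "\<And>w. 0 < Re w \<Longrightarrow> norm w \<le> \<eta> \<Longrightarrow> norm (G w + \<mu> / w) \<le> B"
    and lim: "\<And>L. 0 < L \<Longrightarrow> ((\<lambda>T. contour_integral (linepath (Complex 1 (-T)) (Complex 1 T))
         (\<lambda>w. G w * exp (of_real L * w) / (w * (w + 1)))) \<longlongrightarrow> 2 * pi * \<i> * A L) at_top"
  shows "\<exists>D. \<forall>L\<ge>1. norm (A L + \<mu> * of_real L) \<le> D * (1 + ln L)"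
proof -
  \<comment> \<open>Chosen so that \<open>1 + t^2 \<le> \<kappa> * norm w ^ 2\<close> for
    \<open>t = Im w\<close> outside the disc of radius \<open>\<eta>\<close>.\<close>
  define \<kappa> where "\<kappa> = 1 / \<eta>\<^sup>2 + 1"
  define E where "E = 4 * exp 1 * \<kappa>"
  define B' where "B' = max B 0"
  define D where "D = E * (C + norm \<mu> / \<eta>) + 12 * exp 1 * B'"
  define u where "u = (\<lambda>j::nat. (1 + ln (1 + real j)) / (1 + (real j)\<^sup>2))"
  define U where "U = (\<Sum>j. u j)"
  have \<kappa>: "0 \<le> \<kappa>" by (simp add: \<kappa>_def)
  have E0: "0 \<le> E" using \<kappa> by (simp add: E_def)
  have D0: "0 \<le> D" using E0 C \<eta> by (simp add: D_def B'_def)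
  have u0: "0 \<le> u j" for j by (simp add: u_def)
  have nz: "w \<noteq> 0" "w + 1 \<noteq> 0" if "0 < Re w" for w :: complex
    using that by (auto simp: complex_eq_iff)
  \<comment> \<open>The pole part \<open>- \<mu> / w\<close> of \<open>G\<close> is transformed
    exactly, giving \<open>- \<mu> * (L - 1 + exp (- L))\<close>; only
    \<open>G w + \<mu> / w\<close> has to be estimated.\<close>
  have main: "norm (A L + \<mu> * (of_real L - 1 + exp (- of_real L))) \<le> D * (1 + ln L) * 2 * U" if L: "1 \<le> L" for L
  proof -
    define c where "c = 1 / L"
    have c: "0 < c" "c \<le> 1" "c * L = 1" "1 / c = L" using L by (auto simp: c_def)
    let ?k = "\<lambda>w. G w * exp (of_real L * w) / (w * (w + 1))"
    let ?g = "\<lambda>w::complex. exp (of_real L * w) / (w^2 * (w + 1))"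
    let ?p = "\<lambda>x T. linepath (Complex x (-T)) (Complex x T)"
    define R where "R = (\<lambda>w. G w + \<mu> / w)"
    let ?r = "\<lambda>w. R w * exp (of_real L * w) / (w * (w + 1))"
    have khol: "?k holomorphic_on {w. 0 < Re w}" using nz by (intro holomorphic_intros hol) auto
    have ghol: "?g holomorphic_on {w. 0 < Re w}" using nz by (intro holomorphic_intros) auto
    have rhol: "?r holomorphic_on {w. 0 < Re w}" using nz unfolding R_def by (intro holomorphic_intros hol) auto
    have seg: "closed_segment (Complex c (-T)) (Complex c T) \<subseteq> {w. 0 < Re w}" for T
      using c by (auto simp: closed_segment_same_Re)
    have ci: "f contour_integrable_on ?p c T" if "f holomorphic_on {w. 0 < Re w}" for f T
      by (rule contour_integrable_continuous_linepath, rule holomorphic_on_imp_continuous_on,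
          rule holomorphic_on_subset[OF that seg])
    \<comment> \<open>For fixed \<open>L\<close> the horizontal sides tend to 0 like
      \<open>ln T / T^2\<close>, even with the crude pointwise bound.\<close>
    have shift: "norm (contour_integral (?p 1 T) ?k - contour_integral (?p c T) ?k) \<le> 2 * C * exp L / c * ((1 + ln (1 + T)) / T\<^sup>2)"
      if T: "0 < T" for T
    proof -
      define b where "b = C * exp L / c * ((1 + ln (1 + T)) / T\<^sup>2)"
      have b0: "0 \<le> b" using C c T by (simp add: b_def)
      have pi: "path_image (rectpath (Complex c (-T)) (Complex 1 T)) \<subseteq> {w. 0 < Re w}"
        using c T by (auto simp: path_image_rectpath)
      have "norm (contour_integral (?p 1 T) ?k - contour_integral (?p c T) ?k - 0) \<le> b * (2 * (1 - c))"
      proof (rule vertical_integrals_rect(1)[OF c(2) T b0])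
        show "continuous_on (path_image (rectpath (Complex c (-T)) (Complex 1 T))) ?k"
          by (rule holomorphic_on_imp_continuous_on, rule holomorphic_on_subset[OF khol pi])
        show "(?k has_contour_integral 0) (rectpath (Complex c (-T)) (Complex 1 T))"
          by (rule Cauchy_theorem_convex_simple[OF khol]) (use pi in \<open>auto simp: convex_halfspace_Re_gt\<close>)
        fix w assume w: "c \<le> Re w" "Re w \<le> 1" "\<bar>Im w\<bar> = T"
        have "norm (G w) \<le> C * (1 + ln (1 + \<bar>Im w\<bar>)) / c" by (rule bd1) (use c w in auto)
        then have g: "norm (G w) \<le> C * (1 + ln (1 + T)) / c" using w by simp
        have e: "exp (L * Re w) \<le> exp L" using mult_left_mono[OF w(2), of L] L by simp
        have "T * T \<le> norm w * norm (w + 1)"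
          using w T norm_ge_of_box_boundary[of w T] norm_ge_of_box_boundary[of "w + 1" T] by (intro mult_mono) auto
        then have "norm (?k w) \<le> (C * (1 + ln (1 + T)) / c * exp L) / (T * T)"
          unfolding norm_divide norm_mult norm_exp_eq_Re using g e T C c
          by (intro frac_le mult_mono[of "norm (G w)"]) auto
        also have "\<dots> = b" by (simp add: b_def power2_eq_square)
        finally show "norm (?k w) \<le> b" .
      qed
      also have "\<dots> \<le> b * 2" using b0 c by (intro mult_left_mono) auto
      finally show ?thesis by (simp add: b_def mult_ac)
    qed
    have lim1: "((\<lambda>T. contour_integral (?p c T) ?k) \<longlongrightarrow> 2 * pi * \<i> * A L) at_top"
    proof -
      have "((\<lambda>T. contour_integral (?p 1 T) ?k - contour_integral (?p c T) ?k) \<longlongrightarrow> 0) at_top"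
      proof (rule Lim_null_comparison)
        show "\<forall>\<^sub>F T in at_top. norm (contour_integral (?p 1 T) ?k - contour_integral (?p c T) ?k) \<le> 2 * C * exp L / c * ((1 + ln (1 + T)) / T\<^sup>2)"
          using shift by (intro eventually_at_top_linorderI[of 1]) auto
        have "((\<lambda>T::real. (1 + ln (1 + T)) / T\<^sup>2) \<longlongrightarrow> 0) at_top" by real_asymp
        then show "((\<lambda>T. 2 * C * exp L / c * ((1 + ln (1 + T)) / T\<^sup>2)) \<longlongrightarrow> 0) at_top"
          by (rule tendsto_mult_right_zero)
      qed
      from tendsto_diff[OF lim[of L] this] L show ?thesis by simp
    qed
    have lim2: "((\<lambda>T. contour_integral (?p c T) ?g) \<longlongrightarrow> 2 * pi * \<i> * (of_real L - 1 + exp (- of_real L))) at_top"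
    proof (rule LIM_zero_cancel, rule Lim_null_comparison)
      show "\<forall>\<^sub>F T in at_top. norm (contour_integral (?p c T) ?g - 2 * pi * \<i> * (of_real L - 1 + exp (- of_real L))) \<le> 16 * exp (c * L) / T"
        using perron_kernel_pos(2)[OF c(1,2), of L] L by (intro eventually_at_top_linorderI[of 4]) auto
      show "((\<lambda>T. 16 * exp (c * L) / T) \<longlongrightarrow> 0) at_top"
        by (intro tendsto_divide_0[OF tendsto_const] filterlim_at_top_imp_at_infinity filterlim_ident)
    qed
    have req: "contour_integral (?p c T) ?r = contour_integral (?p c T) ?k + \<mu> * contour_integral (?p c T) ?g" for T
    proof -
      have "contour_integral (?p c T) ?r = contour_integral (?p c T) (\<lambda>w. ?k w + \<mu> * ?g w)"
      proof (rule contour_integral_eq)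
        fix w assume "w \<in> path_image (?p c T)"
        then have "0 < Re w" using seg by auto
        from nz[OF this] show "?r w = ?k w + \<mu> * ?g w"
          by (simp add: R_def divide_simps power2_eq_square) (simp add: algebra_simps)
      qed
      also have "\<dots> = contour_integral (?p c T) ?k + contour_integral (?p c T) (\<lambda>w. \<mu> * ?g w)"
        by (rule contour_integral_add) (intro ci khol contour_integrable_lmul ghol)+
      also have "contour_integral (?p c T) (\<lambda>w. \<mu> * ?g w) = \<mu> * contour_integral (?p c T) ?g"
        by (rule contour_integral_lmul) (intro ci ghol)
      finally show ?thesis .
    qed
    have lim3: "((\<lambda>T. contour_integral (?p c T) ?r) \<longlongrightarrow> 2 * pi * \<i> * (A L + \<mu> * (of_real L - 1 + exp (- of_real L)))) at_top"
      unfolding req using tendsto_add[OF lim1 tendsto_mult_left[OF lim2, of \<mu>]] by (simp add: algebra_simps)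
    define v where "v = (\<lambda>t. norm (?r (Complex c t)))"
    have vcont: "continuous_on S (\<lambda>t. f (Complex c t))" if "f holomorphic_on {w. 0 < Re w}" for f :: "complex \<Rightarrow> complex" and S
      by (rule continuous_on_compose2[OF holomorphic_on_imp_continuous_on[OF that]])
         (use c in \<open>auto intro!: continuous_intros simp: Complex_eq\<close>)
    have vint: "v integrable_on {a..b}" for a b
      unfolding v_def by (intro integrable_continuous_interval continuous_on_norm vcont rhol)
    have Gint: "(\<lambda>t. norm (G (Complex c t))) integrable_on {a..b}" for a b
      by (intro integrable_continuous_interval continuous_on_norm vcont hol)
    \<comment> \<open>The bound on inverse distances is reused with \<open>\<rho> = 1/2\<close>,
      where the distance is just \<open>norm w\<close>: near 0 the remainder \<open>R\<close> is
      bounded, but the kernel still contributes \<open>1 / norm w\<close>.\<close>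
    have "Re (1/2::complex) \<le> 1/2" "\<bar>Im (1/2::complex) - 0\<bar> \<le> 9/5" by auto
    note I0 = integral_inverse_dist_le[OF c(1,2) this]
    have win: "integral {of_int j - 1/2..of_int j + 1/2} v \<le> D * (1 + ln L) * u (nat \<bar>j\<bar>)" for j :: int
    proof -
      let ?J = "{of_int j - 1/2..of_int j + (1/2::real)}"
      define e where "e = E / (1 + (of_int j)\<^sup>2)"
      have e0: "0 \<le> e" using E0 by (simp add: e_def)
      have pt: "v t \<le> e * (norm (G (Complex c t)) + norm \<mu> / \<eta>) +
          (if j = 0 then exp 1 * B' * (1 / norm (Complex (1/2 + c) t - 1/2)) else 0)" if t: "t \<in> ?J" for t
      proof -
        define w where "w = Complex c t"
        have w: "Re w = c" "Im w = t" by (auto simp: w_def)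
        have w0: "w \<noteq> 0" using nz[of w] w c by auto
        \<comment> \<open>As \<open>c * L = 1\<close>, the exponential has the constant modulus
          \<open>exp 1\<close> on the line.\<close>
        have vt: "v t = norm (R w) * exp 1 / (norm w * norm (w + 1))"
          using c by (simp add: v_def w_def norm_divide norm_mult mult.commute[of L])
        have ww: "norm w \<le> norm (w + 1)" unfolding cmod_def using w c by (intro real_sqrt_le_mono) (auto intro: power_mono)
        have w1: "1 \<le> norm (w + 1)" using abs_Re_le_cmod[of "w + 1"] w c by auto
        have sh: "norm (Complex (1/2 + c) t - 1/2) = norm w" by (simp add: w_def cmod_def)
        have G0: "0 \<le> e * (norm (G w) + norm \<mu> / \<eta>)" using e0 \<eta> by simp
        show ?thesis
        proof (cases "norm w \<le> \<eta>")
          case True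
          have "\<bar>t\<bar> < 1/2"
          proof -
            have "\<bar>t\<bar>\<^sup>2 < (norm w)\<^sup>2" using c w by (simp add: cmod_power2)
            also have "\<dots> \<le> (1/2)\<^sup>2" using True \<eta> by (intro power_mono) auto
            finally show ?thesis by (rule power2_less_imp_less) simp
          qed
          then have "\<bar>real_of_int j\<bar> < 1" using t unfolding atLeastAtMost_iff by arith
          then have j: "j = 0" by linarith
          have "norm (R w) \<le> B'" using near[of w] True w c by (auto simp: R_def B'_def)
          moreover have "norm w * 1 \<le> norm w * norm (w + 1)" using w1 by (intro mult_left_mono) auto
          ultimately have "v t \<le> B' * exp 1 / (norm w * 1)"
            unfolding vt using w0 by (intro frac_le mult_mono) (auto simp: B'_def)
          then show ?thesis using G0 j sh by (simp add: w_def mult_ac)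
        next
          case False
          have R: "norm (R w) \<le> norm (G w) + norm \<mu> / \<eta>"
          proof -
            have "norm (\<mu> / w) \<le> norm \<mu> / \<eta>" unfolding norm_divide using False \<eta> w0 by (intro divide_left_mono) auto
            then show ?thesis unfolding R_def using norm_triangle_ineq[of "G w" "\<mu> / w"] by linarith
          qed
          have "(of_int j)\<^sup>2 \<le> (\<bar>t\<bar> + 1/2)\<^sup>2" using t by (intro abs_le_square_iff[THEN iffD1]) auto
          also have "\<dots> = t\<^sup>2 + \<bar>t\<bar> + 1/4" by (simp add: power2_eq_square algebra_simps)
          also have "\<dots> \<le> 2 * t\<^sup>2 + 1/2" using zero_le_power2[of "\<bar>t\<bar> - 1/2"] by (simp add: power2_eq_square algebra_simps)
          finally have j1: "1 + (of_int j)\<^sup>2 \<le> 4 * (1 + t\<^sup>2)" using zero_le_power2[of t] unfolding distrib_left by linarith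
          have wt: "t\<^sup>2 \<le> (norm w)\<^sup>2" using w by (simp add: cmod_power2)
          have "\<eta>\<^sup>2 \<le> (norm w)\<^sup>2" using False \<eta> by (intro power_mono) auto
          then have "1 \<le> (norm w)\<^sup>2 / \<eta>\<^sup>2" using \<eta> by simp
          then have "1 + t\<^sup>2 \<le> (norm w)\<^sup>2 * \<kappa>" using wt by (simp add: \<kappa>_def algebra_simps)
          also have "\<dots> \<le> (norm w * norm (w + 1)) * \<kappa>"
            using ww \<kappa> by (intro mult_right_mono) (auto simp: power2_eq_square intro: mult_left_mono)
          finally have "4 * (1 + t\<^sup>2) \<le> 4 * ((norm w * norm (w + 1)) * \<kappa>)" by (rule mult_left_mono) simp
          then have "1 + (of_int j)\<^sup>2 \<le> 4 * ((norm w * norm (w + 1)) * \<kappa>)" using j1 by (rule order_trans[rotated])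
          then have "1 + (of_int j)\<^sup>2 \<le> 4 * \<kappa> * (norm w * norm (w + 1))" by (simp only: mult_ac)
          moreover have "0 < 1 + (real_of_int j)\<^sup>2" by (simp add: add_pos_nonneg)
          moreover have "0 < norm w * norm (w + 1)" using w0 w1 by (intro mult_pos_pos) auto
          ultimately have "1 / (norm w * norm (w + 1)) \<le> 4 * \<kappa> / (1 + (of_int j)\<^sup>2)"
            by (simp add: field_simps)
          then have "(norm (R w) * exp 1) * (1 / (norm w * norm (w + 1))) \<le> ((norm (G w) + norm \<mu> / \<eta>) * exp 1) * (4 * \<kappa> / (1 + (of_int j)\<^sup>2))"
            using R \<eta> by (intro mult_mono) auto
          then have "v t \<le> e * (norm (G w) + norm \<mu> / \<eta>)" by (simp add: vt e_def E_def mult_ac)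
          moreover have "0 \<le> (if j = 0 then exp 1 * B' * (1 / norm (Complex (1/2 + c) t - 1/2)) else 0)" by (simp add: B'_def)
          ultimately show ?thesis unfolding w_def by linarith
        qed
      qed
      have i1: "((\<lambda>t. e * (norm (G (Complex c t)) + norm \<mu> / \<eta>)) has_integral
          e * (integral ?J (\<lambda>t. norm (G (Complex c t))) + norm \<mu> / \<eta>)) ?J"
      proof -
        have "((\<lambda>t. norm \<mu> / \<eta>) has_integral norm \<mu> / \<eta>) ?J" using has_integral_const_real[of "norm \<mu> / \<eta>" "of_int j - 1/2" "of_int j + 1/2"] by simp
        then show ?thesis by (intro has_integral_mult_right has_integral_add integrable_integral Gint)
      qed
      have i2: "((\<lambda>t. if j = 0 then exp 1 * B' * (1 / norm (Complex (1/2 + c) t - 1/2)) else 0) has_integral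
          (if j = 0 then exp 1 * B' * integral {0 - 1/2..0 + 1/2} (\<lambda>t. 1 / norm (Complex (1/2 + c) t - 1/2)) else 0)) ?J"
      proof (cases "j = 0")
        case True
        have "((\<lambda>t. exp 1 * B' * (1 / norm (Complex (1/2 + c) t - 1/2))) has_integral
          exp 1 * B' * integral {0 - 1/2..0 + 1/2} (\<lambda>t. 1 / norm (Complex (1/2 + c) t - 1/2))) {0 - 1/2..0 + 1/2}"
          by (intro has_integral_mult_right integrable_integral I0)
        with True show ?thesis by simp
      qed simp
      have lnL: "0 \<le> ln L" using L by simp
      have "integral ?J v \<le> e * (integral ?J (\<lambda>t. norm (G (Complex c t))) + norm \<mu> / \<eta>) +
         (if j = 0 then exp 1 * B' * integral {0 - 1/2..0 + 1/2} (\<lambda>t. 1 / norm (Complex (1/2 + c) t - 1/2)) else 0)"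
        by (rule has_integral_le[OF integrable_integral[OF vint] has_integral_add[OF i1 i2]]) (use pt in auto)
      also have "\<dots> \<le> e * ((C + norm \<mu> / \<eta>) * (1 + ln (1 + \<bar>of_int j\<bar>)) * (1 + ln L)) + 12 * exp 1 * B' * (1 + ln L) * u (nat \<bar>j\<bar>)"
      proof (rule add_mono)
        have ring_eq: "(x + y) * z * w = x * z * w + y * (z * w)" for x y z w :: real by (simp add: algebra_simps)
        have G1: "integral ?J (\<lambda>t. norm (G (Complex c t))) \<le> C * (1 + ln (1 + \<bar>of_int j\<bar>)) * (1 + ln L)"
          using bd2[OF c(1,2), of "of_int j"] c(4) by simp
        have "1 * 1 \<le> (1 + ln (1 + \<bar>real_of_int j\<bar>)) * (1 + ln L)" using lnL by (intro mult_mono) auto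
        then have "norm \<mu> / \<eta> * 1 \<le> norm \<mu> / \<eta> * ((1 + ln (1 + \<bar>real_of_int j\<bar>)) * (1 + ln L))"
          using \<eta> by (intro mult_left_mono) auto
        with G1 have "integral ?J (\<lambda>t. norm (G (Complex c t))) + norm \<mu> / \<eta> \<le> (C + norm \<mu> / \<eta>) * (1 + ln (1 + \<bar>of_int j\<bar>)) * (1 + ln L)"
          using ring_eq[of C "norm \<mu> / \<eta>" "1 + ln (1 + \<bar>real_of_int j\<bar>)" "1 + ln L"] by linarith
        then show "e * (integral ?J (\<lambda>t. norm (G (Complex c t))) + norm \<mu> / \<eta>) \<le> e * ((C + norm \<mu> / \<eta>) * (1 + ln (1 + \<bar>of_int j\<bar>)) * (1 + ln L))"
          using e0 by (rule mult_left_mono)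
        show "(if j = 0 then exp 1 * B' * integral {0 - 1/2..0 + 1/2} (\<lambda>t. 1 / norm (Complex (1/2 + c) t - 1/2)) else 0)
           \<le> 12 * exp 1 * B' * (1 + ln L) * u (nat \<bar>j\<bar>)"
        proof (cases "j = 0")
          case True
          have "exp 1 * B' * integral {0 - 1/2..0 + 1/2} (\<lambda>t. 1 / norm (Complex (1/2 + c) t - 1/2)) \<le> exp 1 * B' * (12 * (1 + ln (1/c)))"
            by (rule mult_left_mono[OF I0(2)]) (simp add: B'_def)
          then show ?thesis using True c(4) by (simp add: u_def mult_ac)
        next
          case False
          then show ?thesis using lnL u0 by (simp add: B'_def)
        qed
      qed
      also have "e * ((C + norm \<mu> / \<eta>) * (1 + ln (1 + \<bar>of_int j\<bar>)) * (1 + ln L)) = E * (C + norm \<mu> / \<eta>) * (1 + ln L) * u (nat \<bar>j\<bar>)"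
        by (simp add: e_def u_def)
      also have "E * (C + norm \<mu> / \<eta>) * (1 + ln L) * u (nat \<bar>j\<bar>) + 12 * exp 1 * B' * (1 + ln L) * u (nat \<bar>j\<bar>) = D * (1 + ln L) * u (nat \<bar>j\<bar>)"
        by (simp add: D_def algebra_simps)
      finally show ?thesis .
    qed
    have lnL: "0 \<le> ln L" using L by simp
    have DL: "0 \<le> D * (1 + ln L)" using D0 lnL by simp
    have bound: "norm (contour_integral (?p c (real N + 1/2)) ?r) \<le> D * (1 + ln L) * 2 * U" for N
    proof -
      let ?I = "{-(real N + 1/2)..real N + 1/2}"
      have "contour_integral (?p c (real N + 1/2)) ?r = \<i> * integral ?I (\<lambda>t. ?r (Complex c t))"
        by (rule contour_integral_linepath_same_Re) auto
      then have "norm (contour_integral (?p c (real N + 1/2)) ?r) = norm (integral ?I (\<lambda>t. ?r (Complex c t)))"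
        by (simp add: norm_mult)
      also have "\<dots> \<le> integral ?I v"
        by (rule integral_norm_bound_integral)
           (auto simp: v_def intro!: integrable_continuous_interval vcont[OF rhol] continuous_on_norm)
      also have "\<dots> \<le> 2 * (\<Sum>j\<le>N. D * (1 + ln L) * u j)"
        by (rule integral_windows_le[OF vint win]) (use DL u0 in auto)
      also have "\<dots> = D * (1 + ln L) * 2 * (\<Sum>j\<le>N. u j)" by (subst sum_distrib_left[symmetric]) simp
      also have "\<dots> \<le> D * (1 + ln L) * 2 * U"
        unfolding U_def using DL u0 window_weight_summable
        by (intro mult_left_mono sum_le_suminf) (auto simp: u_def)
      finally show ?thesis .
    qed
    \<comment> \<open>It suffices to let \<open>T\<close> run through half-integers, which fit the
      windows, because the limit over all \<open>T\<close> is known to exist.\<close>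
    have "filterlim (\<lambda>N. real N + 1/2) at_top sequentially" by real_asymp
    from filterlim_compose[OF lim3 this]
    have "(\<lambda>N. contour_integral (?p c (real N + 1/2)) ?r) \<longlonglongrightarrow> 2 * pi * \<i> * (A L + \<mu> * (of_real L - 1 + exp (- of_real L)))" .
    then have "norm (2 * pi * \<i> * (A L + \<mu> * (of_real L - 1 + exp (- of_real L)))) \<le> D * (1 + ln L) * 2 * U"
      by (rule Lim_bounded[OF tendsto_norm, of _ _ 0]) (use bound in auto)
    moreover have "norm (A L + \<mu> * (of_real L - 1 + exp (- of_real L))) \<le> norm (2 * pi * \<i> * (A L + \<mu> * (of_real L - 1 + exp (- of_real L))))"
    proof -
      have "1 * norm (A L + \<mu> * (of_real L - 1 + exp (- of_real L))) \<le> 2 * pi * norm (A L + \<mu> * (of_real L - 1 + exp (- of_real L)))"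
        using pi_gt3 by (intro mult_right_mono) auto
      then show ?thesis by (simp add: norm_mult)
    qed
    ultimately show ?thesis by linarith
  qed
  show ?thesis
  proof (intro exI allI impI)
    fix L :: real assume L: "1 \<le> L"
    have lnL: "0 \<le> ln L" using L by simp
    \<comment> \<open>Passing from \<open>L - 1 + exp (- L)\<close> to \<open>L\<close> costs at
      most \<open>norm \<mu>\<close>.\<close>
    have "A L + \<mu> * of_real L = (A L + \<mu> * (of_real L - 1 + exp (- of_real L))) + \<mu> * (1 - exp (- of_real L))"
      by (simp add: algebra_simps)
    also have "norm \<dots> \<le> D * (1 + ln L) * 2 * U + norm \<mu> * 1"
    proof (rule norm_triangle_mono[OF main[OF L]])
      have "(1 - exp (- of_real L) :: complex) = of_real (1 - exp (- L))" by (simp flip: exp_of_real)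
      then have "norm (1 - exp (- of_real L) :: complex) = \<bar>1 - exp (- L)\<bar>" by (simp only: norm_of_real real_norm_def)
      also have "\<dots> \<le> 1" using L by simp
      finally show "norm (\<mu> * (1 - exp (- of_real L))) \<le> norm \<mu> * 1" unfolding norm_mult by (intro mult_left_mono) auto
    qed
    also have "\<dots> \<le> D * (1 + ln L) * 2 * U + norm \<mu> * (1 + ln L)" using lnL by (intro add_left_mono mult_left_mono) auto
    finally show "norm (A L + \<mu> * of_real L) \<le> (D * 2 * U + norm \<mu>) * (1 + ln L)" by (simp add: algebra_simps)
  qed
qed

section \<open>L-functions under the Riemann hypothesis\<close>

text \<open>The function \<open>(s - 1) * zeta s\<close>, continued to \<open>Re s > 0\<close> by comparing the series with an integral.\<close>

definition zeta_reg :: "complex \<Rightarrow> complex" where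
  "zeta_reg s = 1 + (\<Sum>n. if n = 0 then 0 else (s - 1) * of_nat n powr (- s) - (of_nat n powr (1 - s) - of_nat (Suc n) powr (1 - s)))"

lemma zeta_reg:
  shows zeta_reg_holomorphic: "zeta_reg holomorphic_on {s. 0 < Re s}"
    and zeta_reg_bound: "\<exists>C\<ge>0. \<forall>s. 1/10 \<le> Re s \<longrightarrow> norm (zeta_reg s) \<le> 1 + C * (norm (s - 1) * norm s)"
    and zeta_reg_1: "zeta_reg 1 = 1"
    and zeta_reg_eq: "\<And>s. 1 < Re s \<Longrightarrow> zeta_reg s = (s - 1) * dirichlet_L (\<lambda>_. 1) s"
proof -
  define h where "h = (\<lambda>n s. if n = 0 then 0 else (s - 1) * of_nat n powr (- s) - (of_nat n powr (1 - s) - of_nat (Suc n) powr (1 - s :: complex)))"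
  have zh: "zeta_reg s = 1 + (\<Sum>n. h n s)" for s by (simp add: zeta_reg_def h_def)
  have bd: "norm (h n s) \<le> (norm (s - 1) * norm s) * real n powr (- Re s - 1)" if s: "0 < Re s" for n s
  proof (cases "n = 0")
    case False
    define y where "y = real n"
    have y: "0 < y" using False by (simp add: y_def)
    define B where "B = norm (s - 1) * (norm s * y powr (- Re s - 1))"
    \<comment> \<open>The increment of this function over \<open>[y, y + 1]\<close> is the term
      \<open>h n s\<close>. Its derivative is \<open>s - 1\<close> times a difference of powers
      \<open>- s\<close>, so the bound on such differences gains one power of
      \<open>n\<close>.\<close>
    let ?\<phi> = "\<lambda>z. (s - 1) * of_real y powr (- s) * z + z powr (1 - s)"
    have z: "\<exists>t. z = of_real t \<and> y \<le> t \<and> t \<le> y + 1" if "z \<in> closed_segment (of_real y) (of_real (y + 1))" for z :: complex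
    proof -
      have "z \<in> of_real ` closed_segment y (y + 1)" using that by (simp only: closed_segment_of_real)
      then show ?thesis by (auto simp: closed_segment_eq_real_ivl)
    qed
    have "norm (?\<phi> (of_real (y + 1)) - ?\<phi> (of_real y)) \<le> B * norm (of_real (y + 1) - of_real y :: complex)"
    proof (rule field_differentiable_bound[of "closed_segment (of_real y) (of_real (y + 1))"])
      fix z assume "z \<in> closed_segment (of_real y) (of_real (y + 1) :: complex)"
      then obtain t where t: "z = of_real t" "y \<le> t" "t \<le> y + 1" using z by blast
      then have "z \<notin> \<real>\<^sub>\<le>\<^sub>0" using y by (auto simp: complex_nonpos_Reals_iff)
      then have "((\<lambda>z. z powr (1 - s)) has_field_derivative (1 - s) * z powr (1 - s - 1)) (at z)"
        by (rule has_field_derivative_powr)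
      from DERIV_add[OF DERIV_cmult_Id this]
      have "(?\<phi> has_field_derivative (s - 1) * of_real y powr (- s) + (1 - s) * z powr (1 - s - 1)) (at z)" .
      also have "(s - 1) * of_real y powr (- s) + (1 - s) * z powr (1 - s - 1) = (s - 1) * (of_real y powr (- s) - z powr (- s))"
        by (simp add: algebra_simps)
      finally show "(?\<phi> has_field_derivative (s - 1) * (of_real y powr (- s) - z powr (- s))) (at z within closed_segment (of_real y) (of_real (y + 1)))"
        by (rule has_field_derivative_at_within)
      have "norm (of_real y powr (- s) - z powr (- s)) \<le> norm s * y powr (- Re s - 1) * (t - y)"
        unfolding t(1) by (rule powr_diff_bound[OF y t(2) s])
      also have "\<dots> \<le> norm s * y powr (- Re s - 1) * 1" using t by (intro mult_left_mono) auto
      finally show "norm ((s - 1) * (of_real y powr (- s) - z powr (- s))) \<le> B"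
        unfolding norm_mult B_def by (intro mult_left_mono) auto
    qed auto
    moreover have "norm (of_real (y + 1) - of_real y :: complex) = 1" by simp
    moreover have "?\<phi> (of_real (y + 1)) - ?\<phi> (of_real y) = h n s"
      using False by (simp add: h_def y_def algebra_simps)
    ultimately show ?thesis by (simp add: B_def y_def mult.assoc)
  qed (simp add: h_def)
  have hh: "h n holomorphic_on {s. 0 < Re s}" for n
    unfolding h_def by (cases "n = 0") (auto intro!: holomorphic_intros simp del: of_nat_Suc)
  have Wc: "continuous_on UNIV (\<lambda>s::complex. norm (s - 1) * norm s)" by (intro continuous_intros)
  have W0: "0 \<le> norm (s - 1) * norm s" for s :: complex by simp
  have H1: "summable (\<lambda>n. h n s)" if "0 < Re s" for s
    by (rule half_plane_series(1)[of h "\<lambda>s. norm (s - 1) * norm s", OF hh bd Wc W0 that])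
  have H2: "(\<lambda>s. \<Sum>n. h n s) holomorphic_on {s. 0 < Re s}"
    by (rule half_plane_series(2)[of h "\<lambda>s. norm (s - 1) * norm s", OF hh bd Wc W0])
  have H3: "\<exists>C\<ge>0. \<forall>s. 1/10 \<le> Re s \<longrightarrow> norm (\<Sum>n. h n s) \<le> C * (norm (s - 1) * norm s)"
    by (rule half_plane_series(3)[of h "\<lambda>s. norm (s - 1) * norm s", OF hh bd Wc W0])
  show "zeta_reg holomorphic_on {s. 0 < Re s}"
    using H2 unfolding zh by (intro holomorphic_intros)
  obtain C where C: "C \<ge> 0" "\<And>s. 1/10 \<le> Re s \<Longrightarrow> norm (\<Sum>n. h n s) \<le> C * (norm (s - 1) * norm s)" using H3 by blast
  have "norm (zeta_reg s) \<le> 1 + C * (norm (s - 1) * norm s)" if "1/10 \<le> Re s" for s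
    unfolding zh using norm_triangle_ineq[of 1 "\<Sum>n. h n s"] C(2)[OF that] by simp
  then show "\<exists>C\<ge>0. \<forall>s. 1/10 \<le> Re s \<longrightarrow> norm (zeta_reg s) \<le> 1 + C * (norm (s - 1) * norm s)"
    using C(1) by blast
  \<comment> \<open>At \<open>s = 1\<close> every correction term vanishes: this is the fact that
    zeta has residue 1.\<close>
  have "h n 1 = 0" for n by (simp add: h_def del: of_nat_Suc)
  then show "zeta_reg 1 = 1" by (simp add: zh)
  show "zeta_reg s = (s - 1) * dirichlet_L (\<lambda>_. 1) s" if s: "1 < Re s" for s
  proof -
    have sm: "summable (\<lambda>n. 1 / of_nat n powr s :: complex)"
      by (rule summable_norm_cancel, rule summable_dirichlet_abs) (use s in auto)
    then have "(\<lambda>n. 1 / of_nat n powr s) sums dirichlet_L (\<lambda>_. 1) s" by (simp add: dirichlet_L_def summable_sums)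
    then have S: "(\<lambda>n. 1 / of_nat (Suc n) powr s) sums dirichlet_L (\<lambda>_. 1) s"
      by (subst sums_Suc_iff) simp
    have "(\<lambda>n. of_nat (Suc n) powr (1 - s)) \<longlonglongrightarrow> 0"
    proof (rule tendsto_norm_zero_cancel)
      have "(\<lambda>n. real (Suc n) powr (1 - Re s)) \<longlonglongrightarrow> 0" using s by real_asymp
      then show "(\<lambda>n. norm (of_nat (Suc n) powr (1 - s) :: complex)) \<longlonglongrightarrow> 0" by (simp add: norm_of_nat_powr del: of_nat_Suc)
    qed
    from telescope_sums'[OF this]
    have T: "(\<lambda>n. of_nat (Suc n) powr (1 - s) - of_nat (Suc (Suc n)) powr (1 - s)) sums (1 :: complex)" by simp
    have "h (Suc n) s = (s - 1) * (1 / of_nat (Suc n) powr s) - (of_nat (Suc n) powr (1 - s) - of_nat (Suc (Suc n)) powr (1 - s))" for n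
      by (simp add: h_def powr_minus_divide del: of_nat_Suc)
    then have "(\<lambda>n. h (Suc n) s) sums ((s - 1) * dirichlet_L (\<lambda>_. 1) s - 1)"
      using sums_diff[OF sums_mult[OF S, of "s - 1"] T] by (simp only:)
    then have "(\<lambda>n. h n s) sums ((s - 1) * dirichlet_L (\<lambda>_. 1) s - 1 + h 0 s)" by (rule sums_Suc)
    then show ?thesis unfolding zh by (simp add: sums_iff h_def)
  qed
qed

text \<open>A lower bound on the line \<open>Re s = 2\<close> turns absolute polynomial growth into
  growth relative to the centre of the disc. On that disc
  \<open>norm s \<le> 2 + \<bar>t\<bar> + 19/10\<close>, whence the factor 5.\<close>

lemma tameI:
  fixes f :: "complex \<Rightarrow> complex"
  assumes hol: "f holomorphic_on {s. 0 < Re s}" and nz: "\<And>s. 1/2 < Re s \<Longrightarrow> f s \<noteq> 0"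
    and C: "\<And>s. 1/10 \<le> Re s \<Longrightarrow> norm (f s) \<le> C * (1 + norm s) ^ k"
    and \<delta>: "0 < \<delta>" "\<And>s. Re s = 2 \<Longrightarrow> \<delta> \<le> norm (f s)"
  shows "tame f"
  unfolding tame_def
proof (intro conjI allI impI exI)
  fix t :: real and s assume s: "norm (s - Complex 2 t) \<le> 19/10"
  have C0: "0 \<le> C"
  proof (rule ccontr)
    assume "\<not> 0 \<le> C"
    moreover have "0 < (1 + norm (1 :: complex)) ^ k" by simp
    ultimately have "C * (1 + norm (1 :: complex)) ^ k < 0" by (intro mult_neg_pos) auto
    then show False using order_trans[OF norm_ge_zero C[of 1]] by simp
  qed
  have "1/10 \<le> Re s" using s abs_Re_le_cmod[of "s - Complex 2 t"] by simp
  then have "norm (f s) \<le> C * (1 + norm s) ^ k" by (rule C)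
  also have "\<dots> \<le> C * (5 * (1 + \<bar>t\<bar>)) ^ k"
  proof (intro mult_left_mono power_mono C0)
    have "norm (Complex 2 t) \<le> 2 + \<bar>t\<bar>" using cmod_le[of "Complex 2 t"] by simp
    then show "1 + norm s \<le> 5 * (1 + \<bar>t\<bar>)"
      using s norm_triangle_sub[of s "Complex 2 t"] unfolding distrib_left by linarith
  qed simp
  also have "\<dots> = C * (5 ^ k * (1 + \<bar>t\<bar>) ^ k)" by (simp only: power_mult_distrib)
  also have "\<dots> = C * 5 ^ k / \<delta> * (1 + \<bar>t\<bar>) ^ k * \<delta>" using \<delta> by simp
  also have "\<dots> \<le> C * 5 ^ k / \<delta> * (1 + \<bar>t\<bar>) ^ k * norm (f (Complex 2 t))"
    using \<delta> C0 by (intro mult_left_mono) auto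
  finally show "norm (f s) \<le> C * 5 ^ k / \<delta> * (1 + \<bar>t\<bar>) ^ k * norm (f (Complex 2 t))" .
qed (use hol nz in auto)

text \<open>The logarithmic derivative \<open>1 / (s - 1/2)\<close> represents a bare pole, so that
  a pole can be added or removed using only logarithmic derivatives of tame functions.\<close>

lemma tame_linear: "tame (\<lambda>s. s - 1/2)"
proof (rule tameI[where C = 1 and k = 1 and \<delta> = 1])
  show "norm (s - 1/2) \<le> 1 * (1 + norm s) ^ 1" for s :: complex
    using norm_triangle_ineq4[of s "1/2"] by simp
  show "1 \<le> norm (s - 1/2)" if "Re s = 2" for s using that abs_Re_le_cmod[of "s - 1/2"] by simp
  show "s - 1/2 \<noteq> 0" if "1/2 < Re s" for s :: complex
  proof
    assume "s - 1/2 = 0"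
    from arg_cong[OF this, of Re] show False using that by simp
  qed
qed (auto intro!: holomorphic_intros)

text \<open>Factor \<open>f s = g s * (s - 1/2) ^ n\<close> with \<open>g\<close> nonvanishing near
  1/2. Then \<open>f' / f\<close> differs from \<open>n / w\<close> by \<open>g' / g\<close>, which
  is continuous on a compact disc.\<close>

lemma tame_near_half:
  assumes "tame f"
  shows "\<exists>\<eta> B. 0 < \<eta> \<and> \<eta> \<le> 1/2 \<and> (\<forall>w. 0 < Re w \<longrightarrow> norm w \<le> \<eta> \<longrightarrow>
     norm (deriv f (1/2 + w) / f (1/2 + w) - of_int (zorder f (1/2)) / w) \<le> B)"
    and "zorder f (1/2) \<ge> 0" and "f (1/2) \<noteq> 0 \<Longrightarrow> zorder f (1/2) = 0"
proof -
  let ?S = "{s. 0 < Re s}" and ?g = "zor_poly f (1/2)" and ?n = "zorder f (1/2)"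
  have hol: "f holomorphic_on ?S" using assms by (simp add: tame_def)
  have nz: "f s \<noteq> 0" if "1/2 < Re s" for s using assms that by (simp add: tame_def)
  have "(if f (1/2) = 0 then ?n > 0 else ?n = 0) \<and> (\<exists>r. r>0 \<and> cball (1/2) r \<subseteq> ?S \<and> ?g holomorphic_on cball (1/2) r
    \<and> (\<forall>w\<in>cball (1/2) r. f w = ?g w * (w - 1/2) ^ nat ?n \<and> ?g w \<noteq> 0))"
  proof (rule zorder_exist_zero[OF hol])
    show "open ?S" by (rule open_halfspace_Re_gt)
    show "connected ?S" by (intro convex_connected convex_halfspace_Re_gt)
    show "\<exists>w\<in>?S. f w \<noteq> 0" using nz[of 1] by (intro bexI[of _ 1]) auto
  qed auto
  then obtain r where n: "if f (1/2) = 0 then ?n > 0 else ?n = 0" and r: "r > 0" "cball (1/2) r \<subseteq> ?S" "?g holomorphic_on cball (1/2) r"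
    "\<And>w. w \<in> cball (1/2) r \<Longrightarrow> f w = ?g w * (w - 1/2) ^ nat ?n" "\<And>w. w \<in> cball (1/2) r \<Longrightarrow> ?g w \<noteq> 0" by blast
  show n0: "?n \<ge> 0" and "f (1/2) \<noteq> 0 \<Longrightarrow> ?n = 0" using n by (auto split: if_splits)
  have gb: "?g holomorphic_on ball (1/2) r" using r(3) by (rule holomorphic_on_subset) auto
  define \<eta> where "\<eta> = min (r / 2) (1/2)"
  have \<eta>: "0 < \<eta>" "\<eta> \<le> 1/2" "\<eta> < r" using r(1) by (auto simp: \<eta>_def)
  have sub: "cball (1/2) \<eta> \<subseteq> ball (1/2) r" using \<eta> by auto
  have "(\<lambda>s. deriv ?g s / ?g s) holomorphic_on ball (1/2) r"
    by (intro holomorphic_on_divide holomorphic_deriv gb) (use r(5) in auto)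
  then have "continuous_on (cball (1/2) \<eta>) (\<lambda>s. deriv ?g s / ?g s)"
    by (rule holomorphic_on_imp_continuous_on[OF holomorphic_on_subset[OF _ sub]])
  then have "continuous_on (cball (1/2) \<eta>) (\<lambda>s. norm (deriv ?g s / ?g s))" by (rule continuous_on_norm)
  moreover have "cball (1/2 :: complex) \<eta> \<noteq> {}" using \<eta> by simp
  ultimately have "\<exists>x\<in>cball (1/2) \<eta>. \<forall>s\<in>cball (1/2) \<eta>. norm (deriv ?g s / ?g s) \<le> norm (deriv ?g x / ?g x)"
    by (intro continuous_attains_sup compact_cball)
  then obtain x where x: "\<And>s. s \<in> cball (1/2) \<eta> \<Longrightarrow> norm (deriv ?g s / ?g s) \<le> norm (deriv ?g x / ?g x)" by blast
  have "norm (deriv f (1/2 + w) / f (1/2 + w) - of_int ?n / w) \<le> norm (deriv ?g x / ?g x)"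
    if w: "0 < Re w" "norm w \<le> \<eta>" for w
  proof -
    define s where "s = 1/2 + w"
    have s: "s \<in> cball (1/2) \<eta>" using w by (simp add: s_def dist_norm)
    have w0: "w \<noteq> 0" using w by auto
    have sb: "s \<in> ball (1/2) r" using s sub by blast
    have gd: "(?g has_field_derivative deriv ?g s) (at s)"
      by (rule holomorphic_derivI[OF gb _ sb]) simp
    let ?k = "nat ?n"
    have "((\<lambda>w. ?g w * (w - 1/2) ^ ?k) has_field_derivative (deriv ?g s * (s - 1/2) ^ ?k + ?g s * (of_nat ?k * (s - 1/2) ^ (?k - 1)))) (at s)"
      by (auto intro!: derivative_eq_intros gd)
    then have "(f has_field_derivative (deriv ?g s * (s - 1/2) ^ ?k + ?g s * (of_nat ?k * (s - 1/2) ^ (?k - 1)))) (at s)"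
      by (rule has_field_derivative_transform_within_open[of _ _ _ "ball (1/2) r"]) (use sb r(4) in auto)
    then have df: "deriv f s = deriv ?g s * w ^ ?k + ?g s * (of_nat ?k * w ^ (?k - 1))"
      by (simp add: DERIV_imp_deriv s_def)
    have fs: "f s = ?g s * w ^ ?k" using r(4)[of s] sb by (simp add: s_def)
    have gs: "?g s \<noteq> 0" using r(5)[of s] sb by simp
    have "deriv f s / f s = deriv ?g s / ?g s + of_nat ?k / w"
      unfolding df fs using gs w0 by (cases "?k") (simp_all add: field_simps)
    also have "(of_nat ?k :: complex) = of_int ?n" using n0 by simp
    finally have "deriv f s / f s - of_int ?n / w = deriv ?g s / ?g s" by simp
    then show ?thesis using x[OF s] by (simp add: s_def)
  qed
  then show "\<exists>\<eta> B. 0 < \<eta> \<and> \<eta> \<le> 1/2 \<and> (\<forall>w. 0 < Re w \<longrightarrow> norm w \<le> \<eta> \<longrightarrow>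
     norm (deriv f (1/2 + w) / f (1/2 + w) - of_int ?n / w) \<le> B)" using \<eta> by blast
qed

context
  fixes q :: nat
  assumes q: "q > 1" and GRH: "GRH_mod q"
begin

lemma dirichlet_L_nonprincipal:
  assumes chi: "chi \<in> nonprincipal_chars q"
  shows "dirichlet_L chi holomorphic_on {s. 0 < Re s}"
    and "\<exists>C\<ge>0. \<forall>s. 1/10 \<le> Re s \<longrightarrow> norm (dirichlet_L chi s) \<le> C * norm s"
    and "\<And>s. 1/2 < Re s \<Longrightarrow> dirichlet_L chi s \<noteq> 0"
proof -
  have c: "dirichlet_char q chi" "chi \<noteq> principal_char q" using chi by (auto simp: nonprincipal_chars_def)
  obtain B where B: "\<And>N. norm (\<Sum>n=1..N. chi n) \<le> B"
    using periodic_sums_bounded[of q chi] sum_nonprincipal_char[OF c] q c(1) unfolding dirichlet_char_def by auto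
  show "dirichlet_L chi holomorphic_on {s. 0 < Re s}" by (rule dirichlet_L_bounded_sums(2)[OF B])
  show "\<exists>C\<ge>0. \<forall>s. 1/10 \<le> Re s \<longrightarrow> norm (dirichlet_L chi s) \<le> C * norm s" by (rule dirichlet_L_bounded_sums(3)[OF B])
  show "dirichlet_L chi s \<noteq> 0" if "1/2 < Re s" for s using GRH chi that unfolding GRH_mod_def by blast
qed

lemma tame_dirichlet_L:
  assumes chi: "chi \<in> nonprincipal_chars q"
  shows "tame (dirichlet_L chi)"
proof -
  have c: "dirichlet_char q chi" using chi by (auto simp: nonprincipal_chars_def)
  note L = dirichlet_L_nonprincipal[OF chi]
  obtain C where C: "C \<ge> 0" "\<And>s. 1/10 \<le> Re s \<Longrightarrow> norm (dirichlet_L chi s) \<le> C * norm s" using L(2) by blast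
  show ?thesis
  proof (rule tameI[OF L(1,3), of C 1 "1/4"])
    fix s :: complex assume "1/10 \<le> Re s"
    from C(2)[OF this] show "norm (dirichlet_L chi s) \<le> C * (1 + norm s) ^ 1"
      using C(1) mult_left_mono[of "norm s" "1 + norm s" C] by simp
  qed (use norm_dirichlet_L_ge[OF q c] in auto)
qed

text \<open>Subtracting from the principal character its mean \<open>totient q / q\<close> leaves a
  periodic sequence with sum 0 over a period, whose series continues thanks to bounded partial sums;
  the mean contributes a multiple of \<open>zeta_reg\<close>. At 1 only the latter survives, and the
  value is the mean itself.\<close>

lemma principal_L_continuation:
  obtains f where "f holomorphic_on {s. 0 < Re s}"
    "\<exists>C\<ge>0. \<forall>s. 1/10 \<le> Re s \<longrightarrow> norm (f s) \<le> C * (1 + norm s) ^ 2"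
    "\<And>s. 1 < Re s \<Longrightarrow> f s = (s - 1) * dirichlet_L (principal_char q) s" "f 1 \<noteq> 0"
proof -
  define \<kappa> where "\<kappa> = (of_nat (totient q) / of_nat q :: complex)"
  define d where "d = (\<lambda>n. principal_char q n - \<kappa>)"
  have "d (n + q) = d n" for n using dirichlet_char_principal[of q] by (simp add: d_def dirichlet_char_def)
  moreover have "(\<Sum>n<q. d n) = 0"
    using sum_principal_char[OF q] q by (simp add: d_def sum_subtractf \<kappa>_def)
  ultimately obtain B where B: "\<And>N. norm (\<Sum>n=1..N. d n) \<le> B"
    using periodic_sums_bounded[of q d] q by auto
  note D = dirichlet_L_bounded_sums[OF B]
  obtain C1 where C1: "C1 \<ge> 0" "\<And>s. 1/10 \<le> Re s \<Longrightarrow> norm (dirichlet_L d s) \<le> C1 * norm s" using D(3) by blast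
  obtain C2 where C2: "C2 \<ge> 0" "\<And>s. 1/10 \<le> Re s \<Longrightarrow> norm (zeta_reg s) \<le> 1 + C2 * (norm (s - 1) * norm s)" using zeta_reg_bound by blast
  define f where "f = (\<lambda>s. (s - 1) * dirichlet_L d s + \<kappa> * zeta_reg s)"
  show ?thesis
  proof
    show "f holomorphic_on {s. 0 < Re s}" unfolding f_def by (intro holomorphic_intros D(2) zeta_reg_holomorphic)
    show "\<exists>C\<ge>0. \<forall>s. 1/10 \<le> Re s \<longrightarrow> norm (f s) \<le> C * (1 + norm s) ^ 2"
    proof (intro exI[of _ "C1 + norm \<kappa> * (1 + C2)"] conjI allI impI)
      fix s :: complex assume s: "1/10 \<le> Re s"
      have n1: "norm (s - 1) \<le> 1 + norm s" using norm_triangle_ineq4[of s 1] by simp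
      have p: "norm (s - 1) * norm s \<le> (1 + norm s)\<^sup>2"
        unfolding power2_eq_square using n1 by (intro mult_mono) auto
      have "norm ((s - 1) * dirichlet_L d s) \<le> (1 + norm s) * (C1 * (1 + norm s))"
        unfolding norm_mult using n1 C1(2)[OF s] C1(1) mult_left_mono[of "norm s" "1 + norm s" C1] by (intro mult_mono) auto
      moreover have "norm (\<kappa> * zeta_reg s) \<le> norm \<kappa> * ((1 + C2) * (1 + norm s)\<^sup>2)"
      proof -
        have "1 \<le> (1 + norm s)\<^sup>2" by (rule one_le_power) simp
        moreover have "C2 * (norm (s - 1) * norm s) \<le> C2 * (1 + norm s)\<^sup>2" using p C2(1) by (rule mult_left_mono)
        ultimately have "norm (zeta_reg s) \<le> (1 + C2) * (1 + norm s)\<^sup>2" using C2(2)[OF s] unfolding distrib_right by linarith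
        then show ?thesis unfolding norm_mult by (intro mult_left_mono) auto
      qed
      ultimately have "norm (f s) \<le> (1 + norm s) * (C1 * (1 + norm s)) + norm \<kappa> * ((1 + C2) * (1 + norm s)\<^sup>2)"
        unfolding f_def by (rule norm_triangle_mono)
      also have "\<dots> = (C1 + norm \<kappa> * (1 + C2)) * (1 + norm s)\<^sup>2" by (simp add: power2_eq_square algebra_simps)
      finally show "norm (f s) \<le> (C1 + norm \<kappa> * (1 + C2)) * (1 + norm s)\<^sup>2" .
    qed (use C1 C2 in auto)
    show "f 1 \<noteq> 0" using q by (simp add: f_def zeta_reg_1 \<kappa>_def)
    fix s :: complex assume s: "1 < Re s"
    have S1: "(\<lambda>n. d n / of_nat n powr s) sums dirichlet_L d s" using D(1)[of s] s by simp
    have sm: "summable (\<lambda>n. 1 / of_nat n powr s :: complex)"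
      by (rule summable_norm_cancel, rule summable_dirichlet_abs) (use s in auto)
    have S2: "(\<lambda>n. 1 / of_nat n powr s) sums dirichlet_L (\<lambda>_. 1) s" using sm by (simp add: dirichlet_L_def summable_sums)
    have "(\<lambda>n. d n / of_nat n powr s + \<kappa> * (1 / of_nat n powr s)) sums (dirichlet_L d s + \<kappa> * dirichlet_L (\<lambda>_. 1) s)"
      by (intro sums_add sums_mult S1 S2)
    moreover have "d n / of_nat n powr s + \<kappa> * (1 / of_nat n powr s) = principal_char q n / of_nat n powr s" for n
      by (simp add: d_def diff_divide_distrib)
    ultimately have "dirichlet_L (principal_char q) s = dirichlet_L d s + \<kappa> * dirichlet_L (\<lambda>_. 1) s"
      unfolding dirichlet_L_def[of "principal_char q"] by (simp add: sums_iff)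
    then show "f s = (s - 1) * dirichlet_L (principal_char q) s"
      using s by (simp add: f_def zeta_reg_eq algebra_simps)
  qed
qed

text \<open>The witness is \<open>L(2 s, psi)\<close>, multiplied by \<open>2 s - 1\<close> when
  \<open>psi\<close> is principal to remove the pole. It has no zeros for \<open>Re s > 1/2\<close>
  because \<open>2 s\<close> then lies in the half-plane of absolute convergence. At 1/2 its value
  is \<open>L(1, psi)\<close>, nonzero by GRH, or in the principal case the nonzero residue.\<close>

lemma tame_square:
  assumes psi: "dirichlet_char q psi"
  obtains f where "tame f" "f (1/2) \<noteq> 0"
    "\<And>s. 1/2 < Re s \<Longrightarrow> deriv f s / f s = - 2 * dirichlet_L (mangoldt_char psi) (2 * s) +
        (if psi = principal_char q then 1 / (s - 1/2) else 0)"
proof -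
  define \<delta> where "\<delta> = (if psi = principal_char q then 1 else 0 :: complex)"
  have "\<exists>F C. F holomorphic_on {s. 0 < Re s} \<and> (\<forall>s. 1/10 \<le> Re s \<longrightarrow> norm (F s) \<le> C * (1 + norm s) ^ 2) \<and> C \<ge> 0 \<and> F 1 \<noteq> 0 \<and>
     (\<forall>s. 1 < Re s \<longrightarrow> F s = (if psi = principal_char q then s - 1 else 1) * dirichlet_L psi s)"
  proof (cases "psi = principal_char q")
    case True
    then show ?thesis by (rule_tac principal_L_continuation) auto
  next
    case False
    then have np: "psi \<in> nonprincipal_chars q" using psi by (simp add: nonprincipal_chars_def)
    note L = dirichlet_L_nonprincipal[OF np]
    obtain C where C: "C \<ge> 0" "\<And>s. 1/10 \<le> Re s \<Longrightarrow> norm (dirichlet_L psi s) \<le> C * norm s" using L(2) by blast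
    have "norm (dirichlet_L psi s) \<le> C * (1 + norm s)\<^sup>2" if "1/10 \<le> Re s" for s
    proof -
      have "norm s \<le> (1 + norm s)\<^sup>2" by (simp add: power2_eq_square algebra_simps)
      then show ?thesis using C(2)[OF that] mult_left_mono[OF _ C(1), of "norm s" "(1 + norm s)\<^sup>2"] by linarith
    qed
    then show ?thesis using L(1) L(3)[of 1] C(1) False by (intro exI[of _ "dirichlet_L psi"] exI[of _ C]) auto
  qed
  then obtain F C where F: "F holomorphic_on {s. 0 < Re s}" "\<And>s. 1/10 \<le> Re s \<Longrightarrow> norm (F s) \<le> C * (1 + norm s) ^ 2" "C \<ge> 0" "F 1 \<noteq> 0"
    "\<And>s. 1 < Re s \<Longrightarrow> F s = (if psi = principal_char q then s - 1 else 1) * dirichlet_L psi s" by blast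
  define f where "f = (\<lambda>s. F (2 * s))"
  have nzF: "F s \<noteq> 0" if s: "1 < Re s" for s
    using F(5)[OF s] dirichlet_L_nonzero[OF q psi s] s by auto
  have "tame f"
  proof (rule tameI[of _ "4 * C" 2 "1/4"])
    show "f holomorphic_on {s. 0 < Re s}" unfolding f_def
      by (rule holomorphic_on_compose_gen[unfolded o_def, OF _ F(1)]) (auto intro!: holomorphic_intros)
    show "f s \<noteq> 0" if "1/2 < Re s" for s using nzF[of "2 * s"] that by (simp add: f_def)
    show "norm (f s) \<le> 4 * C * (1 + norm s)\<^sup>2" if "1/10 \<le> Re s" for s
    proof -
      have "norm (f s) \<le> C * (1 + norm (2 * s))\<^sup>2" unfolding f_def using that by (intro F(2)) simp
      also have "\<dots> \<le> C * (2 * (1 + norm s))\<^sup>2" by (intro mult_left_mono power_mono F(3)) (auto simp: norm_mult)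
      also have "\<dots> = 4 * C * (1 + norm s)\<^sup>2" by (simp add: power2_eq_square algebra_simps)
      finally show ?thesis .
    qed
    show "1/4 \<le> norm (f s)" if "Re s = 2" for s
    proof -
      have "1/4 \<le> norm (dirichlet_L psi (2 * s))" using norm_dirichlet_L_ge[OF q psi, of "2 * s"] that by simp
      moreover have "1 \<le> norm (if psi = principal_char q then 2 * s - 1 else 1)"
        using abs_Re_le_cmod[of "2 * s - 1"] that by auto
      ultimately have "1 * (1/4) \<le> norm (if psi = principal_char q then 2 * s - 1 else 1) * norm (dirichlet_L psi (2 * s))"
        by (intro mult_mono) auto
      then show ?thesis unfolding f_def using F(5)[of "2 * s"] that by (simp add: norm_mult)
    qed
  qed auto
  moreover have "f (1/2) \<noteq> 0" using F(4) by (simp add: f_def)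
  moreover have "deriv f s / f s = - 2 * dirichlet_L (mangoldt_char psi) (2 * s) + (if psi = principal_char q then 1 / (s - 1/2) else 0)"
    if s: "1/2 < Re s" for s
  proof -
    have s2: "1 < Re (2 * s)" using s by simp
    let ?L = "dirichlet_L psi"
    define c where "c = (\<lambda>s :: complex. if psi = principal_char q then s - 1 else 1)"
    have dL: "(?L has_field_derivative deriv ?L (2 * s)) (at (2 * s))"
      using has_field_derivative_dirichlet_L[OF norm_chi_le_ln[OF q psi] s2] by (simp add: DERIV_imp_deriv)
    have dc: "(c has_field_derivative \<delta>) (at (2 * s))"
      unfolding c_def \<delta>_def by (auto intro!: derivative_eq_intros)
    have "((\<lambda>s. c s * ?L s) has_field_derivative (\<delta> * ?L (2 * s) + deriv ?L (2 * s) * c (2 * s))) (at (2 * s))"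
      by (rule DERIV_mult[OF dc dL])
    then have "(F has_field_derivative (\<delta> * ?L (2 * s) + deriv ?L (2 * s) * c (2 * s))) (at (2 * s))"
      by (rule has_field_derivative_transform_within_open[of _ _ _ "{s. 1 < Re s}"])
         (use s2 F(5) in \<open>auto simp: c_def open_halfspace_Re_gt\<close>)
    moreover have "((\<lambda>s::complex. 2 * s) has_field_derivative 2) (at s)" by (auto intro!: derivative_eq_intros)
    ultimately have "((\<lambda>s. F (2 * s)) has_field_derivative (\<delta> * ?L (2 * s) + deriv ?L (2 * s) * c (2 * s)) * 2) (at s)"
      by (rule DERIV_chain2)
    then have df: "deriv f s = (\<delta> * ?L (2 * s) + deriv ?L (2 * s) * c (2 * s)) * 2"
      unfolding f_def by (rule DERIV_imp_deriv)
    have fs: "f s = c (2 * s) * ?L (2 * s)" using F(5)[OF s2] by (simp add: f_def c_def)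
    have L0: "?L (2 * s) \<noteq> 0" by (rule dirichlet_L_nonzero[OF q psi s2])
    have "2 * s \<noteq> 1" using s2 by (metis less_irrefl one_complex.sel(1))
    then have c0: "c (2 * s) \<noteq> 0" by (simp add: c_def)
    have "deriv f s / f s = 2 * (deriv ?L (2 * s) / ?L (2 * s)) + 2 * \<delta> / c (2 * s)"
      unfolding df fs using L0 c0 by (simp add: field_simps)
    also have "deriv ?L (2 * s) / ?L (2 * s) = - dirichlet_L (mangoldt_char psi) (2 * s)"
      using dirichlet_L_neg_log_deriv[OF q psi s2] by (simp add: minus_equation_iff)
    also have "2 * \<delta> / c (2 * s) = (if psi = principal_char q then 1 / (s - 1/2) else 0)"
    proof -
      have "2 * s - 1 = 2 * (s - 1/2)" by simp
      then show ?thesis by (simp add: \<delta>_def c_def del: right_diff_distrib_numeral)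
    qed
    finally show ?thesis by simp
  qed
  ultimately show ?thesis by (rule that)
qed

section \<open>Generating functions with at most a simple pole at the centre\<close>

text \<open>Collects what the Perron argument asks of the generating function, in a form stable
  under linear combinations. The number \<open>- \<mu>\<close> plays the role of the residue at 0,
  so the resulting sums behave like \<open>- \<mu> * L\<close>.\<close>

definition log_singular :: "(complex \<Rightarrow> complex) \<Rightarrow> complex \<Rightarrow> bool" where
  "log_singular G \<mu> \<longleftrightarrow> G holomorphic_on {w. 0 < Re w} \<and>
    (\<exists>C\<ge>0. (\<forall>t0 c w. 0 < c \<longrightarrow> c \<le> 1 \<longrightarrow> c \<le> Re w \<longrightarrow> Re w \<le> 1 \<longrightarrow> \<bar>Im w - t0\<bar> \<le> 1/2 \<longrightarrow>
       norm (G w) \<le> C * (1 + ln (1 + \<bar>t0\<bar>)) / c) \<and>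
     (\<forall>t0 c. 0 < c \<longrightarrow> c \<le> 1 \<longrightarrow> integral {t0 - 1/2..t0 + 1/2} (\<lambda>t. norm (G (Complex c t)))
       \<le> C * (1 + ln (1 + \<bar>t0\<bar>)) * (1 + ln (1/c)))) \<and>
    (\<exists>\<eta> B. 0 < \<eta> \<and> \<eta> \<le> 1/2 \<and> (\<forall>w. 0 < Re w \<longrightarrow> norm w \<le> \<eta> \<longrightarrow> norm (G w + \<mu> / w) \<le> B))"

lemma integrable_vertical:
  assumes "G holomorphic_on {w. 0 < Re w}" "0 < c"
  shows "(\<lambda>t. norm (G (Complex c t))) integrable_on {a..b}"
  by (intro integrable_continuous_interval continuous_on_norm
      continuous_on_compose2[OF holomorphic_on_imp_continuous_on[OF assms(1)]])
     (use assms(2) in \<open>auto intro!: continuous_intros simp: Complex_eq\<close>)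

lemma log_singular_tame:
  assumes "tame f"
  shows "log_singular (\<lambda>w. deriv f (1/2 + w) / f (1/2 + w)) (- of_int (zorder f (1/2)))"
  unfolding log_singular_def
proof (intro conjI)
  show "(\<lambda>w. deriv f (1/2 + w) / f (1/2 + w)) holomorphic_on {w. 0 < Re w}"
    by (rule holomorphic_on_compose_gen[unfolded o_def, OF _ tame_log_deriv_holomorphic[OF assms]])
       (auto intro!: holomorphic_intros)
  obtain C where C: "C > 0"
    "\<And>t0 c s. 0 < c \<Longrightarrow> c \<le> 1 \<Longrightarrow> 1/2 + c \<le> Re s \<Longrightarrow> Re s \<le> 3/2 \<Longrightarrow> \<bar>Im s - t0\<bar> \<le> 1/2 \<Longrightarrow>
       norm (deriv f s / f s) \<le> C * (1 + ln (1 + \<bar>t0\<bar>)) / c"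
    "\<And>t0 c. 0 < c \<Longrightarrow> c \<le> 1 \<Longrightarrow> integral {t0 - 1/2..t0 + 1/2} (\<lambda>t. norm (deriv f (Complex (1/2 + c) t) / f (Complex (1/2 + c) t)))
       \<le> C * (1 + ln (1 + \<bar>t0\<bar>)) * (1 + ln (1/c))"
    by (rule tame_log_deriv_bounds[OF assms], rule that)
  have e: "1/2 + Complex c t = Complex (1/2 + c) t" for c t by (simp add: complex_eq_iff)
  show "\<exists>C\<ge>0. (\<forall>t0 c w. 0 < c \<longrightarrow> c \<le> 1 \<longrightarrow> c \<le> Re w \<longrightarrow> Re w \<le> 1 \<longrightarrow> \<bar>Im w - t0\<bar> \<le> 1/2 \<longrightarrow>
       norm (deriv f (1/2 + w) / f (1/2 + w)) \<le> C * (1 + ln (1 + \<bar>t0\<bar>)) / c) \<and>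
     (\<forall>t0 c. 0 < c \<longrightarrow> c \<le> 1 \<longrightarrow> integral {t0 - 1/2..t0 + 1/2} (\<lambda>t. norm (deriv f (1/2 + Complex c t) / f (1/2 + Complex c t)))
       \<le> C * (1 + ln (1 + \<bar>t0\<bar>)) * (1 + ln (1/c)))"
  proof (intro exI[of _ C] conjI allI impI)
    show "norm (deriv f (1/2 + w) / f (1/2 + w)) \<le> C * (1 + ln (1 + \<bar>t0\<bar>)) / c"
      if "0 < c" "c \<le> 1" "c \<le> Re w" "Re w \<le> 1" "\<bar>Im w - t0\<bar> \<le> 1/2" for t0 c w
      by (rule C(2)) (use that in auto)
    show "integral {t0 - 1/2..t0 + 1/2} (\<lambda>t. norm (deriv f (1/2 + Complex c t) / f (1/2 + Complex c t)))
       \<le> C * (1 + ln (1 + \<bar>t0\<bar>)) * (1 + ln (1/c))" if "0 < c" "c \<le> 1" for t0 c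
      unfolding e by (rule C(3)) (use that in auto)
  qed (use C in auto)
  show "\<exists>\<eta> B. 0 < \<eta> \<and> \<eta> \<le> 1/2 \<and> (\<forall>w. 0 < Re w \<longrightarrow> norm w \<le> \<eta> \<longrightarrow>
     norm (deriv f (1/2 + w) / f (1/2 + w) + - of_int (zorder f (1/2)) / w) \<le> B)"
    using tame_near_half(1)[OF assms] by simp
qed

lemma log_singular_scale:
  assumes "log_singular G \<mu>"
  shows "log_singular (\<lambda>w. \<alpha> * G w) (\<alpha> * \<mu>)"
proof -
  obtain C where hol: "G holomorphic_on {w. 0 < Re w}" and C: "C \<ge> 0"
    "\<And>t0 c w. 0 < c \<Longrightarrow> c \<le> 1 \<Longrightarrow> c \<le> Re w \<Longrightarrow> Re w \<le> 1 \<Longrightarrow> \<bar>Im w - t0\<bar> \<le> 1/2 \<Longrightarrow>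
       norm (G w) \<le> C * (1 + ln (1 + \<bar>t0\<bar>)) / c"
    "\<And>t0 c. 0 < c \<Longrightarrow> c \<le> 1 \<Longrightarrow> integral {t0 - 1/2..t0 + 1/2} (\<lambda>t. norm (G (Complex c t)))
       \<le> C * (1 + ln (1 + \<bar>t0\<bar>)) * (1 + ln (1/c))"
    using assms unfolding log_singular_def by blast
  obtain \<eta> B where \<eta>: "0 < \<eta>" "\<eta> \<le> 1/2" "\<And>w. 0 < Re w \<Longrightarrow> norm w \<le> \<eta> \<Longrightarrow> norm (G w + \<mu> / w) \<le> B"
    using assms unfolding log_singular_def by blast
  show ?thesis unfolding log_singular_def
  proof (intro conjI, goal_cases)
    case 1
    show ?case by (intro holomorphic_intros hol)
  next
    case 2
    show ?case
    proof (intro exI[of _ "norm \<alpha> * C"] conjI allI impI)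
      show "norm (\<alpha> * G w) \<le> norm \<alpha> * C * (1 + ln (1 + \<bar>t0\<bar>)) / c"
        if "0 < c" "c \<le> 1" "c \<le> Re w" "Re w \<le> 1" "\<bar>Im w - t0\<bar> \<le> 1/2" for t0 c w
        using mult_left_mono[OF C(2)[OF that], of "norm \<alpha>"] by (simp add: norm_mult mult.assoc)
      show "integral {t0 - 1/2..t0 + 1/2} (\<lambda>t. norm (\<alpha> * G (Complex c t))) \<le> norm \<alpha> * C * (1 + ln (1 + \<bar>t0\<bar>)) * (1 + ln (1/c))"
        if "0 < c" "c \<le> 1" for t0 c
        unfolding norm_mult integral_mult_right mult.assoc[of "norm \<alpha>"]
        using mult_left_mono[OF C(3)[OF that], of "norm \<alpha>"] by (simp add: mult.assoc)
    qed (use C in auto)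
  next
    case 3
    show ?case
    proof (rule exI[of _ \<eta>], rule exI[of _ "norm \<alpha> * B"], intro conjI allI impI)
      show "norm (\<alpha> * G w + \<alpha> * \<mu> / w) \<le> norm \<alpha> * B" if "0 < Re w" "norm w \<le> \<eta>" for w
      proof -
        have "\<alpha> * G w + \<alpha> * \<mu> / w = \<alpha> * (G w + \<mu> / w)" by (simp add: algebra_simps)
        then show ?thesis using mult_left_mono[OF \<eta>(3)[OF that], of "norm \<alpha>"] by (simp add: norm_mult)
      qed
    qed (use \<eta> in auto)
  qed
qed

lemma log_singular_add:
  assumes "log_singular G \<mu>" "log_singular H \<nu>"
  shows "log_singular (\<lambda>w. G w + H w) (\<mu> + \<nu>)"
proof -
  obtain C where hol: "G holomorphic_on {w. 0 < Re w}" and C: "C \<ge> 0"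
    "\<And>t0 c w. 0 < c \<Longrightarrow> c \<le> 1 \<Longrightarrow> c \<le> Re w \<Longrightarrow> Re w \<le> 1 \<Longrightarrow> \<bar>Im w - t0\<bar> \<le> 1/2 \<Longrightarrow>
       norm (G w) \<le> C * (1 + ln (1 + \<bar>t0\<bar>)) / c"
    "\<And>t0 c. 0 < c \<Longrightarrow> c \<le> 1 \<Longrightarrow> integral {t0 - 1/2..t0 + 1/2} (\<lambda>t. norm (G (Complex c t)))
       \<le> C * (1 + ln (1 + \<bar>t0\<bar>)) * (1 + ln (1/c))"
    using assms(1) unfolding log_singular_def by blast
  obtain \<eta> B where \<eta>: "0 < \<eta>" "\<eta> \<le> 1/2" "\<And>w. 0 < Re w \<Longrightarrow> norm w \<le> \<eta> \<Longrightarrow> norm (G w + \<mu> / w) \<le> B"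
    using assms(1) unfolding log_singular_def by blast
  obtain C' where hol': "H holomorphic_on {w. 0 < Re w}" and C': "C' \<ge> 0"
    "\<And>t0 c w. 0 < c \<Longrightarrow> c \<le> 1 \<Longrightarrow> c \<le> Re w \<Longrightarrow> Re w \<le> 1 \<Longrightarrow> \<bar>Im w - t0\<bar> \<le> 1/2 \<Longrightarrow>
       norm (H w) \<le> C' * (1 + ln (1 + \<bar>t0\<bar>)) / c"
    "\<And>t0 c. 0 < c \<Longrightarrow> c \<le> 1 \<Longrightarrow> integral {t0 - 1/2..t0 + 1/2} (\<lambda>t. norm (H (Complex c t)))
       \<le> C' * (1 + ln (1 + \<bar>t0\<bar>)) * (1 + ln (1/c))"
    using assms(2) unfolding log_singular_def by blast
  obtain \<eta>' B' where \<eta>': "0 < \<eta>'" "\<eta>' \<le> 1/2" "\<And>w. 0 < Re w \<Longrightarrow> norm w \<le> \<eta>' \<Longrightarrow> norm (H w + \<nu> / w) \<le> B'"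
    using assms(2) unfolding log_singular_def by blast
  show ?thesis unfolding log_singular_def
  proof (intro conjI, goal_cases)
    case 1
    show ?case by (intro holomorphic_intros hol hol')
  next
    case 2
    show ?case
    proof (intro exI[of _ "C + C'"] conjI allI impI)
    show "norm (G w + H w) \<le> (C + C') * (1 + ln (1 + \<bar>t0\<bar>)) / c"
      if "0 < c" "c \<le> 1" "c \<le> Re w" "Re w \<le> 1" "\<bar>Im w - t0\<bar> \<le> 1/2" for t0 c w
      using norm_triangle_mono[OF C(2)[OF that] C'(2)[OF that]] by (simp only: distrib_right add_divide_distrib)
    show "integral {t0 - 1/2..t0 + 1/2} (\<lambda>t. norm (G (Complex c t) + H (Complex c t))) \<le> (C + C') * (1 + ln (1 + \<bar>t0\<bar>)) * (1 + ln (1/c))"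
      if c: "0 < c" "c \<le> 1" for t0 c
    proof -
      note i = integrable_vertical[OF hol c(1)] integrable_vertical[OF hol' c(1)]
      have "(\<lambda>w. G w + H w) holomorphic_on {w. 0 < Re w}" by (intro holomorphic_intros hol hol')
      from integrable_vertical[OF this c(1)]
      have "integral {t0 - 1/2..t0 + 1/2} (\<lambda>t. norm (G (Complex c t) + H (Complex c t))) \<le>
         integral {t0 - 1/2..t0 + 1/2} (\<lambda>t. norm (G (Complex c t)) + norm (H (Complex c t)))"
        by (intro integral_le integrable_add i norm_triangle_ineq)
      also have "\<dots> = integral {t0 - 1/2..t0 + 1/2} (\<lambda>t. norm (G (Complex c t))) + integral {t0 - 1/2..t0 + 1/2} (\<lambda>t. norm (H (Complex c t)))"
        by (rule integral_add[OF i])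
      also have "\<dots> \<le> C * (1 + ln (1 + \<bar>t0\<bar>)) * (1 + ln (1/c)) + C' * (1 + ln (1 + \<bar>t0\<bar>)) * (1 + ln (1/c))"
        by (intro add_mono C(3) C'(3) c)
      finally show ?thesis by (simp only: distrib_right)
    qed
    qed (use C C' in auto)
  next
    case 3
    show ?case
    proof (rule exI[of _ "min \<eta> \<eta>'"], rule exI[of _ "B + B'"], intro conjI allI impI)
    show "norm (G w + H w + (\<mu> + \<nu>) / w) \<le> B + B'" if "0 < Re w" "norm w \<le> min \<eta> \<eta>'" for w
    proof -
      have eq: "G w + H w + (\<mu> + \<nu>) / w = (G w + \<mu> / w) + (H w + \<nu> / w)" by (simp add: add_divide_distrib)
      show ?thesis unfolding eq by (intro norm_triangle_mono \<eta>(3) \<eta>'(3)) (use that in auto)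
    qed
    qed (use \<eta> \<eta>' in auto)
  qed
qed

lemma log_singular_perron:
  fixes A :: "real \<Rightarrow> complex"
  assumes "log_singular G \<mu>"
    and "\<And>L. 0 < L \<Longrightarrow> ((\<lambda>T. contour_integral (linepath (Complex 1 (-T)) (Complex 1 T))
         (\<lambda>w. G w * exp (of_real L * w) / (w * (w + 1)))) \<longlongrightarrow> 2 * pi * \<i> * A L) at_top"
  shows "\<exists>D. \<forall>L\<ge>1. norm (A L + \<mu> * of_real L) \<le> D * (1 + ln L)"
proof -
  obtain C where hol: "G holomorphic_on {w. 0 < Re w}" and C: "C \<ge> 0"
    "\<And>t0 c w. 0 < c \<Longrightarrow> c \<le> 1 \<Longrightarrow> c \<le> Re w \<Longrightarrow> Re w \<le> 1 \<Longrightarrow> \<bar>Im w - t0\<bar> \<le> 1/2 \<Longrightarrow>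
       norm (G w) \<le> C * (1 + ln (1 + \<bar>t0\<bar>)) / c"
    "\<And>t0 c. 0 < c \<Longrightarrow> c \<le> 1 \<Longrightarrow> integral {t0 - 1/2..t0 + 1/2} (\<lambda>t. norm (G (Complex c t)))
       \<le> C * (1 + ln (1 + \<bar>t0\<bar>)) * (1 + ln (1/c))"
    using assms(1) unfolding log_singular_def by blast
  obtain \<eta> B where \<eta>: "0 < \<eta>" "\<eta> \<le> 1/2" "\<And>w. 0 < Re w \<Longrightarrow> norm w \<le> \<eta> \<Longrightarrow> norm (G w + \<mu> / w) \<le> B"
    using assms(1) unfolding log_singular_def by blast
  show ?thesis by (rule perron_asymptotics[OF hol C(2,3,1) \<eta> assms(2)])
qed

text \<open>The generating function is \<open>- L'/L (1/2 + w, chi)\<close> minus the von Mangoldt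
  series of \<open>psi\<close> at \<open>1 + 2 w\<close>; the frequencies \<open>ln n\<close> and
  \<open>2 * ln n\<close> correspond to the arguments \<open>w\<close> and \<open>2 w\<close>. The
  weights with \<open>max 0\<close> are the values of the Perron kernel.\<close>

lemma prime_power_sum_asymptotics:
  assumes chi: "chi \<in> nonprincipal_chars q"
  defines "psi \<equiv> (\<lambda>n. chi n ^ 2)"
  defines "\<mu> \<equiv> of_int (m_chi chi) + (if psi = principal_char q then 1/2 else 0)"
  shows "\<exists>D. \<forall>L\<ge>1. norm ((\<Sum>n. mangoldt_char chi n / of_nat n powr (1/2) * of_real (max 0 (1 - exp (ln (real n) - L)))) -
      (\<Sum>n. mangoldt_char psi n / of_nat n powr 1 * of_real (max 0 (1 - exp (2 * ln (real n) - L)))) + \<mu> * of_real L) \<le> D * (1 + ln L)"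
proof -
  have c: "dirichlet_char q chi" using chi by (auto simp: nonprincipal_chars_def)
  have psi: "dirichlet_char q psi" unfolding psi_def by (rule dirichlet_char_square[OF c])
  define \<delta> where "\<delta> = (if psi = principal_char q then 1 else 0 :: complex)"
  obtain f where f: "tame f" "f (1/2) \<noteq> 0" and df: "\<And>s. 1/2 < Re s \<Longrightarrow> deriv f s / f s = - 2 * dirichlet_L (mangoldt_char psi) (2 * s) +
        (if psi = principal_char q then 1 / (s - 1/2) else 0)" using tame_square[OF psi] by blast
  let ?l = "\<lambda>f w. deriv f (1/2 + w) / f (1/2 + w)"
  \<comment> \<open>Half of \<open>f' / f\<close> is minus the series at \<open>1 + 2 w\<close> plus
    \<open>\<delta> / (2 w)\<close>, and the last summand takes this pole away. As \<open>f\<close>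
    is nonzero at 1/2, that summand alone puts \<open>\<delta> / 2\<close> into
    \<open>\<mu>\<close>.\<close>
  define G where "G = (\<lambda>w. (- 1) * ?l (dirichlet_L chi) w + ((1/2) * ?l f w + (- (\<delta> / 2)) * ?l (\<lambda>s. s - 1/2) w))"
  have z3: "zorder (\<lambda>s::complex. s - 1/2) (1/2) = 1"
    by (rule zorder_eqI[of UNIV _ "\<lambda>_. 1"]) auto
  have z2: "zorder f (1/2) = 0" by (rule tame_near_half(3)[OF f])
  have "log_singular G ((- 1) * (- of_int (zorder (dirichlet_L chi) (1/2))) + ((1/2) * (- of_int (zorder f (1/2))) + (- (\<delta> / 2)) * (- of_int (zorder (\<lambda>s::complex. s - 1/2) (1/2)))))"
    unfolding G_def by (intro log_singular_add log_singular_scale log_singular_tame tame_dirichlet_L[OF chi] f tame_linear)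
  also have "(- 1) * (- of_int (zorder (dirichlet_L chi) (1/2))) + ((1/2) * (- of_int (zorder f (1/2))) + (- (\<delta> / 2)) * (- of_int (zorder (\<lambda>s::complex. s - 1/2) (1/2)))) = \<mu>"
    by (simp add: z2 z3 \<mu>_def m_chi_def \<delta>_def)
  finally have G: "log_singular G \<mu>" .
  define a1 where "a1 = (\<lambda>n. mangoldt_char chi n / of_nat n powr (1/2))"
  define a2 where "a2 = (\<lambda>n. mangoldt_char psi n / of_nat n powr 1)"
  have nchi: "norm (chi n) \<le> 1" "norm (psi n) \<le> 1" for n using norm_chi_le[OF q c] norm_chi_le[OF q psi] by auto
  have bm: "norm (mangoldt_char chi n) \<le> 1 + ln (real n)" "norm (mangoldt_char psi n) \<le> 1 + ln (real n)" if "n \<ge> 1" for n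
    using norm_mangoldt_char_le[of chi n] norm_mangoldt_char_le[of psi n] nchi that by auto
  have pw: "of_nat n powr (u + k * w) = of_nat n powr u * exp (of_real (Re k * ln (real n)) * w)" if "n > 0" "Im k = 0" for n and u k w :: complex
  proof -
    have k: "k = of_real (Re k)" using that(2) by (simp add: complex_eq_iff)
    have "of_nat n powr (k * w) = exp (k * w * of_real (ln (real n)))" using that(1) by (simp add: powr_def)
    also have "k * w * of_real (ln (real n)) = of_real (Re k * ln (real n)) * w" by (subst k) (simp add: mult_ac)
    finally show ?thesis by (simp add: powr_add)
  qed
  have e1: "a1 n * exp (- of_real (ln (real n)) * w) = mangoldt_char chi n / of_nat n powr (1/2 + w)" for n w
    using pw[of n 1 "1/2" w] by (cases "n = 0") (simp_all add: a1_def mangoldt_char_def exp_minus field_simps)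
  have e2: "a2 n * exp (- of_real (2 * ln (real n)) * w) = mangoldt_char psi n / of_nat n powr (1 + 2 * w)" for n w
    using pw[of n 2 1 w] by (cases "n = 0") (simp_all add: a2_def mangoldt_char_def exp_minus field_simps)
  have n1: "norm (a1 n) * exp (- ln (real n)) = norm (mangoldt_char chi n / of_nat n powr (3/2))" for n
    using arg_cong[OF e1[of n 1], of norm] by (simp add: norm_mult)
  have n2: "norm (a2 n) * exp (- (2 * ln (real n))) = norm (mangoldt_char psi n / of_nat n powr 3)" for n
    using arg_cong[OF e2[of n 1], of norm] by (simp add: norm_mult)
  have sa1: "summable (\<lambda>n. norm (mangoldt_char chi n / of_nat n powr s))" if "1 < Re s" for s
    by (rule summable_dirichlet_abs[OF bm(1) that])
  have sa2: "summable (\<lambda>n. norm (mangoldt_char psi n / of_nat n powr s))" if "1 < Re s" for s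
    by (rule summable_dirichlet_abs[OF bm(2) that])
  define G1 where "G1 = (\<lambda>w. dirichlet_L (mangoldt_char chi) (1/2 + w))"
  define G2 where "G2 = (\<lambda>w. dirichlet_L (mangoldt_char psi) (1 + 2 * w))"
  have s1: "(\<lambda>n. a1 n * exp (- of_real (ln (real n)) * w)) sums G1 w" if "Re w = 1" for w
    unfolding e1 G1_def dirichlet_L_def by (rule summable_sums[OF summable_norm_cancel[OF sa1]]) (use that in simp)
  have s2: "(\<lambda>n. a2 n * exp (- of_real (2 * ln (real n)) * w)) sums G2 w" if "Re w = 1" for w
    unfolding e2 G2_def dirichlet_L_def by (rule summable_sums[OF summable_norm_cancel[OF sa2]]) (use that in simp)
  have G12: "G w = G1 w - G2 w" if "Re w = 1" for w
  proof -
    have l1: "- ?l (dirichlet_L chi) w = G1 w" unfolding G1_def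
      by (rule dirichlet_L_neg_log_deriv[OF q c]) (use that in simp)
    have l2: "?l f w = - 2 * G2 w + \<delta> / w" using df[of "1/2 + w"] that by (simp add: G2_def \<delta>_def distrib_left)
    have l3: "?l (\<lambda>s. s - 1/2) w = 1 / w" by simp
    have l1': "(- 1) * ?l (dirichlet_L chi) w = G1 w" using l1 by (simp only: mult_minus1)
    show ?thesis unfolding G_def l1' l2 l3 by (simp add: algebra_simps)
  qed
  let ?p = "\<lambda>T. linepath (Complex 1 (-T)) (Complex 1 T)"
  let ?k = "\<lambda>H (L::real) (w::complex). H w * exp (of_real L * w) / (w * (w + 1))"
  have lim: "((\<lambda>T. contour_integral (?p T) (?k G L)) \<longlongrightarrow>
      2 * pi * \<i> * ((\<Sum>n. a1 n * of_real (max 0 (1 - exp (ln (real n) - L)))) - (\<Sum>n. a2 n * of_real (max 0 (1 - exp (2 * ln (real n) - L)))))) at_top" for L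
  proof -
    have P1: "((\<lambda>T. contour_integral (?p T) (?k G1 L)) \<longlongrightarrow> 2 * pi * \<i> * (\<Sum>n. a1 n * of_real (max 0 (1 - exp (ln (real n) - L))))) at_top"
      by (rule perron_series[OF _ s1]) (simp_all only: n1, rule sa1, simp)
    have P2: "((\<lambda>T. contour_integral (?p T) (?k G2 L)) \<longlongrightarrow> 2 * pi * \<i> * (\<Sum>n. a2 n * of_real (max 0 (1 - exp (2 * ln (real n) - L))))) at_top"
      by (rule perron_series[OF _ s2]) (simp_all only: n2, rule sa2, simp)
    have seg: "Re w = 1" if "w \<in> path_image (?p T)" for w T using that by (auto simp: closed_segment_same_Re)
    have hol: "dirichlet_L a holomorphic_on {s. 1 < Re s}" if "\<And>n. n \<ge> 1 \<Longrightarrow> norm (a n) \<le> 1 + ln (real n)" for a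
      unfolding holomorphic_on_open[OF open_halfspace_Re_gt]
      using has_field_derivative_dirichlet_L[OF that] by blast
    have "G1 holomorphic_on {w. 1/2 < Re w}" unfolding G1_def
      by (rule holomorphic_on_compose_gen[unfolded o_def, OF _ hol[OF bm(1)]]) (auto intro!: holomorphic_intros)
    moreover have "G2 holomorphic_on {w. 1/2 < Re w}" unfolding G2_def
      by (rule holomorphic_on_compose_gen[unfolded o_def, OF _ hol[OF bm(2)]]) (auto intro!: holomorphic_intros)
    moreover have "w \<noteq> 0 \<and> w + 1 \<noteq> 0" if "1/2 < Re w" for w :: complex using that by (auto simp: complex_eq_iff)
    ultimately have kh: "?k G1 L holomorphic_on {w. 1/2 < Re w}" "?k G2 L holomorphic_on {w. 1/2 < Re w}"
      by (auto intro!: holomorphic_intros)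
    have ci: "H contour_integrable_on ?p T" if "H holomorphic_on {w. 1/2 < Re w}" for H T
      by (rule contour_integrable_continuous_linepath, rule holomorphic_on_imp_continuous_on, rule holomorphic_on_subset[OF that])
         (use seg[of _ T] in force)
    have "contour_integral (?p T) (?k G L) = contour_integral (?p T) (?k G1 L) - contour_integral (?p T) (?k G2 L)" for T
    proof -
      have "contour_integral (?p T) (?k G L) = contour_integral (?p T) (\<lambda>w. ?k G1 L w - ?k G2 L w)"
      proof (rule contour_integral_eq)
        fix w assume "w \<in> path_image (?p T)"
        from G12[OF seg[OF this]] show "?k G L w = ?k G1 L w - ?k G2 L w"
          by (simp only: left_diff_distrib diff_divide_distrib)
      qed
      also have "\<dots> = contour_integral (?p T) (?k G1 L) - contour_integral (?p T) (?k G2 L)"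
        by (rule contour_integral_diff[OF ci[OF kh(1)] ci[OF kh(2)]])
      finally show ?thesis .
    qed
    then show ?thesis using tendsto_diff[OF P1 P2] by (simp only: right_diff_distrib)
  qed
  show ?thesis using log_singular_perron[OF G lim] unfolding a1_def a2_def by simp
qed

end

section \<open>From prime powers to primes\<close>

lemma finite_primes_le: "finite {p :: nat. prime p \<and> real p \<le> x}"
proof (rule finite_subset)
  show "{p :: nat. prime p \<and> real p \<le> x} \<subseteq> {..nat \<lceil>x\<rceil>}"
  proof
    fix p :: nat assume "p \<in> {p. prime p \<and> real p \<le> x}"
    then have "real p \<le> x" by simp
    then show "p \<in> {..nat \<lceil>x\<rceil>}" unfolding atMost_iff by linarith
  qed
qed simp

text \<open>Reindexing along the bijection sending a prime \<open>p\<close> and any \<open>k\<close>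
  to \<open>p ^ Suc k\<close>; the shift makes the exponents start at 1.\<close>

lemma has_sum_mangoldt_primepows:
  fixes h :: "nat \<Rightarrow> complex"
  assumes "((\<lambda>n. mangoldt n * h n) has_sum S) UNIV"
  shows "((\<lambda>(p, k). of_real (ln (real p)) * h (p ^ Suc k)) has_sum S) ({p. prime p} \<times> UNIV)"
proof -
  have "((\<lambda>n. mangoldt n * h n) has_sum S) UNIV \<longleftrightarrow> ((\<lambda>n. mangoldt n * h n) has_sum S) (Collect primepow)"
    by (rule has_sum_cong_neutral) (auto simp: mangoldt_def)
  also have "\<dots> \<longleftrightarrow> ((\<lambda>x. (\<lambda>n. mangoldt n * h n) ((\<lambda>(p,k). p ^ Suc k) x)) has_sum S) ({p. prime p} \<times> UNIV)"
    by (rule has_sum_reindex_bij_betw[OF bij_betw_primepows, symmetric])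
  also have "\<dots> \<longleftrightarrow> ((\<lambda>(p, k). of_real (ln (real p)) * h (p ^ Suc k)) has_sum S) ({p. prime p} \<times> UNIV)"
  proof (rule has_sum_cong)
    fix x :: "nat \<times> nat" assume "x \<in> {p. prime p} \<times> UNIV"
    then obtain p k where x: "x = (p, k)" "prime p" by auto
    then have "(mangoldt (p ^ Suc k) :: complex) = of_real (ln (real p))" by (intro mangoldt_primepow') auto
    then show "(\<lambda>n. mangoldt n * h n) ((\<lambda>(p,k). p ^ Suc k) x) = (case x of (p, k) \<Rightarrow> of_real (ln (real p)) * h (p ^ Suc k))"
      by (simp only: x(1) prod.case)
  qed
  finally show ?thesis using assms by blast
qed

text \<open>For exponents \<open>Suc k \<ge> 3\<close>, \<open>p powr (- (k + 1) / 2)\<close> is at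
  most \<open>p powr (- 3/2)\<close> times \<open>2 powr (- (k - 2) / 2)\<close>, which explains the
  exponent 3/2, the ratio \<open>2 powr (- (1/2))\<close> and the factor 2.\<close>

lemma summable_prime_powers_majorant:
  "(\<lambda>(p, k). (2 * ((1 + ln (real p)) * real p powr (- (3/2)))) * (2 powr (- (1/2))) ^ k) summable_on (UNIV \<times> UNIV :: (nat \<times> nat) set)"
proof (rule summable_on_SigmaI)
  let ?c = "2 powr (- (1/2)) :: real"
  have c: "0 \<le> ?c" "?c < 1" by (auto intro: powr_less_one)
  have "((\<lambda>k. ?c ^ k) has_sum (1 / (1 - ?c))) UNIV"
    using c by (intro norm_summable_imp_has_sum geometric_sums) (auto intro!: summable_geometric simp: norm_power)
  then show "((\<lambda>k. case (p, k) of (p, k) \<Rightarrow> (2 * ((1 + ln (real p)) * real p powr (- (3/2)))) * ?c ^ k) has_sum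
     ((2 * ((1 + ln (real p)) * real p powr (- (3/2)))) * (1 / (1 - ?c)))) UNIV" for p
    unfolding prod.case by (rule has_sum_cmult_right)
  have "summable (\<lambda>p. 2 * ((1 + ln (real p)) * real p powr (- (3/2))))"
    by (intro summable_mult summable_ln_powr) simp
  moreover have nn: "0 \<le> 2 * ((1 + ln (real p)) * real p powr (- (3/2)))" for p
  proof (cases "p = 0")
    case False
    then have "0 \<le> ln (real p)" by simp
    then show ?thesis by simp
  qed simp
  ultimately have "summable (\<lambda>p. norm (2 * ((1 + ln (real p)) * real p powr (- (3/2)))))" by simp
  then have "(\<lambda>p. 2 * ((1 + ln (real p)) * real p powr (- (3/2)))) summable_on UNIV" by (rule norm_summable_imp_summable_on)
  then show "(\<lambda>p. (2 * ((1 + ln (real p)) * real p powr (- (3/2)))) * (1 / (1 - ?c))) summable_on UNIV"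
    by (rule summable_on_cmult_left)
  show "0 \<le> (case (p, k) of (p, k) \<Rightarrow> (2 * ((1 + ln (real p)) * real p powr (- (3/2)))) * ?c ^ k)" for p k
    unfolding prod.case by (rule mult_nonneg_nonneg[OF nn]) simp
qed

text \<open>Among the prime powers \<open>p ^ Suc k\<close>, the squares (\<open>k\<close> odd) cancel between the two series, so that besides
  the primes only exponents \<open>Suc k \<ge> 3\<close> remain.\<close>

lemma prime_powers_to_primes:
  fixes chi :: "nat \<Rightarrow> complex"
  assumes mult: "\<And>n. chi (n ^ 2) = chi n ^ 2" and le: "\<And>n. norm (chi n) \<le> 1"
  shows "\<exists>B. \<forall>x\<ge>1. norm ((\<Sum>n. mangoldt_char chi n / of_nat n powr (1/2) * of_real (max 0 (1 - exp (ln (real n) - ln x)))) -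
      (\<Sum>n. mangoldt_char (\<lambda>n. chi n ^ 2) n / of_nat n powr 1 * of_real (max 0 (1 - exp (2 * ln (real n) - ln x)))) -
      (\<Sum>p | prime p \<and> real p \<le> x. chi p * of_real (ln (real p) / sqrt (real p) * (1 - real p / x)))) \<le> B"
proof (intro exI allI impI)
  fix x :: real assume x: "1 \<le> x"
  define w where "w = (\<lambda>n. max 0 (1 - real n / x))"
  define g where "g = (\<lambda>n. chi n * of_real (real n powr (- (1/2)) * w n))"
  have w: "0 \<le> w n" "w n \<le> 1" for n using x by (auto simp: w_def)
  have w0: "w n = 0" if "x \<le> real n" for n using that x by (simp add: w_def)
  have g0: "g n = 0" if "x \<le> real n" for n using w0[OF that] by (simp add: g_def)
  define S1 where "S1 = (\<Sum>n. mangoldt n * g n)"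
  define S2 where "S2 = (\<Sum>n. mangoldt n * g (n ^ 2))"
  define P where "P = (\<Sum>p | prime p \<and> real p \<le> x. of_real (ln (real p)) * g p)"
  have pw: "(of_nat n powr (1/2) :: complex) = of_real (real n powr (1/2))" for n
    using powr_of_real[of "real n" "1/2"] by simp
  have e1: "mangoldt_char chi n / of_nat n powr (1/2) * of_real (max 0 (1 - exp (ln (real n) - ln x))) = mangoldt n * g n" for n
  proof (cases "n = 0")
    case False
    then have "exp (ln (real n) - ln x) = real n / x" using x by (simp add: exp_diff)
    then show ?thesis unfolding pw by (simp add: mangoldt_char_def g_def w_def powr_minus_divide)
  qed (simp add: mangoldt_char_def)
  have e2: "mangoldt_char (\<lambda>n. chi n ^ 2) n / of_nat n powr 1 * of_real (max 0 (1 - exp (2 * ln (real n) - ln x))) = mangoldt n * g (n ^ 2)" for n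
  proof (cases "n = 0")
    case False
    have "exp (2 * ln (real n) - ln x) = exp (ln (real n)) * exp (ln (real n)) / exp (ln x)"
      by (simp only: exp_diff mult_2 exp_add)
    also have "\<dots> = (real n)\<^sup>2 / x" using x False by (simp add: power2_eq_square)
    finally have "exp (2 * ln (real n) - ln x) = (real n)\<^sup>2 / x" .
    moreover have "real (n ^ 2) powr (- (1/2)) = 1 / real n"
      using False by (simp add: powr_minus_divide powr_half_sqrt)
    ultimately show ?thesis using False by (simp add: mangoldt_char_def g_def w_def mult)
  qed (simp add: mangoldt_char_def)
  define N where "N = nat \<lceil>x\<rceil>"
  have N: "x \<le> real n" if "n \<ge> N" for n using that unfolding N_def by linarith
  \<comment> \<open>The weight vanishes from \<open>x\<close> on, so each series has finite support
    and becomes an unordered sum that can be regrouped.\<close>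
  have fin: "(h has_sum suminf h) UNIV" if "\<And>n. n \<ge> N \<Longrightarrow> h n = 0" for h :: "nat \<Rightarrow> complex"
  proof -
    have "h n = 0" if "n \<notin> {..<N}" for n using that \<open>\<And>n. n \<ge> N \<Longrightarrow> h n = 0\<close> by auto
    then have sn: "summable (\<lambda>n. norm (h n))" by (intro summable_finite[of "{..<N}"]) auto
    show ?thesis by (rule norm_summable_imp_has_sum[OF sn summable_sums[OF summable_norm_cancel[OF sn]]])
  qed
  let ?Pr = "{p :: nat. prime p}"
  define f where "f = (\<lambda>(p, k). of_real (ln (real p)) * g (p ^ Suc k))"
  have "((\<lambda>n. mangoldt n * g n) has_sum S1) UNIV"
    unfolding S1_def by (rule fin) (use N g0 in auto)
  then have F1: "(f has_sum S1) (?Pr \<times> UNIV)" unfolding f_def by (rule has_sum_mangoldt_primepows)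
  have "((\<lambda>n. mangoldt n * g (n ^ 2)) has_sum S2) UNIV"
    unfolding S2_def
  proof (rule fin)
    fix n assume "n \<ge> N"
    then have "x \<le> real n" by (rule N)
    also have "real n \<le> real (n ^ 2)" by (simp only: of_nat_le_iff power2_nat_le_imp_le power2_eq_square le_square)
    finally show "mangoldt n * g (n ^ 2) = 0" using g0 by simp
  qed
  then have "((\<lambda>(p, k). of_real (ln (real p)) * g ((p ^ Suc k) ^ 2)) has_sum S2) (?Pr \<times> UNIV)" by (rule has_sum_mangoldt_primepows)
  \<comment> \<open>The square of \<open>p ^ Suc k\<close> is \<open>p ^ Suc (2 * k + 1)\<close>, so
    the second series runs exactly over the odd indices of the first.\<close>
  also have "?this \<longleftrightarrow> (f has_sum S2) (?Pr \<times> {k. odd k})"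
  proof (rule has_sum_reindex_bij_witness[where j = "\<lambda>(p, k). (p, 2 * k + 1)" and i = "\<lambda>(p, k). (p, k div 2)"])
    fix a :: "nat \<times> nat" assume "a \<in> ?Pr \<times> UNIV"
    obtain p k where a: "a = (p, k)" by force
    have "p ^ Suc (2 * k + 1) = (p ^ Suc k) ^ 2" by (simp only: power_mult[symmetric]) (simp add: algebra_simps)
    then show "f ((\<lambda>(p, k). (p, 2 * k + 1)) a) = (case a of (p, k) \<Rightarrow> of_real (ln (real p)) * g ((p ^ Suc k) ^ 2))"
      by (simp only: a f_def prod.case)
  qed auto
  finally have F2: "(f has_sum S2) (?Pr \<times> {k. odd k})" .
  have "((\<lambda>p. of_real (ln (real p)) * g p) has_sum P) ?Pr"
  proof -
    have fp: "finite {p. prime p \<and> real p \<le> x}" by (rule finite_primes_le)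
    have "((\<lambda>p. of_real (ln (real p)) * g p) has_sum P) {p. prime p \<and> real p \<le> x}"
      unfolding P_def by (rule has_sum_finite[OF fp])
    also have "?this \<longleftrightarrow> ((\<lambda>p. of_real (ln (real p)) * g p) has_sum P) ?Pr"
      by (rule has_sum_cong_neutral) (use g0 in auto)
    finally show ?thesis .
  qed
  also have "?this \<longleftrightarrow> (f has_sum P) (?Pr \<times> {0})"
    by (rule has_sum_reindex_bij_witness[where j = "\<lambda>p. (p, 0)" and i = fst]) (auto simp: f_def)
  finally have F3: "(f has_sum P) (?Pr \<times> {0})" .
  have "(f has_sum (S1 - S2 - P)) (?Pr \<times> UNIV - ?Pr \<times> {k. odd k} - ?Pr \<times> {0})"
    by (intro has_sum_Diff F1 F2 F3) auto
  also have "?Pr \<times> UNIV - ?Pr \<times> {k. odd k} - ?Pr \<times> {0} = ?Pr \<times> {k. even k \<and> k \<noteq> 0}" by auto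
  finally have F: "(f has_sum (S1 - S2 - P)) (?Pr \<times> {k. even k \<and> k \<noteq> 0})" .
  let ?M = "\<lambda>(p, k). (2 * ((1 + ln (real p)) * real p powr (- (3/2)))) * (2 powr (- (1/2))) ^ k"
  have "?M summable_on (?Pr \<times> {k. even k \<and> k \<noteq> 0})"
    by (rule summable_on_subset_banach[OF summable_prime_powers_majorant]) auto
  then have M: "(?M has_sum (infsum ?M (?Pr \<times> {k. even k \<and> k \<noteq> 0}))) (?Pr \<times> {k. even k \<and> k \<noteq> 0})"
    by (rule has_sum_infsum)
  \<comment> \<open>The majorant does not involve \<open>x\<close>, which makes the bound
    uniform.\<close>
  have "norm (S1 - S2 - P) \<le> infsum ?M (?Pr \<times> {k. even k \<and> k \<noteq> 0})"
  proof (rule norm_infsum_le[OF F M])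
    fix y assume "y \<in> ?Pr \<times> {k::nat. even k \<and> k \<noteq> 0}"
    then obtain p k where y: "y = (p, k)" "prime p" "even k" "k \<noteq> 0" by auto
    have p: "2 \<le> real p" using prime_ge_2_nat[OF y(2)] by simp
    obtain j where k: "k = j + 2" using y(3,4) by (metis add.commute dvd_imp_le le_Suc_ex neq0_conv)
    define r where "r = real p powr (- (1/2))"
    let ?c = "2 powr (- (1/2)) :: real"
    have r: "0 \<le> r" "r \<le> ?c" using p unfolding r_def by (auto intro!: powr_mono2')
    have c2: "?c ^ 2 = 1/2" by (simp add: powr_minus_divide powr_half_sqrt power_divide)
    have "real (p ^ Suc k) powr (- (1/2)) = r ^ Suc k"
      using p by (simp add: r_def powr_power powr_powr powr_realpow[symmetric] mult.commute del: power_Suc)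
    also have "\<dots> = r ^ 3 * r ^ j"
    proof -
      have "Suc k = 3 + j" by (simp add: k)
      then show ?thesis by (simp only: power_add)
    qed
    also have "r ^ 3 = real p powr (- (3/2))" using p by (simp add: r_def powr_power)
    finally have e: "real (p ^ Suc k) powr (- (1/2)) = real p powr (- (3/2)) * r ^ j" .
    have "norm (g (p ^ Suc k)) \<le> 1 * (real (p ^ Suc k) powr (- (1/2)) * 1)"
    proof -
      have *: "\<bar>real n powr (- (1/2)) * w n\<bar> \<le> real n powr (- (1/2)) * 1" for n
        unfolding abs_mult using w by (intro mult_mono) auto
      show ?thesis unfolding g_def norm_mult norm_of_real by (rule mult_mono[OF le *]) auto
    qed
    then have "norm (g (p ^ Suc k)) \<le> real p powr (- (3/2)) * r ^ j" unfolding e by simp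
    also have "\<dots> \<le> real p powr (- (3/2)) * ?c ^ j" using r by (intro mult_left_mono power_mono) auto
    also have "?c ^ j = 2 * ?c ^ k" unfolding k power_add c2 by simp
    finally have g: "norm (g (p ^ Suc k)) \<le> real p powr (- (3/2)) * (2 * ?c ^ k)" .
    have "norm (f y) = ln (real p) * norm (g (p ^ Suc k))" using p by (simp add: y f_def norm_mult)
    also have "\<dots> \<le> (1 + ln (real p)) * (real p powr (- (3/2)) * (2 * ?c ^ k))"
      using g p by (intro mult_mono) auto
    finally show "norm (f y) \<le> ?M y" by (simp add: y mult_ac)
  qed
  moreover have "of_real (ln (real p)) * g p = chi p * of_real (ln (real p) / sqrt (real p) * (1 - real p / x))"
    if "p \<in> {p. prime p \<and> real p \<le> x}" for p
  proof -
    have "0 < real p" using that prime_gt_0_nat by auto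
    moreover have "w p = 1 - real p / x" using that x by (simp add: w_def)
    ultimately show ?thesis by (simp add: g_def powr_minus_divide powr_half_sqrt)
  qed
  then have "P = (\<Sum>p | prime p \<and> real p \<le> x. chi p * of_real (ln (real p) / sqrt (real p) * (1 - real p / x)))"
    unfolding P_def by (intro sum.cong refl)
  ultimately show "norm ((\<Sum>n. mangoldt_char chi n / of_nat n powr (1/2) * of_real (max 0 (1 - exp (ln (real n) - ln x)))) -
      (\<Sum>n. mangoldt_char (\<lambda>n. chi n ^ 2) n / of_nat n powr 1 * of_real (max 0 (1 - exp (2 * ln (real n) - ln x)))) -
      (\<Sum>p | prime p \<and> real p \<le> x. chi p * of_real (ln (real p) / sqrt (real p) * (1 - real p / x))))
      \<le> infsum ?M (?Pr \<times> {k. even k \<and> k \<noteq> 0})"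
    unfolding e1 e2 S1_def S2_def by simp
qed

lemma prime_sum_asymptotics:
  assumes q: "q > 1" and GRH: "GRH_mod q" and chi: "chi \<in> nonprincipal_chars q"
  defines "\<mu> \<equiv> of_int (m_chi chi) + (if (\<lambda>n. chi n ^ 2) = principal_char q then 1/2 else 0)"
  shows "\<exists>D. \<forall>x\<ge>exp 1. norm ((\<Sum>p | prime p \<and> real p \<le> x. chi p * of_real (ln (real p) / sqrt (real p) * (1 - real p / x))) + \<mu> * of_real (ln x)) \<le> D * (1 + ln (ln x))"
proof -
  have c: "dirichlet_char q chi" using chi by (auto simp: nonprincipal_chars_def)
  let ?S1 = "\<lambda>L. \<Sum>n. mangoldt_char chi n / of_nat n powr (1/2) * of_real (max 0 (1 - exp (ln (real n) - L)))"
  let ?S2 = "\<lambda>L. \<Sum>n. mangoldt_char (\<lambda>n. chi n ^ 2) n / of_nat n powr 1 * of_real (max 0 (1 - exp (2 * ln (real n) - L)))"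
  let ?P = "\<lambda>x. \<Sum>p | prime p \<and> real p \<le> x. chi p * of_real (ln (real p) / sqrt (real p) * (1 - real p / x))"
  obtain D where D: "\<And>L. 1 \<le> L \<Longrightarrow> norm (?S1 L - ?S2 L + \<mu> * of_real L) \<le> D * (1 + ln L)"
    using prime_power_sum_asymptotics[OF q GRH chi] unfolding \<mu>_def by blast
  obtain B where B: "\<And>x. 1 \<le> x \<Longrightarrow> norm (?S1 (ln x) - ?S2 (ln x) - ?P x) \<le> B"
    using prime_powers_to_primes[of chi] dirichlet_char_power[OF c] norm_chi_le[OF q c] by blast
  show ?thesis
  proof (intro exI allI impI)
    fix x :: real assume x: "exp 1 \<le> x"
    have x1: "1 \<le> x" using x exp_ge_add_one_self[of 1] by linarith
    have lx: "1 \<le> ln x" using x x1 by (subst ln_ge_iff) auto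
    have "?P x + \<mu> * of_real (ln x) = (?S1 (ln x) - ?S2 (ln x) + \<mu> * of_real (ln x)) - (?S1 (ln x) - ?S2 (ln x) - ?P x)" by simp
    also have "norm \<dots> \<le> D * (1 + ln (ln x)) + B"
      by (intro order_trans[OF norm_triangle_ineq4] add_mono D B lx x1)
    also have "\<dots> \<le> (D + \<bar>B\<bar>) * (1 + ln (ln x))"
    proof -
      have "\<bar>B\<bar> * 1 \<le> \<bar>B\<bar> * (1 + ln (ln x))" using lx by (intro mult_left_mono) auto
      then show ?thesis unfolding distrib_right[of D] using abs_ge_self[of B] by linarith
    qed
    finally show "norm (?P x + \<mu> * of_real (ln x)) \<le> (D + \<bar>B\<bar>) * (1 + ln (ln x))" .
  qed
qed

section \<open>Partial summation\<close>

text \<open>Taylor's formula at \<open>x\<close>, with integral remainder, for \<open>f u = (1 - u / x) / ln u\<close>.\<close>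

lemma weight_taylor:
  fixes p x :: real
  assumes p: "2 \<le> p" "p \<le> x"
  defines "\<phi> \<equiv> (\<lambda>u. (1 / (u\<^sup>2 * (ln u)\<^sup>2) + 2 / (u\<^sup>2 * (ln u)^3)) - (2 / (u * (ln u)^3) - 1 / (u * (ln u)\<^sup>2)) / x)"
  shows "((\<lambda>u. \<phi> u * max 0 (u - p)) has_integral ((1 - p / x) / ln p - (x - p) / (x * ln x))) {2..x}"
proof -
  have x0: "0 < x" using p by simp
  define f1 where "f1 = (\<lambda>u. - 1 / (u * (ln u)\<^sup>2) - (1 / ln u - 1 / (ln u)\<^sup>2) / x)"
  define f where "f = (\<lambda>u. 1 / ln u - (u / ln u) / x)"
  have lnp: "0 < ln u" if "2 \<le> u" for u :: real using that by simp
  have d: "(f has_field_derivative f1 u) (at u)" if u: "2 \<le> u" for u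
    unfolding f_def f1_def using u lnp[OF u] x0
    by (auto intro!: derivative_eq_intros simp: field_simps power2_eq_square)
  have d1: "(f1 has_field_derivative \<phi> u) (at u)" if u: "2 \<le> u" for u
    unfolding f1_def \<phi>_def using u lnp[OF u] x0
    by (auto intro!: derivative_eq_intros simp: field_simps power2_eq_square power3_eq_cube)
  have "((\<lambda>u. \<phi> u * (u - p)) has_integral ((f1 x * (x - p) - f x) - (f1 p * (p - p) - f p))) {p..x}"
  proof (rule fundamental_theorem_of_calculus[OF p(2)])
    fix u assume "u \<in> {p..x}"
    then have u: "2 \<le> u" using p by simp
    have "((\<lambda>u. f1 u * (u - p) - f u) has_field_derivative (\<phi> u * (u - p))) (at u)"
      using d[OF u] d1[OF u] by (auto intro!: derivative_eq_intros)
    then show "((\<lambda>u. f1 u * (u - p) - f u) has_vector_derivative (\<phi> u * (u - p))) (at u within {p..x})"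
      by (simp add: has_real_derivative_iff_has_vector_derivative has_vector_derivative_at_within)
  qed
  moreover have "(f1 x * (x - p) - f x) - (f1 p * (p - p) - f p) = (1 - p / x) / ln p - (x - p) / (x * ln x)"
  proof -
    have "f1 x = - 1 / (x * ln x)" unfolding f1_def using x0 lnp[of x] p by (simp add: field_simps power2_eq_square)
    moreover have "f x = 0" unfolding f_def using x0 by simp
    moreover have "f p = (1 - p / x) / ln p" unfolding f_def by (simp add: diff_divide_distrib)
    ultimately show ?thesis by simp
  qed
  ultimately have "((\<lambda>u. \<phi> u * (u - p)) has_integral ((1 - p / x) / ln p - (x - p) / (x * ln x))) {p..x}" by simp
  \<comment> \<open>Writing \<open>max 0 (u - p)\<close> makes \<open>{2..x}\<close> the range of
    integration for every \<open>p\<close>, so that the sum over primes can be taken inside the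
    integral.\<close>
  then have 1: "((\<lambda>u. \<phi> u * max 0 (u - p)) has_integral ((1 - p / x) / ln p - (x - p) / (x * ln x))) {p..x}"
    by (rule has_integral_eq[rotated]) auto
  have "((\<lambda>u. 0) has_integral 0) {2..p}" by simp
  then have 2: "((\<lambda>u. \<phi> u * max 0 (u - p)) has_integral 0) {2..p}"
    by (rule has_integral_eq[rotated]) auto
  from has_integral_combine[OF p 2 1] show ?thesis by simp
qed

text \<open>Since \<open>H\<close> is a decreasing tail primitive of the majorant \<open>H'\<close>,
  integrals up to two points beyond \<open>x\<close> differ from the one up to \<open>x\<close> by
  at most \<open>H x\<close>. This yields both the limit and the rate.\<close>

lemma integral_tail_limit:
  fixes h :: "real \<Rightarrow> complex" and H :: "real \<Rightarrow> real"
  assumes cont: "\<And>b. continuous_on {2..b} h"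
    and H: "\<And>u. 2 \<le> u \<Longrightarrow> (H has_field_derivative - H' u) (at u)"
    and bd: "\<And>u. 2 \<le> u \<Longrightarrow> norm (h u) \<le> H' u"
    and H0: "(H \<longlongrightarrow> 0) at_top" "\<And>u. 2 \<le> u \<Longrightarrow> 0 \<le> H u"
  shows "\<exists>C. \<forall>x\<ge>2. norm (integral {2..x} h - C) \<le> H x"
proof -
  define J where "J = (\<lambda>x. integral {2..x} h)"
  have diff: "norm (J y - J x) \<le> H x" if xy: "2 \<le> x" "x \<le> y" for x y
  proof -
    have "integral {2..x} h + integral {x..y} h = integral {2..y} h"
      using xy by (intro Henstock_Kurzweil_Integration.integral_combine integrable_continuous_interval cont)
    then have Jdiff: "J y - J x = integral {x..y} h" by (simp add: J_def algebra_simps)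
    have I: "(H' has_integral (- H y - (- H x))) {x..y}"
    proof (rule fundamental_theorem_of_calculus[OF xy(2)])
      fix u assume "u \<in> {x..y}"
      then have "((\<lambda>u. - H u) has_field_derivative H' u) (at u)" using H[of u] xy by (auto intro!: derivative_eq_intros)
      then show "((\<lambda>u. - H u) has_vector_derivative H' u) (at u within {x..y})"
        by (simp add: has_real_derivative_iff_has_vector_derivative has_vector_derivative_at_within)
    qed
    have "norm (integral {x..y} h) \<le> integral {x..y} H'"
    proof (rule integral_norm_bound_integral)
      show "h integrable_on {x..y}"
        by (rule integrable_continuous_interval, rule continuous_on_subset[OF cont[of y]]) (use xy in auto)
      show "H' integrable_on {x..y}" using I by blast
      show "norm (h u) \<le> H' u" if "u \<in> {x..y}" for u using bd that xy by simp
    qed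
    also have "integral {x..y} H' = H x - H y" using integral_unique[OF I] by simp
    also have "\<dots> \<le> H x" using H0(2)[of y] xy by simp
    finally show ?thesis unfolding Jdiff .
  qed
  have "Cauchy (\<lambda>n. J (real n))"
  proof (rule metric_CauchyI)
    fix e :: real assume e: "0 < e"
    have "eventually (\<lambda>x. H x < e) at_top" using order_tendstoD(2)[OF H0(1) e] .
    then obtain X where X: "\<And>x. X \<le> x \<Longrightarrow> H x < e" unfolding eventually_at_top_linorder by blast
    define M where "M = nat \<lceil>max X 2\<rceil>"
    have M: "X \<le> real n" "2 \<le> real n" if "M \<le> n" for n using that unfolding M_def by linarith+
    have *: "dist (J (real m)) (J (real n)) < e" if "M \<le> n" "n \<le> m" for m n
      using diff[of "real n" "real m"] X[of "real n"] M[of n] that by (simp add: dist_norm)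
    show "\<exists>M. \<forall>m\<ge>M. \<forall>n\<ge>M. dist (J (real m)) (J (real n)) < e"
    proof (intro exI allI impI)
      fix m n assume "M \<le> m" "M \<le> n"
      then show "dist (J (real m)) (J (real n)) < e"
        using *[of n m] *[of m n] by (cases "n \<le> m") (auto simp: dist_commute)
    qed
  qed
  then obtain C where C: "(\<lambda>n. J (real n)) \<longlonglongrightarrow> C" by (meson Cauchy_convergent convergent_def)
  show ?thesis
  proof (intro exI allI impI)
    fix x :: real assume x: "2 \<le> x"
    have "(\<lambda>n. norm (J (real n) - J x)) \<longlonglongrightarrow> norm (C - J x)" by (intro tendsto_intros C)
    moreover have "\<forall>n\<ge>nat \<lceil>x\<rceil>. norm (J (real n) - J x) \<le> H x"
    proof (intro allI impI)
      fix n assume "nat \<lceil>x\<rceil> \<le> n"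
      then have "x \<le> real n" by linarith
      then show "norm (J (real n) - J x) \<le> H x" by (rule diff[OF x])
    qed
    ultimately have "norm (C - J x) \<le> H x" by (intro Lim_bounded)
    then show "norm (integral {2..x} h - C) \<le> H x" by (simp add: J_def norm_minus_commute)
  qed
qed

text \<open>From \<open>exp 2\<close> on, \<open>ln u \<ge> 2\<close> and \<open>1 / ln u\<close> is
  at most the derivative \<open>2 / ln u - 2 / (ln u)^2\<close> of \<open>2 * u / ln u\<close>. The
  initial piece has length below 7 and integrand at most 3/2.\<close>

lemma integral_inverse_ln_le:
  fixes x :: real
  assumes x: "exp 2 \<le> x"
  shows "(\<lambda>u. 1 / ln u) integrable_on {2..x}" "integral {2..x} (\<lambda>u. 1 / ln u) \<le> 14 + 2 * (x / ln x)"
proof -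
  have e2: "2 \<le> exp (2::real)" using exp_ge_add_one_self[of 2] by simp
  have int: "(\<lambda>u. 1 / ln u) integrable_on {a..b}" if "2 \<le> a" for a b :: real
    by (rule integrable_continuous_interval) (use that in \<open>auto intro!: continuous_intros\<close>)
  then show "(\<lambda>u. 1 / ln u) integrable_on {2..x}" by simp
  have ln2: "2/3 \<le> ln (2::real)" by (rule ln2_ge_two_thirds)
  have "integral {2..exp 2} (\<lambda>u::real. 1 / ln u) \<le> integral {2..exp 2} (\<lambda>u::real. 3/2)"
  proof (rule integral_le)
    fix u :: real assume u: "u \<in> {2..exp 2}"
    then have "ln 2 \<le> ln u" by simp
    then have "2/3 \<le> ln u" using ln2 by linarith
    then show "1 / ln u \<le> 3/2" by (simp add: field_simps)
  qed (use int in auto)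
  also have "\<dots> = (exp 2 - 2) * (3/2)" using e2 by simp
  also have "\<dots> \<le> 14"
  proof -
    have "exp (1 + 1) = exp 1 * exp (1::real)" by (rule exp_add)
    moreover have "exp 1 * exp 1 \<le> 3 * (3::real)" by (intro mult_mono exp_le) auto
    ultimately show ?thesis by simp
  qed
  finally have 1: "integral {2..exp 2} (\<lambda>u::real. 1 / ln u) \<le> 14" .
  have I: "((\<lambda>u. 2 / ln u - 2 / (ln u)\<^sup>2) has_integral (2 * x / ln x - 2 * exp 2 / ln (exp 2))) {exp 2..x}"
  proof (rule fundamental_theorem_of_calculus[OF x])
    fix u assume "u \<in> {exp 2..x}"
    then have "2 \<le> u" using e2 by simp
    then have "0 < ln u" "0 < u" by auto
    then have "((\<lambda>u. 2 * u / ln u) has_field_derivative (2 / ln u - 2 / (ln u)\<^sup>2)) (at u)"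
      by (auto intro!: derivative_eq_intros simp: field_simps power2_eq_square)
    then show "((\<lambda>u. 2 * u / ln u) has_vector_derivative (2 / ln u - 2 / (ln u)\<^sup>2)) (at u within {exp 2..x})"
      by (simp add: has_real_derivative_iff_has_vector_derivative has_vector_derivative_at_within)
  qed
  have "integral {exp 2..x} (\<lambda>u. 1 / ln u) \<le> integral {exp 2..x} (\<lambda>u. 2 / ln u - 2 / (ln u)\<^sup>2)"
  proof (rule integral_le)
    show "(\<lambda>u. 1 / ln u) integrable_on {exp 2..x}" using e2 by (intro int)
    show "(\<lambda>u. 2 / ln u - 2 / (ln u)\<^sup>2) integrable_on {exp 2..x}" using I by blast
    fix u assume u: "u \<in> {exp 2..x}"
    then have "0 < u" using e2 by simp
    then have l: "2 \<le> ln u" using u by (subst ln_ge_iff) auto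
    then have "2 / (ln u)\<^sup>2 \<le> 1 / ln u" by (simp add: power2_eq_square field_simps)
    then show "1 / ln u \<le> 2 / ln u - 2 / (ln u)\<^sup>2" by simp
  qed
  also have "\<dots> \<le> 2 * (x / ln x)" using integral_unique[OF I] by simp
  finally have 2: "integral {exp 2..x} (\<lambda>u. 1 / ln u) \<le> 2 * (x / ln x)" .
  have "integral {2..exp 2} (\<lambda>u. 1 / ln u) + integral {exp 2..x} (\<lambda>u. 1 / ln u) = integral {2..x} (\<lambda>u. 1 / ln u)"
    by (rule Henstock_Kurzweil_Integration.integral_combine) (use e2 x int in auto)
  then show "integral {2..x} (\<lambda>u. 1 / ln u) \<le> 14 + 2 * (x / ln x)" using 1 2 by linarith
qed

text \<open>Inserting \<open>A u = E u - \<mu> * ln u\<close> into the Taylor formula for the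
  weights gives three integrals: the logarithm produces \<open>ln (ln x)\<close>; the error
  \<open>E\<close> is integrated against \<open>k\<close>, of size
  \<open>1 / (u * (ln u)^2)\<close>, and converges to a limit that enters \<open>C\<close>; the part
  with the factor \<open>1 / x\<close> is \<open>O(1 / ln x)\<close> because \<open>A u\<close> is
  \<open>O(ln u)\<close>.\<close>

lemma partial_summation:
  fixes a :: "nat \<Rightarrow> complex" and \<mu> :: complex
  defines "Pr \<equiv> (\<lambda>x. {p :: nat. prime p \<and> real p \<le> x})"
  assumes D: "\<And>x. exp 1 \<le> x \<Longrightarrow> norm ((\<Sum>p\<in>Pr x. a p * of_real (1 - real p / x)) + \<mu> * of_real (ln x)) \<le> D * (1 + ln (ln x))"
  shows "\<exists>C K. \<forall>x\<ge>exp 2. norm ((\<Sum>p\<in>Pr x. a p * of_real ((1 - real p / x) / ln (real p))) - (- \<mu> * of_real (ln (ln x)) + C))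
     \<le> K * ((1 + ln (ln x)) / ln x)"
proof -
  have fin: "finite (Pr x)" for x unfolding Pr_def by (rule finite_primes_le)
  define l where "l = (\<lambda>u::real. 1 + ln (ln u))"
  \<comment> \<open>Each prime enters with weight 0 at \<open>u = p\<close>, so \<open>V\<close> is
    continuous, as the integrability arguments require.\<close>
  define V where "V = (\<lambda>u. \<Sum>p\<in>Pr u. a p * of_real (u - real p))"
  define A where "A = (\<lambda>u. V u / of_real u)"
  define E where "E = (\<lambda>u. A u + \<mu> * of_real (ln u))"
  have ln2: "2/3 \<le> ln (2::real)" by (rule ln2_ge_two_thirds)
  have lnu: "2/3 \<le> ln u" if "2 \<le> u" for u :: real
  proof -
    have "ln 2 \<le> ln u" using that by simp
    then show ?thesis using ln2 by linarith
  qed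
  \<comment> \<open>Near 2, \<open>ln (ln u)\<close> is negative. This bound keeps \<open>l\<close>
    away from 0, so the hypothesis, given from \<open>exp 1\<close> on, extends to
    \<open>u \<ge> 2\<close> at the price of a constant.\<close>
  have l_lower: "1/2 \<le> l u" if "2 \<le> u" for u
  proof -
    have "3/2 \<le> exp (1/2 :: real)" using exp_ge_add_one_self[of "1/2"] by simp
    then have "exp (-(1/2)) \<le> (2/3 :: real)" by (simp add: exp_minus field_simps)
    then have "exp (-(1/2)) \<le> ln u" using lnu[OF that] by linarith
    then have "-(1/2) \<le> ln (ln u)" using lnu[OF that] by (subst ln_ge_iff) auto
    then show ?thesis by (simp add: l_def)
  qed
  have l_upper: "l u \<le> ln u" if "2 \<le> u" for u
    using ln_le_minus_one[of "ln u"] lnu[OF that] by (simp add: l_def)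
  have A_eq: "A u = (\<Sum>p\<in>Pr u. a p * of_real (1 - real p / u))" if "0 < u" for u
    unfolding A_def V_def sum_divide_distrib using that by (intro sum.cong refl) (simp add: field_simps)
  obtain K where K: "\<And>u. 2 \<le> u \<Longrightarrow> norm (E u) \<le> K * l u" "0 \<le> K"
  proof -
    define B where "B = (\<Sum>p\<in>Pr (exp 1). norm (a p)) + norm \<mu>"
    have B0: "0 \<le> B" by (auto simp: B_def intro!: add_nonneg_nonneg sum_nonneg)
    have "norm (E u) \<le> (\<bar>D\<bar> + 2 * B) * l u" if u: "2 \<le> u" for u
    proof (cases "exp 1 \<le> u")
      case True
      have "norm (E u) \<le> D * l u" using D[OF True] A_eq[of u] u by (simp add: E_def l_def)
      also have "\<dots> \<le> (\<bar>D\<bar> + 2 * B) * l u" using l_lower[OF u] B0 by (intro mult_right_mono) auto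
      finally show ?thesis .
    next
      case False
      have Au: "A u = (\<Sum>p\<in>Pr u. a p * of_real (1 - real p / u))" using A_eq[of u] u by simp
      have "norm (A u) \<le> (\<Sum>p\<in>Pr u. norm (a p))"
        unfolding Au
      proof (rule sum_norm_le)
        fix p assume "p \<in> Pr u"
        then have "\<bar>1 - real p / u\<bar> \<le> 1" using u by (simp add: Pr_def field_simps)
        then have "norm (a p) * \<bar>1 - real p / u\<bar> \<le> norm (a p) * 1" by (intro mult_left_mono) auto
        then show "norm (a p * of_real (1 - real p / u)) \<le> norm (a p)" by (simp only: norm_mult norm_of_real mult_1_right)
      qed
      also have "\<dots> \<le> (\<Sum>p\<in>Pr (exp 1). norm (a p))" using False by (intro sum_mono2 fin) (auto simp: Pr_def)
      finally have 1: "norm (A u) \<le> (\<Sum>p\<in>Pr (exp 1). norm (a p))" .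
      have "ln u \<le> 1" using False u by (metis exp_gt_zero ln_exp ln_less_cancel_iff linear not_le order_less_le_trans zero_less_numeral order_less_imp_le)
      then have "norm \<mu> * \<bar>ln u\<bar> \<le> norm \<mu> * 1" using lnu[OF u] by (intro mult_left_mono) auto
      then have "norm (\<mu> * of_real (ln u)) \<le> norm \<mu>" by (simp only: norm_mult norm_of_real mult_1_right)
      from norm_triangle_mono[OF 1 this] have "norm (E u) \<le> B" by (simp add: E_def B_def)
      also have "B \<le> (2 * B) * l u" using l_lower[OF u] mult_left_mono[of "1/2" "l u" "2 * B"] B0 by simp
      also have "\<dots> \<le> (\<bar>D\<bar> + 2 * B) * l u" using l_lower[OF u] by (intro mult_right_mono) auto
      finally show ?thesis .
    qed
    then show ?thesis using that[of "\<bar>D\<bar> + 2 * B"] B0 by auto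
  qed
  have Vmax: "V u = (\<Sum>p\<in>Pr x. a p * of_real (max 0 (u - real p)))" if "u \<le> x" for u x
    unfolding V_def
  proof (rule sum.mono_neutral_cong_left)
    show "Pr u \<subseteq> Pr x" using that by (auto simp: Pr_def)
    show "\<forall>p\<in>Pr x - Pr u. a p * of_real (max 0 (u - real p)) = 0" by (auto simp: Pr_def)
  qed (auto simp: fin, auto simp: Pr_def)
  have Vc: "continuous_on {2..b} V" for b
  proof -
    have "continuous_on {2..b} (\<lambda>u. \<Sum>p\<in>Pr b. a p * of_real (max 0 (u - real p)))" by (intro continuous_intros)
    then show ?thesis by (rule continuous_on_cong[THEN iffD1, rotated 2]) (use Vmax in auto)
  qed
  have Ac: "continuous_on {2..b} A" for b unfolding A_def by (intro continuous_intros Vc) auto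
  have Ec: "continuous_on {2..b} E" for b unfolding E_def by (intro continuous_intros Ac) auto
  define k where "k = (\<lambda>u::real. 1 / (u * (ln u)\<^sup>2) + 2 / (u * (ln u)^3))"
  have k_bd: "0 \<le> k u" "k u \<le> 4 / (u * (ln u)\<^sup>2)" if u: "2 \<le> u" for u
  proof -
    have L: "0 < ln u" "2/3 \<le> ln u" "0 < u" using lnu[OF u] u by auto
    show "0 \<le> k u" using L by (simp add: k_def)
    have "2 / (u * (ln u)^3) = (2 / ln u) * (1 / (u * (ln u)\<^sup>2))" by (simp add: power3_eq_cube power2_eq_square)
    also have "\<dots> \<le> 3 * (1 / (u * (ln u)\<^sup>2))" using L by (intro mult_right_mono) (auto simp: field_simps)
    finally have le3: "2 / (u * (ln u)^3) \<le> 3 * (1 / (u * (ln u)\<^sup>2))" .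
    have "X + Y \<le> 4 * X" if "Y \<le> 3 * X" for X Y :: real using that by simp
    from this[OF le3] have "k u \<le> 4 * (1 / (u * (ln u)\<^sup>2))" unfolding k_def .
    then show "k u \<le> 4 / (u * (ln u)\<^sup>2)" by simp
  qed
  have kc: "continuous_on {2..b} k" for b
    unfolding k_def by (intro continuous_intros) (auto simp: ln_eq_zero_iff)
  \<comment> \<open>The tail function \<open>(2 + ln (ln u)) / ln u\<close> has derivative
    \<open>- l u / (u * (ln u)^2)\<close>, which is minus the majorant up to the factor
    \<open>4 * K\<close>.\<close>
  have "\<exists>C. \<forall>x\<ge>2. norm (integral {2..x} (\<lambda>u. of_real (k u) * E u) - C) \<le> 4 * K * ((2 + ln (ln x)) / ln x)"
  proof (rule integral_tail_limit[where H' = "\<lambda>u. 4 * K * (l u / (u * (ln u)\<^sup>2))"])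
    show "continuous_on {2..b} (\<lambda>u. of_real (k u) * E u)" for b by (intro continuous_intros kc Ec)
    show "((\<lambda>u. 4 * K * ((2 + ln (ln u)) / ln u)) has_field_derivative - (4 * K * (l u / (u * (ln u)\<^sup>2)))) (at u)" if u: "2 \<le> u" for u
    proof -
      have L: "0 < ln u" "0 < u" using lnu[OF u] u by auto
      have "((\<lambda>u. (2 + ln (ln u)) / ln u) has_field_derivative - (l u / (u * (ln u)\<^sup>2))) (at u)"
        using L unfolding l_def by (auto intro!: derivative_eq_intros simp: field_simps power2_eq_square)
      from DERIV_cmult[OF this, of "4 * K"] show ?thesis by simp
    qed
    show "norm (of_real (k u) * E u) \<le> 4 * K * (l u / (u * (ln u)\<^sup>2))" if u: "2 \<le> u" for u
    proof -
      have "norm (of_real (k u) * E u) \<le> (4 / (u * (ln u)\<^sup>2)) * (K * l u)"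
        unfolding norm_mult norm_of_real using k_bd[OF u] K(1)[OF u] u by (intro mult_mono) auto
      then show ?thesis by (simp add: mult_ac)
    qed
    have "((\<lambda>x::real. (2 + ln (ln x)) / ln x) \<longlongrightarrow> 0) at_top" by real_asymp
    then show "((\<lambda>u. 4 * K * ((2 + ln (ln u)) / ln u)) \<longlongrightarrow> 0) at_top" by (rule tendsto_mult_right_zero)
    show "0 \<le> 4 * K * ((2 + ln (ln u)) / ln u)" if u: "2 \<le> u" for u
      using l_lower[OF u] lnu[OF u] K(2) by (simp add: l_def)
  qed
  then obtain C' where C': "\<And>x. 2 \<le> x \<Longrightarrow> norm (integral {2..x} (\<lambda>u. of_real (k u) * E u) - C') \<le> 4 * K * ((2 + ln (ln x)) / ln x)" by blast
  define k2 where "k2 = (\<lambda>u::real. 2 / (u * (ln u)^3) - 1 / (u * (ln u)\<^sup>2))"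
  have k2c: "continuous_on {2..b} k2" for b
    unfolding k2_def by (intro continuous_intros) (auto simp: ln_eq_zero_iff)
  \<comment> \<open>Collected from the boundary term \<open>A x / ln x\<close>, the lower end point
    2 of the elementary integral, and the limit of the error integral.\<close>
  define C where "C = - \<mu> + \<mu> * of_real (ln (ln 2) - 2 / ln 2) + C'"
  define KK where "KK = K + 2 * norm \<mu> + 8 * K + 4 * (norm \<mu> + K) * 16"
  show ?thesis
  proof (intro exI allI impI)
    fix x :: real assume x: "exp 2 \<le> x"
    have tri: "norm (a + b + c - d) \<le> norm a + norm b + norm c + norm d" for a b c d :: complex
      using norm_triangle_ineq4[of "a + b + c" d] norm_triangle_ineq[of "a + b" c] norm_triangle_ineq[of a b] by linarith
    have x2: "2 \<le> x" using x exp_ge_add_one_self[of 2] by simp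
    have x0: "0 < x" using x2 by simp
    have lx: "2 \<le> ln x" using x x0 by (subst ln_ge_iff) auto
    have l1: "1 \<le> l x" using lx by (simp add: l_def)
    define \<phi> where "\<phi> = (\<lambda>u::real. (1 / (u\<^sup>2 * (ln u)\<^sup>2) + 2 / (u\<^sup>2 * (ln u)^3)) - (2 / (u * (ln u)^3) - 1 / (u * (ln u)\<^sup>2)) / x)"
    have "((\<lambda>u. \<Sum>p\<in>Pr x. a p * of_real (\<phi> u * max 0 (u - real p))) has_integral
       (\<Sum>p\<in>Pr x. a p * of_real ((1 - real p / x) / ln (real p) - (x - real p) / (x * ln x)))) {2..x}"
    proof (intro has_integral_sum fin has_integral_mult_right has_integral_of_real)
      fix p assume "p \<in> Pr x"
      then have "2 \<le> real p" "real p \<le> x" using prime_ge_2_nat by (auto simp: Pr_def)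
      from weight_taylor[OF this] show "((\<lambda>u. \<phi> u * max 0 (u - real p)) has_integral ((1 - real p / x) / ln (real p) - (x - real p) / (x * ln x))) {2..x}"
        by (simp add: \<phi>_def)
    qed
    also have "(\<Sum>p\<in>Pr x. a p * of_real ((1 - real p / x) / ln (real p) - (x - real p) / (x * ln x))) =
       (\<Sum>p\<in>Pr x. a p * of_real ((1 - real p / x) / ln (real p))) - A x / of_real (ln x)"
    proof -
      have "A x / of_real (ln x) = (\<Sum>p\<in>Pr x. a p * of_real ((x - real p) / (x * ln x)))"
        unfolding A_def V_def sum_divide_distrib by (intro sum.cong refl) simp
      then show ?thesis by (simp only: of_real_diff right_diff_distrib sum_subtractf)
    qed
    finally have 1: "((\<lambda>u. of_real (\<phi> u) * V u) has_integral ((\<Sum>p\<in>Pr x. a p * of_real ((1 - real p / x) / ln (real p))) - A x / of_real (ln x))) {2..x}"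
    proof (rule has_integral_eq[rotated])
      fix u assume "u \<in> {2..x}"
      then show "(\<Sum>p\<in>Pr x. a p * of_real (\<phi> u * max 0 (u - real p))) = of_real (\<phi> u) * V u"
        using Vmax[of u x] by (simp add: sum_distrib_left mult_ac)
    qed
    define I1 where "I1 = integral {2..x} (\<lambda>u. of_real (k u) * E u)"
    define I2 where "I2 = integral {2..x} (\<lambda>u. of_real (k2 u) * V u)"
    have J1: "((\<lambda>u. of_real (k u) * E u) has_integral I1) {2..x}"
      unfolding I1_def by (intro integrable_integral integrable_continuous_interval continuous_intros kc Ec)
    have J2: "((\<lambda>u. of_real (k2 u) * V u) has_integral I2) {2..x}"
      unfolding I2_def by (intro integrable_integral integrable_continuous_interval continuous_intros k2c Vc)
    have J3: "((\<lambda>u. 1 / (u * ln u) + 2 / (u * (ln u)\<^sup>2)) has_integral ((ln (ln x) - 2 / ln x) - (ln (ln 2) - 2 / ln 2))) {2..x}"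
    proof (rule fundamental_theorem_of_calculus[OF x2])
      fix u assume "u \<in> {2..x}"
      then have "0 < ln u" "0 < u" by auto
      then have "((\<lambda>u. ln (ln u) - 2 / ln u) has_field_derivative (1 / (u * ln u) + 2 / (u * (ln u)\<^sup>2))) (at u)"
        by (auto intro!: derivative_eq_intros simp: field_simps power2_eq_square)
      then show "((\<lambda>u. ln (ln u) - 2 / ln u) has_vector_derivative (1 / (u * ln u) + 2 / (u * (ln u)\<^sup>2))) (at u within {2..x})"
        by (simp add: has_real_derivative_iff_has_vector_derivative has_vector_derivative_at_within)
    qed
    have "((\<lambda>u. of_real (k u) * E u - \<mu> * of_real (1 / (u * ln u) + 2 / (u * (ln u)\<^sup>2)) - of_real (1 / x) * (of_real (k2 u) * V u)) has_integral
       (I1 - \<mu> * of_real ((ln (ln x) - 2 / ln x) - (ln (ln 2) - 2 / ln 2)) - of_real (1 / x) * I2)) {2..x}"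
      by (intro has_integral_diff J1 has_integral_mult_right has_integral_of_real J3 J2)
    then have 2: "((\<lambda>u. of_real (\<phi> u) * V u) has_integral (I1 - \<mu> * of_real ((ln (ln x) - 2 / ln x) - (ln (ln 2) - 2 / ln 2)) - of_real (1 / x) * I2)) {2..x}"
    proof (rule has_integral_eq[rotated])
      fix u assume "u \<in> {2..x}"
      then have u: "0 < u" "0 < ln u" by auto
      have V: "V u = of_real u * A u" using u by (simp add: A_def)
      \<comment> \<open>The second derivative of the weight splits into a part independent of
        \<open>x\<close> and a part carrying \<open>1 / x\<close>.\<close>
      have "\<phi> u * u = k u - k2 u * u / x"
        using u x0 by (simp add: \<phi>_def k_def k2_def field_simps power2_eq_square power3_eq_cube)
      moreover have "k u * ln u = 1 / (u * ln u) + 2 / (u * (ln u)\<^sup>2)"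
        using u by (simp add: k_def field_simps power2_eq_square power3_eq_cube)
      ultimately have "of_real (\<phi> u) * V u = of_real (k u - k2 u * u / x) * A u"
        "\<mu> * of_real (1 / (u * ln u) + 2 / (u * (ln u)\<^sup>2)) = \<mu> * of_real (k u * ln u)"
        unfolding V by (simp_all flip: of_real_mult add: mult.assoc[symmetric])
      then show "of_real (k u) * E u - \<mu> * of_real (1 / (u * ln u) + 2 / (u * (ln u)\<^sup>2)) - of_real (1 / x) * (of_real (k2 u) * V u) = of_real (\<phi> u) * V u"
        unfolding V E_def by (simp add: algebra_simps)
    qed
    have "(\<Sum>p\<in>Pr x. a p * of_real ((1 - real p / x) / ln (real p))) =
       A x / of_real (ln x) + (I1 - \<mu> * of_real ((ln (ln x) - 2 / ln x) - (ln (ln 2) - 2 / ln 2)) - of_real (1 / x) * I2)"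
      using has_integral_unique[OF 1 2] by (simp add: algebra_simps)
    moreover have "A x / of_real (ln x) = - \<mu> + E x / of_real (ln x)"
      using lx by (simp add: E_def field_simps)
    ultimately have "(\<Sum>p\<in>Pr x. a p * of_real ((1 - real p / x) / ln (real p))) - (- \<mu> * of_real (ln (ln x)) + C) =
       E x / of_real (ln x) + \<mu> * of_real (2 / ln x) + (I1 - C') - of_real (1 / x) * I2"
      unfolding C_def by (simp only: of_real_diff right_diff_distrib) (simp add: algebra_simps)
    also have "norm \<dots> \<le> K * (l x / ln x) + 2 * norm \<mu> * (l x / ln x) + 8 * K * (l x / ln x) + 4 * (norm \<mu> + K) * 16 * (l x / ln x)"
    proof (rule order_trans[OF tri], intro add_mono)
      show "norm (E x / of_real (ln x)) \<le> K * (l x / ln x)"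
        using divide_right_mono[OF K(1)[OF x2], of "ln x"] lx by (simp add: norm_divide)
      have "1 / ln x \<le> l x / ln x" using l1 lx by (intro divide_right_mono) auto
      then have "2 * norm \<mu> * (1 / ln x) \<le> 2 * norm \<mu> * (l x / ln x)" by (intro mult_left_mono) auto
      then show "norm (\<mu> * of_real (2 / ln x)) \<le> 2 * norm \<mu> * (l x / ln x)" using lx by (simp add: norm_mult norm_divide mult_ac)
      have "(2 + ln (ln x)) / ln x \<le> 2 * (l x / ln x)"
        using l1 lx by (simp add: l_def divide_right_mono)
      then have "4 * K * ((2 + ln (ln x)) / ln x) \<le> 4 * K * (2 * (l x / ln x))" using K(2) by (intro mult_left_mono) auto
      then show "norm (I1 - C') \<le> 8 * K * (l x / ln x)" using C'[OF x2] by (simp add: I1_def)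
      have "norm I2 \<le> integral {2..x} (\<lambda>u. 4 * (norm \<mu> + K) * (1 / ln u))"
        unfolding I2_def
      proof (rule integral_norm_bound_integral)
        show "(\<lambda>u. of_real (k2 u) * V u) integrable_on {2..x}" using J2 by blast
        show "(\<lambda>u. 4 * (norm \<mu> + K) * (1 / ln u)) integrable_on {2..x}"
          by (intro integrable_on_mult_right integral_inverse_ln_le(1)[OF x])
        fix u assume "u \<in> {2..x}"
        then have u: "2 \<le> u" by simp
        have L: "0 < ln u" "0 < u" using lnu[OF u] u by auto
        have "\<bar>k2 u\<bar> \<le> k u" using L unfolding k2_def k_def by (intro abs_leI) auto
        then have k2: "\<bar>k2 u\<bar> \<le> 4 / (u * (ln u)\<^sup>2)" using k_bd(2)[OF u] by linarith
        have "norm (A u) \<le> norm (E u) + norm (\<mu> * of_real (ln u))"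
          unfolding E_def using norm_triangle_ineq4[of "A u + \<mu> * of_real (ln u)" "\<mu> * of_real (ln u)"] by simp
        also have "norm (\<mu> * of_real (ln u)) = norm \<mu> * ln u" using L by (simp add: norm_mult)
        also have "norm (E u) \<le> K * ln u" using K(1)[OF u] mult_left_mono[OF l_upper[OF u] K(2)] by linarith
        finally have A: "norm (A u) \<le> (norm \<mu> + K) * ln u" by (simp add: algebra_simps)
        have "norm (V u) = u * norm (A u)" using L by (simp add: A_def norm_divide)
        also have "\<dots> \<le> u * ((norm \<mu> + K) * ln u)" using A L by (intro mult_left_mono) auto
        finally have "norm (of_real (k2 u) * V u) \<le> (4 / (u * (ln u)\<^sup>2)) * (u * ((norm \<mu> + K) * ln u))"
          unfolding norm_mult norm_of_real using k2 L by (intro mult_mono) auto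
        also have "\<dots> = 4 * (norm \<mu> + K) * (1 / ln u)" using L by (simp add: power2_eq_square)
        finally show "norm (of_real (k2 u) * V u) \<le> 4 * (norm \<mu> + K) * (1 / ln u)" .
      qed
      also have "\<dots> = 4 * (norm \<mu> + K) * integral {2..x} (\<lambda>u. 1 / ln u)" by (rule integral_mult_right)
      also have "\<dots> \<le> 4 * (norm \<mu> + K) * (14 + 2 * (x / ln x))"
        using integral_inverse_ln_le(2)[OF x] K(2) by (intro mult_left_mono) auto
      also have "\<dots> \<le> 4 * (norm \<mu> + K) * (16 * (x / ln x))"
      proof -
        have "1 \<le> x / ln x" using ln_le_minus_one[OF x0] lx by (simp add: field_simps)
        then show ?thesis using K(2) by (intro mult_left_mono) auto
      qed
      finally have "norm I2 \<le> 4 * (norm \<mu> + K) * (16 * (x / ln x))" .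
      then have "1 / x * norm I2 \<le> 1 / x * (4 * (norm \<mu> + K) * (16 * (x / ln x)))" using x0 by (intro mult_left_mono) auto
      also have "\<dots> = 4 * (norm \<mu> + K) * 16 * (1 / ln x)" using x0 by simp
      also have "\<dots> \<le> 4 * (norm \<mu> + K) * 16 * (l x / ln x)"
        using \<open>1 / ln x \<le> l x / ln x\<close> K(2) by (intro mult_left_mono) auto
      finally show "norm (of_real (1 / x) * I2) \<le> 4 * (norm \<mu> + K) * 16 * (l x / ln x)"
        using x0 by (simp add: norm_mult norm_divide)
    qed
    also have "\<dots> = KK * (l x / ln x)" by (simp only: KK_def distrib_right)
    finally show "norm ((\<Sum>p\<in>Pr x. a p * of_real ((1 - real p / x) / ln (real p))) - (- \<mu> * of_real (ln (ln x)) + C))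
     \<le> KK * ((1 + ln (ln x)) / ln x)" by (simp add: l_def)
  qed
qed

section \<open>Averages over residue classes\<close>

text \<open>Orthogonality attaches \<open>cnj chi\<close> to the primes while \<open>M_const\<close>
  is written with \<open>chi\<close>. Conjugating the series relates the two L-functions by
  \<open>cnj (L (cnj s))\<close>; as 1/2 is fixed by conjugation, the local factorisation there is
  carried over with the same exponent.\<close>

lemma m_chi_cnj:
  assumes q: "q > 1" and GRH: "GRH_mod q" and chi: "chi \<in> nonprincipal_chars q"
  shows "m_chi (\<lambda>n. cnj (chi n)) = m_chi chi"
proof -
  let ?S = "{s. 0 < Re s}" and ?L = "dirichlet_L chi"
  let ?g = "zor_poly ?L (1/2)" and ?n = "zorder ?L (1/2)"
  have c: "dirichlet_char q chi" "chi \<noteq> principal_char q" using chi by (auto simp: nonprincipal_chars_def)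
  obtain B where B: "\<And>N. norm (\<Sum>n=1..N. chi n) \<le> B"
    using periodic_sums_bounded[of q chi] sum_nonprincipal_char[OF c] q c(1) unfolding dirichlet_char_def by auto
  have cnjL: "dirichlet_L (\<lambda>n. cnj (chi n)) s = cnj (?L (cnj s))" if "0 < Re s" for s
  proof -
    have "(\<lambda>n. chi n / of_nat n powr cnj s) sums ?L (cnj s)"
      by (rule dirichlet_L_bounded_sums(1)[OF B]) (use that in simp)
    then have "(\<lambda>n. cnj (chi n / of_nat n powr cnj s)) sums cnj (?L (cnj s))" by (simp only: sums_cnj)
    moreover have "cnj (chi n / of_nat n powr cnj s) = cnj (chi n) / of_nat n powr s" for n
      by (cases "n = 0") (simp_all add: powr_def exp_cnj)
    ultimately have "(\<lambda>n. cnj (chi n) / of_nat n powr s) sums cnj (?L (cnj s))" by (simp only:)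
    then show ?thesis unfolding dirichlet_L_def[of "\<lambda>n. cnj (chi n)"] by (rule sums_unique[symmetric])
  qed
  have hol: "?L holomorphic_on ?S" by (rule dirichlet_L_bounded_sums(2)[OF B])
  have nz: "?L s \<noteq> 0" if "1/2 < Re s" for s using GRH chi that unfolding GRH_mod_def by blast
  have n0: "?n \<ge> 0" by (rule tame_near_half(2)[OF tame_dirichlet_L[OF q GRH chi]])
  have "(if ?L (1/2) = 0 then ?n > 0 else ?n = 0) \<and> (\<exists>r. r>0 \<and> cball (1/2) r \<subseteq> ?S \<and> ?g holomorphic_on cball (1/2) r
    \<and> (\<forall>w\<in>cball (1/2) r. ?L w = ?g w * (w - 1/2) ^ nat ?n \<and> ?g w \<noteq> 0))"
  proof (rule zorder_exist_zero[OF hol])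
    show "open ?S" by (rule open_halfspace_Re_gt)
    show "connected ?S" by (intro convex_connected convex_halfspace_Re_gt)
    show "\<exists>w\<in>?S. ?L w \<noteq> 0" using nz[of 1] by (intro bexI[of _ 1]) auto
  qed auto
  then obtain r where r: "r > 0" "cball (1/2) r \<subseteq> ?S" "?g holomorphic_on cball (1/2) r"
    "\<And>w. w \<in> cball (1/2) r \<Longrightarrow> ?L w = ?g w * (w - 1/2) ^ nat ?n" "\<And>w. w \<in> cball (1/2) r \<Longrightarrow> ?g w \<noteq> 0" by blast
  have cb: "cnj w \<in> ball (1/2) r" if "w \<in> ball (1/2) r" for w
  proof -
    have "dist (1/2) (cnj w) = norm (cnj (1/2 - w))" by (simp add: dist_norm)
    also have "\<dots> = dist (1/2) w" by (simp only: complex_mod_cnj dist_norm)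
    finally show ?thesis using that by simp
  qed
  have "zorder (dirichlet_L (\<lambda>n. cnj (chi n))) (1/2) = ?n"
  proof (rule zorder_eqI[where S = "ball (1/2) r" and g = "cnj \<circ> ?g \<circ> cnj"])
    show "cnj \<circ> ?g \<circ> cnj holomorphic_on ball (1/2) r"
      by (rule holomorphic_on_compose_cnj_cnj[OF holomorphic_on_subset[OF r(3)]]) (use cb in force)+
    show "(cnj \<circ> ?g \<circ> cnj) (1/2) \<noteq> 0" using r(1) r(5)[of "1/2"] by simp
    fix w :: complex assume w: "w \<in> ball (1/2) r" "w \<noteq> 1/2"
    have "0 < Re w" using w(1) r(2) ball_subset_cball by blast
    then have "dirichlet_L (\<lambda>n. cnj (chi n)) w = cnj (?L (cnj w))" by (rule cnjL)
    also have "?L (cnj w) = ?g (cnj w) * (cnj w - 1/2) ^ nat ?n" using cb[OF w(1)] by (intro r(4)) auto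
    also have "cnj \<dots> = (cnj \<circ> ?g \<circ> cnj) w * (w - 1/2) ^ nat ?n" by simp
    also have "(w - 1/2) ^ nat ?n = (w - 1/2) powi ?n" using n0 by (simp add: power_int_def)
    finally show "dirichlet_L (\<lambda>n. cnj (chi n)) w = (cnj \<circ> ?g \<circ> cnj) w * (w - 1/2) powi ?n" .
  qed (use r(1) in auto)
  then show ?thesis by (simp add: m_chi_def)
qed

lemma nonprincipal_cnj:
  assumes "chi \<in> nonprincipal_chars q"
  shows "(\<lambda>n. cnj (chi n)) \<in> nonprincipal_chars q"
proof -
  have "(\<lambda>n. cnj (chi n)) \<noteq> principal_char q"
  proof
    assume *: "(\<lambda>n. cnj (chi n)) = principal_char q"
    have "chi n = principal_char q n" for n
    proof -
      have "cnj (chi n) = principal_char q n" using fun_cong[OF *, of n] .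
      then have "chi n = cnj (principal_char q n)" by (metis complex_cnj_cnj)
      then show ?thesis by (simp add: principal_char_def)
    qed
    then show False using assms by (auto simp: nonprincipal_chars_def)
  qed
  then show ?thesis using assms dirichlet_char_cnj by (auto simp: nonprincipal_chars_def)
qed

lemma square_principal_cnj_iff:
  "(\<lambda>n. cnj (chi n) ^ 2) = principal_char q \<longleftrightarrow> (\<lambda>n. chi n ^ 2) = principal_char q"
proof -
  have "cnj (chi n) ^ 2 = principal_char q n \<longleftrightarrow> chi n ^ 2 = principal_char q n" for n
  proof -
    have "cnj (principal_char q n) = principal_char q n" by (simp add: principal_char_def)
    then have "cnj (chi n) ^ 2 = principal_char q n \<longleftrightarrow> cnj (chi n ^ 2) = cnj (principal_char q n)" by simp
    then show ?thesis by (simp only: complex_cnj_cancel_iff)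
  qed
  then show ?thesis by (simp only: fun_eq_iff)
qed

text \<open>Conjugation permutes the nonprincipal characters and preserves \<open>m_chi\<close>, so
  the sum equals its own conjugate. This is what permits the final constant to be chosen
  real.\<close>

lemma M_const_real:
  assumes q: "q > 1" and GRH: "GRH_mod q"
  shows "M_const q a b = of_real (Re (M_const q a b))"
proof -
  let ?NP = "nonprincipal_chars q"
  define S where "S = (\<Sum>chi\<in>?NP. (chi a - chi b) * of_int (m_chi chi))"
  have "bij_betw (\<lambda>chi n. cnj (chi n)) ?NP ?NP"
    by (rule bij_betwI[where g = "\<lambda>chi n. cnj (chi n)"]) (auto intro: nonprincipal_cnj)
  then have "S = (\<Sum>chi\<in>?NP. (cnj (chi a) - cnj (chi b)) * of_int (m_chi (\<lambda>n. cnj (chi n))))"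
    unfolding S_def by (rule sum.reindex_bij_betw[symmetric])
  also have "\<dots> = (\<Sum>chi\<in>?NP. cnj ((chi a - chi b) * of_int (m_chi chi)))"
    by (intro sum.cong refl) (simp add: m_chi_cnj[OF q GRH])
  also have "\<dots> = cnj S" by (simp add: S_def)
  finally have "S \<in> \<real>" by (metis Reals_cnj_iff)
  then have "M_const q a b \<in> \<real>" unfolding M_const_def S_def[symmetric] by (intro Reals_mult Reals_add Reals_divide) auto
  then show ?thesis by simp
qed

text \<open>The count of square roots is distributed over the characters with principal square, each
  receiving the extra 1/2 found in the residue; the principal character drops out because it takes
  the value 1 at both \<open>a\<close> and \<open>b\<close>.\<close>

lemma M_const_eq:
  assumes q: "q > 1" and a: "coprime a q" and b: "coprime b q"
  shows "M_const q a b = 1 / of_nat (totient q) * (\<Sum>chi\<in>nonprincipal_chars q. (chi a - chi b) *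
     (of_int (m_chi chi) + (if (\<lambda>n. chi n ^ 2) = principal_char q then 1/2 else 0)))"
proof -
  let ?D = "{chi. dirichlet_char q chi}" and ?NP = "nonprincipal_chars q"
  let ?s = "\<lambda>chi. (\<lambda>n. chi n ^ 2) = principal_char q"
  have fin: "finite ?D" using q by (intro finite_dirichlet_chars) simp
  have NP: "?D = insert (principal_char q) ?NP" "principal_char q \<notin> ?NP"
    using dirichlet_char_principal by (auto simp: nonprincipal_chars_def)
  have finNP: "finite ?NP" using fin NP(1) by simp
  have "of_nat (r_sq q a) - of_nat (r_sq q b) = (\<Sum>chi\<in>{chi. dirichlet_char q chi \<and> ?s chi}. chi a - chi b)"
    using r_sq_eq_sum_chars[OF q a] r_sq_eq_sum_chars[OF q b] by (simp add: sum_subtractf)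
  also have "{chi. dirichlet_char q chi \<and> ?s chi} = {chi\<in>?D. ?s chi}" by simp
  also have "(\<Sum>chi\<in>{chi\<in>?D. ?s chi}. chi a - chi b) = (\<Sum>chi\<in>?D. if ?s chi then chi a - chi b else 0)"
    by (rule sum.inter_filter[OF fin])
  also have "\<dots> = (\<Sum>chi\<in>?NP. if ?s chi then chi a - chi b else 0)"
    unfolding NP(1) using a b by (subst sum.insert[OF finNP NP(2)]) (simp add: principal_char_def)
  finally have r: "of_nat (r_sq q a) - of_nat (r_sq q b) = (\<Sum>chi\<in>?NP. if ?s chi then chi a - chi b else 0)" .
  have "(\<Sum>chi\<in>?NP. (chi a - chi b) * (of_int (m_chi chi) + (if ?s chi then 1/2 else 0))) =
    (\<Sum>chi\<in>?NP. (chi a - chi b) * of_int (m_chi chi)) + (\<Sum>chi\<in>?NP. (if ?s chi then chi a - chi b else 0) / 2)"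
    unfolding sum.distrib[symmetric] by (intro sum.cong refl) (simp add: distrib_left)
  also have "(\<Sum>chi\<in>?NP. (if ?s chi then chi a - chi b else 0) / 2) = (of_nat (r_sq q a) - of_nat (r_sq q b)) / 2"
    unfolding r by (rule sum_divide_distrib[symmetric])
  finally have "(\<Sum>chi\<in>?NP. (chi a - chi b) * (of_int (m_chi chi) + (if ?s chi then 1/2 else 0))) =
    (\<Sum>chi\<in>?NP. (chi a - chi b) * of_int (m_chi chi)) + (of_nat (r_sq q a) - of_nat (r_sq q b)) / 2" .
  moreover have "1 / (2 * t) * (u + 2 * v) = 1 / t * (v + u / 2)" for t u v :: complex
    by (simp add: field_simps)
  ultimately show ?thesis unfolding M_const_def by (simp only: of_int_diff of_int_of_nat_eq)
qed

section \<open>From the averaged prime counts to smoothed character sums\<close>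

text \<open>The summand of a prime \<open>p\<close> is a step that switches on at \<open>p\<close>;
  integrating it up to \<open>x\<close> produces the weight \<open>x - p\<close>.\<close>

lemma pi_half_integral:
  fixes q c :: nat and x :: real
  assumes x: "2 \<le> x"
  shows "((\<lambda>u. pi_half u q c) has_integral (\<Sum>p | prime p \<and> real p \<le> x. (if [p = c] (mod q) then 1 / sqrt (real p) else 0) * (x - real p))) {2..x}"
proof -
  let ?Pr = "{p :: nat. prime p \<and> real p \<le> x}"
  let ?c = "\<lambda>p. if [p = c] (mod q) then 1 / sqrt (real p) else 0"
  have "((\<lambda>u. \<Sum>p\<in>?Pr. if u \<in> {real p..x} then ?c p else 0) has_integral (\<Sum>p\<in>?Pr. ?c p * (x - real p))) {2..x}"
  proof (intro has_integral_sum finite_primes_le)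
    fix p assume "p \<in> ?Pr"
    then have p: "2 \<le> real p" "real p \<le> x" using prime_ge_2_nat by auto
    have "((\<lambda>u. ?c p) has_integral (?c p * (x - real p))) {real p..x}"
      using has_integral_const_real[of "?c p" "real p" x] p by (simp add: mult.commute)
    then show "((\<lambda>u. if u \<in> {real p..x} then ?c p else 0) has_integral (?c p * (x - real p))) {2..x}"
      by (subst has_integral_restrict) (use p in auto)
  qed
  then show ?thesis
  proof (rule has_integral_eq[rotated])
    fix u assume u: "u \<in> {2..x}"
    have "pi_half u q c = (\<Sum>p | prime p \<and> real p \<le> u \<and> [p = c] (mod q). ?c p)"
      unfolding pi_half_def by (intro sum.cong refl) auto
    also have "\<dots> = (\<Sum>p\<in>?Pr. if u \<in> {real p..x} then ?c p else 0)"
      by (rule sum.mono_neutral_cong_left[OF finite_primes_le]) (use u in auto)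
    finally show "(\<Sum>p\<in>?Pr. if u \<in> {real p..x} then ?c p else 0) = pi_half u q c" by simp
  qed
qed

lemma smoothed_char_sum_asymptotics:
  assumes q: "q > 1" and GRH: "GRH_mod q" and chi: "chi \<in> nonprincipal_chars q"
  shows "\<exists>C K. \<forall>x\<ge>exp 2. norm ((\<Sum>p | prime p \<and> real p \<le> x. chi p * of_real ((1 - real p / x) / sqrt (real p))) -
     (- (of_int (m_chi chi) + (if (\<lambda>n. chi n ^ 2) = principal_char q then 1/2 else 0)) * of_real (ln (ln x)) + C)) \<le> K * ((1 + ln (ln x)) / ln x)"
proof -
  define \<mu> where "\<mu> = of_int (m_chi chi) + (if (\<lambda>n. chi n ^ 2) = principal_char q then 1/2 else (0::complex))"
  define a where "a = (\<lambda>p. chi p * of_real (ln (real p) / sqrt (real p)))"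
  obtain D where D: "\<And>x. exp 1 \<le> x \<Longrightarrow> norm ((\<Sum>p | prime p \<and> real p \<le> x. chi p * of_real (ln (real p) / sqrt (real p) * (1 - real p / x))) + \<mu> * of_real (ln x)) \<le> D * (1 + ln (ln x))"
    using prime_sum_asymptotics[OF q GRH chi] unfolding \<mu>_def by blast
  have "\<exists>C K. \<forall>x\<ge>exp 2. norm ((\<Sum>p | prime p \<and> real p \<le> x. a p * of_real ((1 - real p / x) / ln (real p))) - (- \<mu> * of_real (ln (ln x)) + C))
     \<le> K * ((1 + ln (ln x)) / ln x)"
    by (rule partial_summation[of a \<mu> D]) (use D in \<open>simp add: a_def mult.assoc\<close>)
  moreover have "a p * of_real ((1 - real p / x) / ln (real p)) = chi p * of_real ((1 - real p / x) / sqrt (real p))" if "prime p" for p x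
  proof -
    have "ln (real p) \<noteq> 0" using prime_gt_1_nat[OF that] by simp
    then show ?thesis by (simp add: a_def)
  qed
  then have "(\<Sum>p | prime p \<and> real p \<le> x. a p * of_real ((1 - real p / x) / ln (real p))) = (\<Sum>p | prime p \<and> real p \<le> x. chi p * of_real ((1 - real p / x) / sqrt (real p)))" for x
    by (intro sum.cong refl) auto
  ultimately show ?thesis unfolding \<mu>_def by simp
qed

text \<open>Orthogonality is applied to the difference of the two classes, so that the contribution
  of the principal character cancels before any asymptotics are taken.\<close>

lemma averaged_difference_eq:
  assumes q: "q > 1" and a: "coprime a q" and b: "coprime b q" and x: "2 \<le> x"
  shows "complex_of_real (integral {2..x} (\<lambda>u. pi_half u q a - pi_half u q b) / x) =
    1 / of_nat (totient q) * (\<Sum>chi\<in>nonprincipal_chars q. (chi a - chi b) *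
       (\<Sum>p | prime p \<and> real p \<le> x. cnj (chi p) * of_real ((1 - real p / x) / sqrt (real p))))"
proof -
  let ?D = "{chi. dirichlet_char q chi}" and ?NP = "nonprincipal_chars q" and ?Pr = "{p :: nat. prime p \<and> real p \<le> x}"
  let ?w = "\<lambda>p. (1 - real p / x) / sqrt (real p)"
  let ?i = "\<lambda>c p. if [p = c] (mod q) then 1 else (0::complex)"
  have fin: "finite ?D" using q by (intro finite_dirichlet_chars) simp
  have NP: "?D = insert (principal_char q) ?NP" "principal_char q \<notin> ?NP"
    using dirichlet_char_principal by (auto simp: nonprincipal_chars_def)
  have finNP: "finite ?NP" using fin NP(1) by simp
  have t0: "(of_nat (totient q) :: complex) \<noteq> 0" using q by simp
  have orth: "?i a p - ?i b p = 1 / of_nat (totient q) * (\<Sum>chi\<in>?NP. (chi a - chi b) * cnj (chi p))" for p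
  proof -
    have "(\<Sum>chi\<in>?D. (chi a - chi b) * cnj (chi p)) = of_nat (totient q) * (?i a p - ?i b p)"
      unfolding left_diff_distrib sum_subtractf char_orthogonality[OF q a] char_orthogonality[OF q b] by simp
    also have "(\<Sum>chi\<in>?D. (chi a - chi b) * cnj (chi p)) = (\<Sum>chi\<in>?NP. (chi a - chi b) * cnj (chi p))"
      unfolding NP(1) using a b by (subst sum.insert[OF finNP NP(2)]) (simp add: principal_char_def)
    finally show ?thesis using t0 by (simp add: field_simps)
  qed
  have int: "integral {2..x} (\<lambda>u. pi_half u q a - pi_half u q b) =
    (\<Sum>p\<in>?Pr. (if [p = a] (mod q) then 1 / sqrt (real p) else 0) * (x - real p)) - (\<Sum>p\<in>?Pr. (if [p = b] (mod q) then 1 / sqrt (real p) else 0) * (x - real p))"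
    by (intro integral_unique has_integral_diff pi_half_integral x)
  have div: "integral {2..x} (\<lambda>u. pi_half u q a - pi_half u q b) / x =
    (\<Sum>p\<in>?Pr. ((if [p = a] (mod q) then 1 else 0) - (if [p = b] (mod q) then 1 else 0)) * ?w p)"
    unfolding int sum_subtractf[symmetric] sum_divide_distrib
  proof (intro sum.cong refl)
    fix p
    have "(x - real p) / x = 1 - real p / x" using x by (simp add: diff_divide_distrib)
    moreover have "(u * (x - real p) - v * (x - real p)) / x = (u - v) * ((x - real p) / x)" for u v
      by (simp add: left_diff_distrib)
    ultimately show "((if [p = a] (mod q) then 1 / sqrt (real p) else 0) * (x - real p) - (if [p = b] (mod q) then 1 / sqrt (real p) else 0) * (x - real p)) / x =
      ((if [p = a] (mod q) then 1 else 0) - (if [p = b] (mod q) then 1 else 0)) * ?w p" by (simp add: diff_divide_distrib)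
  qed
  have "complex_of_real (integral {2..x} (\<lambda>u. pi_half u q a - pi_half u q b) / x) =
    complex_of_real (\<Sum>p\<in>?Pr. ((if [p = a] (mod q) then 1 else 0) - (if [p = b] (mod q) then 1 else 0)) * ?w p)"
    by (simp only: div)
  also have "\<dots> = (\<Sum>p\<in>?Pr. (?i a p - ?i b p) * of_real (?w p))"
    unfolding of_real_sum
  proof (intro sum.cong refl)
    show "complex_of_real (((if [p = a] (mod q) then 1 else 0) - (if [p = b] (mod q) then 1 else 0)) * ?w p) = (?i a p - ?i b p) * of_real (?w p)" for p
      by (cases "[p = a] (mod q)"; cases "[p = b] (mod q)") (simp_all only: if_True if_False of_real_mult of_real_diff of_real_1 of_real_0)
  qed
  also have "\<dots> = (\<Sum>p\<in>?Pr. \<Sum>chi\<in>?NP. 1 / of_nat (totient q) * ((chi a - chi b) * (cnj (chi p) * of_real (?w p))))"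
    unfolding orth by (intro sum.cong refl) (simp only: sum_distrib_left sum_distrib_right mult.assoc)
  also have "\<dots> = (\<Sum>chi\<in>?NP. \<Sum>p\<in>?Pr. 1 / of_nat (totient q) * ((chi a - chi b) * (cnj (chi p) * of_real (?w p))))"
    by (rule sum.swap)
  also have "\<dots> = 1 / of_nat (totient q) * (\<Sum>chi\<in>?NP. (chi a - chi b) * (\<Sum>p\<in>?Pr. cnj (chi p) * of_real (?w p)))"
    by (simp only: sum_distrib_left)
  finally show ?thesis .
qed

theorem theorem1p4:
  fixes q a b :: nat
  assumes "q \<ge> 3" and "GRH_mod q"
    and "a < q" and "b < q" and "coprime a q" and "coprime b q" and "a \<noteq> b"
  shows "\<exists>C::real. (\<lambda>x::real. complex_of_real
            (integral {2..x} (\<lambda>u. pi_half u q a - pi_half u q b) / x)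
          - (- M_const q a b * of_real (ln (ln x)) + of_real C))
        \<in> O[at_top](\<lambda>x. complex_of_real (ln (ln x) / ln x))"
proof -
  have q: "q > 1" using assms(1) by simp
  note GRH = assms(2)
  let ?NP = "nonprincipal_chars q"
  let ?T = "1 / of_nat (totient q) :: complex"
  let ?P = "\<lambda>chi x. \<Sum>p | prime p \<and> real p \<le> x. cnj (chi p) * of_real ((1 - real p / x) / sqrt (real p))"
  let ?F = "\<lambda>x. integral {2..x} (\<lambda>u. pi_half u q a - pi_half u q b) / x"
  define \<mu> where "\<mu> = (\<lambda>chi. of_int (m_chi chi) + (if (\<lambda>n. chi n ^ 2) = principal_char q then 1/2 else (0::complex)))"
  \<comment> \<open>The asymptotics are applied to the conjugate character; \<open>m_chi\<close> and
    the condition on the square are invariant under conjugation.\<close>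
  have "\<exists>C. \<exists>K. \<forall>x\<ge>exp 2. norm (?P chi x - (- \<mu> chi * of_real (ln (ln x)) + C)) \<le> K * ((1 + ln (ln x)) / ln x)" if "chi \<in> ?NP" for chi
    using smoothed_char_sum_asymptotics[OF q GRH nonprincipal_cnj[OF that]]
    unfolding m_chi_cnj[OF q GRH that] square_principal_cnj_iff \<mu>_def .
  then obtain C where "\<forall>chi\<in>?NP. \<exists>K. \<forall>x\<ge>exp 2. norm (?P chi x - (- \<mu> chi * of_real (ln (ln x)) + C chi)) \<le> K * ((1 + ln (ln x)) / ln x)"
    using bchoice[of ?NP "\<lambda>chi C. \<exists>K. \<forall>x\<ge>exp 2. norm (?P chi x - (- \<mu> chi * of_real (ln (ln x)) + C)) \<le> K * ((1 + ln (ln x)) / ln x)"] by blast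
  then obtain K where CK: "\<And>chi x. chi \<in> ?NP \<Longrightarrow> exp 2 \<le> x \<Longrightarrow>
      norm (?P chi x - (- \<mu> chi * of_real (ln (ln x)) + C chi)) \<le> K chi * ((1 + ln (ln x)) / ln x)"
    using bchoice[of ?NP "\<lambda>chi K. \<forall>x\<ge>exp 2. norm (?P chi x - (- \<mu> chi * of_real (ln (ln x)) + C chi)) \<le> K * ((1 + ln (ln x)) / ln x)"] by blast
  define C0 where "C0 = ?T * (\<Sum>chi\<in>?NP. (chi a - chi b) * C chi)"
  define K0 where "K0 = norm ?T * (\<Sum>chi\<in>?NP. norm (chi a - chi b) * K chi)"
  have M: "M_const q a b = ?T * (\<Sum>chi\<in>?NP. (chi a - chi b) * \<mu> chi)"
    unfolding \<mu>_def by (rule M_const_eq[OF q assms(5,6)])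
  have main: "norm (of_real (?F x) - (- M_const q a b * of_real (ln (ln x)) + C0)) \<le> K0 * ((1 + ln (ln x)) / ln x)"
    if x: "exp 2 \<le> x" for x
  proof -
    have x2: "2 \<le> x" using x exp_ge_add_one_self[of 2] by simp
    have "of_real (?F x) - (- M_const q a b * of_real (ln (ln x)) + C0) =
       ?T * (\<Sum>chi\<in>?NP. (chi a - chi b) * (?P chi x - (- \<mu> chi * of_real (ln (ln x)) + C chi)))"
      unfolding averaged_difference_eq[OF q assms(5,6) x2] M C0_def
      by (simp add: sum_subtractf sum.distrib right_diff_distrib distrib_left sum_distrib_left sum_distrib_right sum_negf mult_ac)
    also have "norm \<dots> \<le> norm ?T * (\<Sum>chi\<in>?NP. norm (chi a - chi b) * (K chi * ((1 + ln (ln x)) / ln x)))"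
      unfolding norm_mult[of ?T]
    proof (intro mult_left_mono sum_norm_le)
      fix chi assume "chi \<in> ?NP"
      from CK[OF this x] show "norm ((chi a - chi b) * (?P chi x - (- \<mu> chi * of_real (ln (ln x)) + C chi))) \<le> norm (chi a - chi b) * (K chi * ((1 + ln (ln x)) / ln x))"
        unfolding norm_mult by (intro mult_left_mono) auto
    qed simp
    also have "\<dots> = K0 * ((1 + ln (ln x)) / ln x)"
      unfolding K0_def by (simp only: sum_distrib_right mult.assoc)
    finally show ?thesis .
  qed
  show ?thesis
  \<comment> \<open>So far the constant is complex; since the average and \<open>M_const\<close> are
    real, taking real parts can only decrease the error.\<close>
  proof (rule exI[of _ "Re C0"], rule bigoI[where c = "2 * \<bar>K0\<bar>"])
    show "\<forall>\<^sub>F x in at_top. norm (of_real (?F x) - (- M_const q a b * of_real (ln (ln x)) + of_real (Re C0))) \<le>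
       2 * \<bar>K0\<bar> * norm (complex_of_real (ln (ln x) / ln x))"
    \<comment> \<open>From here on \<open>ln (ln x) \<ge> 1\<close>, which absorbs the summand 1 in
      the error term.\<close>
    proof (rule eventually_at_top_linorderI[of "exp (exp 1)"])
      fix x :: real assume x: "exp (exp 1) \<le> x"
      have "2 \<le> exp (1::real)" using exp_ge_add_one_self[of 1] by simp
      then have "exp 2 \<le> x" using x by (metis exp_le_cancel_iff order_trans)
      have x0: "0 < x" using x exp_gt_zero[of "exp 1"] by linarith
      have lx: "exp 1 \<le> ln x" using x x0 by (subst ln_ge_iff) auto
      then have lx0: "0 < ln x" using exp_gt_zero[of "1::real"] by linarith
      have llx: "1 \<le> ln (ln x)" using lx lx0 by (subst ln_ge_iff) auto
      let ?z = "of_real (?F x) - (- M_const q a b * of_real (ln (ln x)) + C0)"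
      have "of_real (?F x) - (- M_const q a b * of_real (ln (ln x)) + of_real (Re C0)) = of_real (Re ?z)"
        using M_const_real[OF q GRH, of a b] by (simp add: complex_eq_iff)
      also have "norm \<dots> \<le> norm ?z" unfolding norm_of_real by (rule abs_Re_le_cmod)
      also have "\<dots> \<le> K0 * ((1 + ln (ln x)) / ln x)" by (rule main) fact
      also have "\<dots> \<le> \<bar>K0\<bar> * (2 * (ln (ln x) / ln x))"
      proof (rule mult_mono)
        show "(1 + ln (ln x)) / ln x \<le> 2 * (ln (ln x) / ln x)"
          using llx lx0 by (simp add: divide_right_mono)
      qed (use llx lx0 in auto)
      also have "\<dots> = 2 * \<bar>K0\<bar> * norm (complex_of_real (ln (ln x) / ln x))"
      proof -
        have "0 \<le> ln (ln x) / ln x" using llx lx0 by (intro divide_nonneg_nonneg; linarith)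
        then show ?thesis by (simp only: norm_of_real abs_of_nonneg) simp
      qed
      finally show "norm (of_real (?F x) - (- M_const q a b * of_real (ln (ln x)) + of_real (Re C0))) \<le>
       2 * \<bar>K0\<bar> * norm (complex_of_real (ln (ln x) / ln x))" .
    qed
  qed
qed

end
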